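(* Fix $\lambda_*\in(0,1)$ and suppose that $\mathbb{E}[e^{pZ_0}]<+\infty$ for some $p\ge 2$. Then $$\sup_{\lambda\in[0,\lambda_*]}\Big\|\frac{d\mathbb{Q}_\lambda}{d\mathbb{Q}_0}\Big\|_{L^p(\mathbb{Q}_0)}<\infty .$$
   Context: An environment is a sequence $\omega=(Z_k,E_k)_{k\in\mathbb{Z}}\in\Omega:=((0,+\infty)\times\mathbb{R})^{\mathbb{Z}}$; $Z_k,E_k$ also denote the coordinate maps on $\Omega$. For $\ell\in\mathbb{Z}$, $\tau_\ell\omega:=(Z_{k+\ell},E_{k+\ell})_{k\in\mathbb{Z}}$. $\mathbb{P}$ is a probability on $\Omega$ with expectation $\mathbb{E}$, satisfying the standing assumptions: (A1) $(Z_k,E_k)_{k\in\mathbb{Z}}$ is stationary and ergodic with respect to shifts; (A2) $\mathbb{E}[Z_0]<\infty$; (A3) $\mathbb{P}(\omega=\tau_\ell\omega)=0$ for all $\ell\in\mathbb{Z}\setminus\{0\}$; (A4) there is $d>0$ with $\mathbb{P}(Z_0\ge d)=1$. Set $x_0=0$, $x_{k+1}=x_k+Z_k$. Fix a symmetric bounded continuous $u:\mathbb{R}\times\mathbb{R}\to\mathbb{R}$. For $\lambda\in[0,1)$ let $r^\lambda_{i,k}(\omega)=\exp\{-|x_i-x_k|+\lambda(x_k-x_i)+u(E_i,E_k)\}$ for $i\ne k$, $r^\lambda_{i,i}=0$, and $p^\lambda_{i,k}=r^\lambda_{i,k}/\sum_{j}r^\lambda_{i,j}$. The discrete-time Mott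 random walk $(Y^\lambda_n)$ is the Markov chain on $\{x_k\}$ started at $0$ jumping from $x_i$ to $x_k$ with probability $p^\lambda_{i,k}$. The environment viewed from the walker is the Markov chain on $\Omega$ jumping from $\omega$ to $\tau_k\omega$ with probability $p^\lambda_{0,k}(\omega)$. When $\lambda=0$ the index $\lambda$ is omitted. Let $\pi=\sum_k r_{0,k}$ and $\mathbb{Q}_0(d\omega)=\frac{\pi(\omega)}{\mathbb{E}[\pi]}\mathbb{P}(d\omega)$ (reversible for the $\lambda=0$ environment chain). For $\lambda\in(0,1)$ with $\mathbb{E}[e^{(1-\lambda)Z_0}]<\infty$, $\mathbb{Q}_\lambda$ denotes the (known to exist) unique invariant and ergodic distribution of the environment viewed from $(Y^\lambda_n)$ that is absolutely continuous w.r.t. $\mathbb{P}$; it is known that $\mathbb{Q}_\lambda$ and $\mathbb{P}$ are mutually absolutely continuous. *)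

theory Defs
  imports "HOL-Probability.Probability"
begin

text \<open>
  An environment \<open>\<omega>\<close> assigns to \<open>k \<in> \<int>\<close> the pair \<open>\<omega> k = (Z\<^sub>k, E\<^sub>k)\<close>. Since the factors live on
  \<open>{0<..} \<times> UNIV\<close>, the points of \<open>env_space\<close> are exactly the elements of \<open>((0,\<infinity>) \<times> \<real>)\<^sup>\<int>\<close>.
\<close>

type_synonym environment = "int \<Rightarrow> real \<times> real"

definition env_space :: "environment measure" where
  "env_space = PiM UNIV (\<lambda>_. restrict_space borel ({0<..} \<times> UNIV))"

definition shift :: "int \<Rightarrow> environment \<Rightarrow> environment" where
  "shift l \<omega> = (\<lambda>k. \<omega> (k + l))"

lemma space_env_space: "space env_space = {\<omega>. \<forall>k. 0 < fst (\<omega> k)}"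
  by (auto simp: env_space_def space_PiM space_restrict_space PiE_def Pi_def extensional_def
      mem_Times_iff)

lemma measurable_shift [measurable]: "shift l \<in> env_space \<rightarrow>\<^sub>M env_space"
  unfolding shift_def env_space_def
  by (rule measurable_PiM_single') (auto simp: space_PiM PiE_def Pi_def extensional_def)

locale stationary_ergodic_environment = prob_space P for P :: "environment measure" +
  assumes sets_P: "sets P = sets env_space"
    and stationary: "\<And>l. distr P env_space (shift l) = P"
    and ergodic: "\<And>A. A \<in> sets env_space \<Longrightarrow>
          (\<forall>l. shift l -` A \<inter> space env_space = A) \<Longrightarrow> prob A = 0 \<or> prob A = 1"
    and integrable_Z0: "integrable P (\<lambda>\<omega>. fst (\<omega> 0))"
    and aperiodic: "\<And>l. l \<noteq> 0 \<Longrightarrow> AE \<omega> in P. \<omega> \<noteq> shift l \<omega>"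
    and Z0_bounded_below: "\<exists>d>0. AE \<omega> in P. d \<le> fst (\<omega> 0)"

definition site :: "environment \<Rightarrow> int \<Rightarrow> real" where
  "site \<omega> k = (if 0 \<le> k then \<Sum>j\<in>{0..<k}. fst (\<omega> j) else - (\<Sum>j\<in>{k..<0}. fst (\<omega> j)))"

lemma site_0: "site \<omega> 0 = 0"
  by (simp add: site_def)

lemma site_add_1: "site \<omega> (k + 1) = site \<omega> k + fst (\<omega> k)"
proof (cases "0 \<le> k")
  case True
  then have "{0..<k + 1} = insert k {0..<k}" by auto
  with True show ?thesis by (simp add: site_def)
next
  case False
  then have "{k..<0} = insert k {k + 1..<0}" by auto
  with False show ?thesis by (auto simp: site_def)
qed

definition mott_rate ::
    "(real \<Rightarrow> real \<Rightarrow> real) \<Rightarrow> real \<Rightarrow> environment \<Rightarrow> int \<Rightarrow> int \<Rightarrow> real" where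
  "mott_rate u lam \<omega> i k =
     (if i = k then 0
      else exp (- \<bar>site \<omega> i - site \<omega> k\<bar> + lam * (site \<omega> k - site \<omega> i) + u (snd (\<omega> i)) (snd (\<omega> k))))"

text \<open>
  If all \<open>Z\<^sub>k\<close> are bounded below by some \<open>d > 0\<close> almost surely, then for
  \<open>0 \<le> lam < 1\<close> and bounded \<open>u\<close> the series
  below converge almost surely; \<open>infsum\<close> takes the value \<open>0\<close> on the remaining null set.
\<close>

definition mott_prob ::
    "(real \<Rightarrow> real \<Rightarrow> real) \<Rightarrow> real \<Rightarrow> environment \<Rightarrow> int \<Rightarrow> int \<Rightarrow> real" where
  "mott_prob u lam \<omega> i k = mott_rate u lam \<omega> i k / (\<Sum>\<^sub>\<infinity>j. mott_rate u lam \<omega> i j)"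

definition total_rate :: "(real \<Rightarrow> real \<Rightarrow> real) \<Rightarrow> environment \<Rightarrow> real" where
  "total_rate u \<omega> = (\<Sum>\<^sub>\<infinity>k. mott_rate u 0 \<omega> 0 k)"

text \<open>
  Transition kernel of the environment viewed from the walker: from \<open>\<omega>\<close>, jump to \<open>shift k \<omega>\<close>
  with probability \<open>mott_prob u lam \<omega> 0 k\<close>.
\<close>

definition env_kernel ::
    "(real \<Rightarrow> real \<Rightarrow> real) \<Rightarrow> real \<Rightarrow> environment \<Rightarrow> environment measure" where
  "env_kernel u lam \<omega> =
     distr (density (count_space UNIV) (\<lambda>k. ennreal (mott_prob u lam \<omega> 0 k)))
       env_space (\<lambda>k. shift k \<omega>)"

definition invariant_distribution :: "'a measure \<Rightarrow> ('a \<Rightarrow> 'a measure) \<Rightarrow> bool" where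
  "invariant_distribution Q K \<longleftrightarrow>
     prob_space Q \<and> (\<forall>A\<in>sets Q. (\<integral>\<^sup>+\<omega>. emeasure (K \<omega>) A \<partial>Q) = emeasure Q A)"

text \<open>
  For an invariant distribution \<open>Q\<close>, triviality of the sets that are invariant under the kernel
  up to \<open>Q\<close>-null sets is equivalent to ergodicity under time shifts of the stationary
  chain started from \<open>Q\<close>.
\<close>

definition ergodic_distribution :: "'a measure \<Rightarrow> ('a \<Rightarrow> 'a measure) \<Rightarrow> bool" where
  "ergodic_distribution Q K \<longleftrightarrow>
     (\<forall>A\<in>sets Q. (AE \<omega> in Q. emeasure (K \<omega>) A = indicator A \<omega>) \<longrightarrow>
        measure Q A = 0 \<or> measure Q A = 1)"

definition steady_state ::
    "environment measure \<Rightarrow> (real \<Rightarrow> real \<Rightarrow> real) \<Rightarrow> real \<Rightarrow> environment measure \<Rightarrow> bool" where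
  "steady_state P u lam Q \<longleftrightarrow>
     sets Q = sets env_space \<and> absolutely_continuous P Q \<and>
     invariant_distribution Q (env_kernel u lam) \<and> ergodic_distribution Q (env_kernel u lam)"

definition reversible_law ::
    "environment measure \<Rightarrow> (real \<Rightarrow> real \<Rightarrow> real) \<Rightarrow> environment measure" where
  "reversible_law P u =
     density P (\<lambda>\<omega>. ennreal (total_rate u \<omega> / (\<integral>\<omega>. total_rate u \<omega> \<partial>P)))"

text \<open>The \<open>L\<^sup>p\<close> norm, with value \<open>\<infinity>\<close> for functions outside \<open>L\<^sup>p\<close>.\<close>

definition Lp_norm :: "real \<Rightarrow> 'a measure \<Rightarrow> ('a \<Rightarrow> real) \<Rightarrow> ennreal" where
  "Lp_norm p M f =
     (let I = (\<integral>\<^sup>+x. ennreal (\<bar>f x\<bar> powr p) \<partial>M)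
      in if I = \<infinity> then \<infinity> else ennreal (enn2real I powr (1 / p)))"

end

theory Submission
  imports Defs
begin

text \<open>
  Let \<open>f\<close> be the density of the steady state with respect to \<open>P\<close>. In a frozen environment the walk is
  reversible with conductances \<open>c a b = exp (2 lam x\<^sub>a) r\<^sub>a\<^sub>b\<close>, and invariance of \<open>f\<close> says that
  \<open>h a = exp (- 2 lam x\<^sub>a) g (shift a \<omega>)\<close> is harmonic, where \<open>g\<close> is \<open>f\<close> divided by the total rate. The net
  flux \<open>J\<close> of \<open>h\<close> across a bond does not depend on the bond, so by ergodicity it is a constant.
  Truncating \<open>h\<close> at the level \<open>h 0\<close> gives a function of Dirichlet energy at most \<open>J h 0\<close>; keeping only
  nearest neighbour bonds, the Cauchy-Schwarz inequality yields
  \<open>h 0 \<le> J (\<Sum>j. 1 / c j (j + 1))\<close>, with no need for \<open>h\<close> to be monotone.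

  The flux is of order \<open>lam\<close>: the stationary entropy production equals \<open>2 lam J E[Z\<^sub>0]\<close> and dominates
  the squared differences of the square roots of forward and backward jump intensities, while \<open>J\<close> is the
  mean index displacement and hence at most a constant times the square root of the entropy production.
  Therefore \<open>f\<close> is bounded by \<open>lam\<close> times a geometric series with ratio \<open>exp (- 2 lam d)\<close> in the
  variables \<open>exp Z\<^sub>j\<close>, whose \<open>p\<close>-th moment is bounded uniformly in \<open>lam\<close> by Jensen's inequality.
\<close>

section \<open>A resistance bound for harmonic functions on the integers\<close>

text \<open>The bound on \<open>g\<close> by the flux is used twice. At first the flux is merely
  some finite constant, and the bound shows that \<open>g\<close> is integrable; this is not clear
  in advance, since the total rate can be arbitrarily small where the gaps are large. Only then is
  the mean displacement in space finite and the entropy balance meaningful. That balance makes the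
  flux of order \<open>lam\<close>, and the same bound is read again, now with explicit constants.
  The flux estimate closes on itself: the entropy production is linear in \<open>J\<close>, so a
  bound \<open>J \<le> C * sqrt (lam * J)\<close> gives the order \<open>lam\<close> instead of its
  square root. Uniformity in the bias then rests on one cancellation: the geometric series is of
  order \<open>1 / lam\<close>, and the flux supplies the missing factor \<open>lam\<close>.\<close>

lemma summable_on_iff_integrable_count_space:
  fixes f :: "'a \<Rightarrow> real"
  shows "f summable_on A \<longleftrightarrow> integrable (count_space A) f"
  using summable_on_iff_abs_summable_on_real[of f A] abs_summable_equivalent[of f A]
  by (simp add: abs_summable_on_def)

text \<open>Unconditional, because both sides default to 0 when the series does not converge
  absolutely. Through this identity dominated convergence, Fubini and the measurability of parameter
  integrals become available for \<open>infsum\<close>.\<close>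

lemma infsum_eq_integral_count_space:
  fixes f :: "'a \<Rightarrow> real"
  shows "infsum f A = integral\<^sup>L (count_space A) f"
proof (cases "f summable_on A")
  case True
  then have "Infinite_Set_Sum.abs_summable_on f A"
    by (simp add: summable_on_iff_integrable_count_space abs_summable_on_def)
  then show ?thesis
    using infsetsum_infsum[of f A] by (simp add: infsetsum_def)
next
  case False
  then show ?thesis
    by (simp add: summable_on_iff_integrable_count_space infsum_not_exists
        not_integrable_integral_eq)
qed

section \<open>Divergence-free flows and summation by parts\<close>

lemma sum_telescope_of_bool:
  fixes \<phi> :: "int \<Rightarrow> real"
  assumes "n \<le> m"
  shows "(\<Sum>i\<in>{n..<m}. (\<phi> i - \<phi> (i + 1)) * of_bool (a \<le> i)) = \<phi> (max n (min a m)) - \<phi> m"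
  using assms
proof (induction m rule: int_ge_induct)
  case base
  then show ?case by simp
next
  case (step m)
  then have "{n..<m + 1} = insert m {n..<m}" by auto
  then have "(\<Sum>i\<in>{n..<m + 1}. (\<phi> i - \<phi> (i + 1)) * of_bool (a \<le> i)) =
      (\<phi> m - \<phi> (m + 1)) * of_bool (a \<le> m) + (\<phi> (max n (min a m)) - \<phi> m)"
    using step by simp
  also have "\<dots> = \<phi> (max n (min a (m + 1))) - \<phi> (m + 1)"
  proof (cases "a \<le> m")
    case False
    then have "min a m = m" "min a (m + 1) = m + 1" by auto
    with False step.hyps show ?thesis by simp
  qed (use step.hyps in simp)
  finally show ?case .
qed

lemma has_sum_sum:
  fixes f :: "'i \<Rightarrow> 'a \<Rightarrow> real"
  assumes "\<And>i. i \<in> I \<Longrightarrow> (f i has_sum s i) A"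
  shows "((\<lambda>x. \<Sum>i\<in>I. f i x) has_sum (\<Sum>i\<in>I. s i)) A"
  using assms
proof (induction I rule: infinite_finite_induct)
  case (insert i I)
  then show ?case by (auto intro!: has_sum_add)
qed auto

text \<open>The fluxes across the cuts at \<open>i - 1\<close> and at \<open>i\<close> differ by the
  net outflow of the vertex \<open>i\<close>, which vanishes by \<open>bal\<close>.\<close>

lemma flow_constant:
  fixes q :: "int \<Rightarrow> int \<Rightarrow> real"
  assumes cut: "\<And>i. (\<lambda>(a, b). q a b * (of_bool (a \<le> i) - of_bool (b \<le> i))) summable_on UNIV"
    and row: "\<And>i. q i summable_on UNIV"
    and col: "\<And>i. (\<lambda>b. q b i) summable_on UNIV"
    and bal: "\<And>i. infsum (q i) UNIV = (\<Sum>\<^sub>\<infinity>b. q b i)"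
  shows "(\<Sum>\<^sub>\<infinity>(a, b). q a b * (of_bool (a \<le> i) - of_bool (b \<le> i))) =
         (\<Sum>\<^sub>\<infinity>(a, b). q a b * (of_bool (a \<le> (0::int)) - of_bool (b \<le> 0)))"
proof -
  define J where "J i = (\<Sum>\<^sub>\<infinity>(a, b). q a b * (of_bool (a \<le> i) - of_bool (b \<le> i)))" for i :: int
  have step: "J i = J (i - 1)" for i
  proof -
    have r: "((\<lambda>(a, b). q a b * of_bool (a = i)) has_sum infsum (q i) UNIV) UNIV"
    proof -
      have "((\<lambda>(a, b). q a b) has_sum infsum (q i) UNIV) (Pair i ` UNIV)"
        using row[of i] by (subst has_sum_reindex) (auto simp: inj_on_def o_def)
      then show ?thesis
        by (rule has_sum_cong_neutral[THEN iffD1, rotated -1]) auto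
    qed
    have c: "((\<lambda>(a, b). q a b * of_bool (b = i)) has_sum (\<Sum>\<^sub>\<infinity>b. q b i)) UNIV"
    proof -
      have "((\<lambda>(a, b). q a b) has_sum (\<Sum>\<^sub>\<infinity>b. q b i)) ((\<lambda>a. (a, i)) ` UNIV)"
        using col[of i] by (subst has_sum_reindex) (auto simp: inj_on_def o_def)
      then show ?thesis
        by (rule has_sum_cong_neutral[THEN iffD1, rotated -1]) auto
    qed
    have "((\<lambda>(a, b). q a b * (of_bool (a = i) - of_bool (b = i))) has_sum 0) UNIV"
      using has_sum_add[OF r has_sum_cmult_right[OF c, of "-1"]] bal[of i]
      by (simp add: case_prod_unfold algebra_simps)
    moreover have "((\<lambda>(a, b). q a b * (of_bool (a \<le> i - 1) - of_bool (b \<le> i - 1))) has_sum J (i - 1)) UNIV"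
      unfolding J_def by (intro has_sum_infsum cut)
    ultimately have "((\<lambda>x. (case x of (a, b) \<Rightarrow> q a b * (of_bool (a = i) - of_bool (b = i))) +
        (case x of (a, b) \<Rightarrow> q a b * (of_bool (a \<le> i - 1) - of_bool (b \<le> i - 1)))) has_sum 0 + J (i - 1)) UNIV"
      by (rule has_sum_add)
    also have "(\<lambda>x. (case x of (a, b) \<Rightarrow> q a b * (of_bool (a = i) - of_bool (b = i))) +
        (case x of (a, b) \<Rightarrow> q a b * (of_bool (a \<le> i - 1) - of_bool (b \<le> i - 1)))) =
        (\<lambda>(a, b). q a b * (of_bool (a \<le> i) - of_bool (b \<le> i)))"
      by (auto simp: fun_eq_iff of_bool_def)
    finally show ?thesis
      unfolding J_def by (simp add: infsumI)
  qed
  have "J i = J 0"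
  proof (induction i rule: int_induct[where k = 0])
    case (step1 i)
    then show ?case using step[of "i + 1"] by simp
  next
    case (step2 i)
    then show ?case using step[of i] by simp
  qed simp
  then show ?thesis by (simp add: J_def)
qed

text \<open>Since \<phi> is constant outside the window from \<open>n\<close> to \<open>m\<close>,
  the increment \<open>\<phi> a - \<phi> b\<close> is a finite combination of cut functions with
  coefficients \<open>\<phi> i - \<phi> (i + 1)\<close>, and every cut carries the same flux
  \<open>J\<close>. Finiteness of the window makes summability over each single cut
  sufficient.\<close>

lemma flow_summation_by_parts:
  fixes q :: "int \<Rightarrow> int \<Rightarrow> real"
  assumes cut: "\<And>i. (\<lambda>(a, b). q a b * (of_bool (a \<le> i) - of_bool (b \<le> i))) summable_on UNIV"
    and J: "\<And>i. (\<Sum>\<^sub>\<infinity>(a, b). q a b * (of_bool (a \<le> i) - of_bool (b \<le> i))) = J"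
    and "n \<le> m" and left: "\<And>a. a \<le> n \<Longrightarrow> \<phi> a = \<phi> n" and right: "\<And>a. m \<le> a \<Longrightarrow> \<phi> a = \<phi> m"
  shows "((\<lambda>(a, b). q a b * (\<phi> a - \<phi> b)) has_sum J * (\<phi> n - \<phi> m)) UNIV"
proof -
  have cut': "((\<lambda>(a, b). q a b * (of_bool (a \<le> i) - of_bool (b \<le> i))) has_sum J) UNIV" for i
    using cut[of i] J[of i] by (simp add: has_sum_iff)
  have "((\<lambda>x. \<Sum>i\<in>{n..<m}. (\<phi> i - \<phi> (i + 1)) *
      (case x of (a, b) \<Rightarrow> q a b * (of_bool (a \<le> i) - of_bool (b \<le> i)))) has_sum
      (\<Sum>i\<in>{n..<m}. (\<phi> i - \<phi> (i + 1)) * J)) UNIV"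
    by (intro has_sum_sum has_sum_cmult_right cut')
  moreover have "(\<Sum>i\<in>{n..<m}. \<phi> i - \<phi> (i + 1)) = \<phi> n - \<phi> m"
    using sum_telescope_of_bool[OF \<open>n \<le> m\<close>, of \<phi> n] \<open>n \<le> m\<close> by (simp add: max_def min_def)
  moreover have "(\<Sum>i\<in>{n..<m}. (\<phi> i - \<phi> (i + 1)) * (q a b * (of_bool (a \<le> i) - of_bool (b \<le> i)))) =
      q a b * (\<phi> a - \<phi> b)" for a b
  proof -
    \<comment> \<open>Moving an endpoint of a long bond into the window does not change
      \<phi>.\<close>
    have clamp: "\<phi> (max n (min a m)) = \<phi> a" for a
      using left[of a] right[of a] \<open>n \<le> m\<close> by (auto simp: max_def min_def)
    have "(\<Sum>i\<in>{n..<m}. (\<phi> i - \<phi> (i + 1)) * (q a b * (of_bool (a \<le> i) - of_bool (b \<le> i)))) =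
      q a b * ((\<Sum>i\<in>{n..<m}. (\<phi> i - \<phi> (i + 1)) * of_bool (a \<le> i)) -
        (\<Sum>i\<in>{n..<m}. (\<phi> i - \<phi> (i + 1)) * of_bool (b \<le> i)))"
      by (simp add: sum_distrib_left sum_subtractf[symmetric] algebra_simps)
    then show ?thesis
      by (simp add: sum_telescope_of_bool[OF \<open>n \<le> m\<close>] clamp)
  qed
  ultimately show ?thesis
    by (simp add: case_prod_unfold sum_distrib_left[symmetric] mult.commute[of _ J])
qed

text \<open>Clipping is nondecreasing and 1-Lipschitz, so the clipped increment has the sign of
  \<open>x - y\<close> and is not longer.\<close>

lemma truncation_energy_ineq:
  fixes x y s t :: real
  assumes "s \<le> t"
  shows "(max s (min x t) - max s (min y t))\<^sup>2 \<le> (x - y) * (max s (min x t) - max s (min y t))"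
proof -
  have "(u - v)\<^sup>2 \<le> (x - y) * (u - v)"
    if "\<bar>u - v\<bar> \<le> \<bar>x - y\<bar>" "0 \<le> (x - y) * (u - v)" for u v
  proof -
    have "(u - v)\<^sup>2 = \<bar>u - v\<bar> * \<bar>u - v\<bar>" by (simp add: power2_eq_square)
    also have "\<dots> \<le> \<bar>x - y\<bar> * \<bar>u - v\<bar>" using that by (intro mult_right_mono) auto
    also have "\<dots> = (x - y) * (u - v)" using that by (simp add: abs_mult[symmetric])
    finally show ?thesis .
  qed
  moreover have "\<bar>max s (min x t) - max s (min y t)\<bar> \<le> \<bar>x - y\<bar>"
    using assms by (auto simp: max_def min_def)
  moreover have "0 \<le> (x - y) * (max s (min x t) - max s (min y t))"
  proof (cases "x \<le> y")
    case True
    then show ?thesis by (intro mult_nonpos_nonpos) (auto simp: max_def min_def)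
  next
    case False
    then show ?thesis using assms by (intro mult_nonneg_nonneg) (auto simp: max_def min_def)
  qed
  ultimately show ?thesis by blast
qed

text \<open>
  \<open>\<phi>\<close> is \<open>h\<close> clipped to \<open>[s, t]\<close> on the right of \<open>n\<close> and constant on the left of it. Only the bonds
  crossing \<open>n\<close> can contribute negatively, and their total conductance vanishes as \<open>n\<close> tends to \<open>-\<infinity>\<close>.
\<close>

lemma energy_lower_bound:
  fixes c :: "int \<Rightarrow> int \<Rightarrow> real" and h \<phi> :: "int \<Rightarrow> real"
  assumes sym: "\<And>a b. c a b = c b a" and nonneg: "\<And>a b. 0 \<le> c a b" and h: "\<And>a. 0 \<le> h a"
    and st: "0 < s" "s < t" and n: "n < 0"
    and \<phi>: "\<And>a. \<phi> a = (if a \<le> n then t else max s (min (h a) t))"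
    and flow: "((\<lambda>(a, b). c a b * h a * (\<phi> a - \<phi> b)) has_sum T) UNIV"
    and small: "(\<lambda>(a, b). c a b * of_bool (a \<le> n)) summable_on UNIV"
  shows "(\<Sum>j<m. c (int j) (int j + 1) * (\<phi> (int j) - \<phi> (int j + 1))\<^sup>2)
      \<le> T + t\<^sup>2 * (\<Sum>\<^sub>\<infinity>(a, b). c a b * of_bool (a \<le> n))"
proof -
  define A where "A = (\<Sum>\<^sub>\<infinity>(a, b). c a b * of_bool (a \<le> n))"
  have A: "((\<lambda>(a, b). c a b * of_bool (a \<le> n)) has_sum A) UNIV"
    unfolding A_def by (intro has_sum_infsum small)
  have swap: "((\<lambda>(a, b). f b a) has_sum x) UNIV" if "((\<lambda>(a, b). f a b) has_sum x) UNIV"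
    for f :: "int \<Rightarrow> int \<Rightarrow> real" and x
    using that has_sum_swap[where f = "\<lambda>(a, b). f a b" and S = x and A = UNIV and B = UNIV] by (simp add: case_prod_unfold)
  \<comment> \<open>Adding the sum with \<open>a\<close> and \<open>b\<close> exchanged turns the
    pairing of the flow with \<phi> into a Dirichlet form in \<open>h\<close> and \<phi>, at the
    price of a factor 2.\<close>
  have "((\<lambda>(a, b). c a b * h b * (\<phi> b - \<phi> a)) has_sum T) UNIV"
    using swap[OF flow] sym by simp
  from has_sum_add[OF flow this]
  have T2: "((\<lambda>(a, b). c a b * (h a - h b) * (\<phi> a - \<phi> b)) has_sum 2 * T) UNIV"
    by (simp add: case_prod_unfold algebra_simps)
  have A2: "((\<lambda>(a, b). t\<^sup>2 * (c a b * of_bool (a \<le> n) + c a b * of_bool (b \<le> n))) has_sum t\<^sup>2 * (A + A)) UNIV"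
    using has_sum_cmult_right[OF has_sum_add[OF A swap[OF A]], of "t\<^sup>2"] sym
    by (simp add: case_prod_unfold)
  \<comment> \<open>Both orientations of each nearest neighbour bond are kept, to match the factor 2
    of the symmetrised sum.\<close>
  define F1 where "F1 = (\<lambda>j::nat. (int j, int j + 1)) ` {..<m}"
  define F2 where "F2 = (\<lambda>j::nat. (int j + 1, int j)) ` {..<m}"
  define E where "E x = (case x of (a, b) \<Rightarrow> c a b * (\<phi> a - \<phi> b)\<^sup>2)" for x
  define S where "S = (\<Sum>j<m. c (int j) (int j + 1) * (\<phi> (int j) - \<phi> (int j + 1))\<^sup>2)"
  have "sum E (F1 \<union> F2) = sum E F1 + sum E F2"
    by (rule sum.union_disjoint) (auto simp: F1_def F2_def)
  moreover have "sum E F1 = S" "sum E F2 = S"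
    unfolding F1_def F2_def S_def
    by (subst sum.reindex; force simp: inj_on_def E_def sym power2_commute intro!: sum.cong)+
  ultimately have "(E has_sum 2 * S) (F1 \<union> F2)"
    using has_sum_finite[of "F1 \<union> F2" E] by (simp add: F1_def F2_def)
  then have S2: "((\<lambda>x. E x * indicator (F1 \<union> F2) x) has_sum 2 * S) UNIV"
    by (rule has_sum_cong_neutral[THEN iffD1, rotated -1]) auto
  have "2 * S \<le> 2 * T + t\<^sup>2 * (A + A)"
  proof (rule has_sum_mono[OF S2 has_sum_add[OF T2 A2]])
    fix x :: "int \<times> int"
    obtain a b where x: "x = (a, b)" by (cases x)
    \<comment> \<open>A bond crossing \<open>n\<close>: \<phi> equals \<open>t\<close> at its left
      end. The only negative contribution contains \<open>h b\<close>; it vanishes if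
      \<open>h b \<ge> t\<close> and otherwise is a product of two factors at most
      \<open>t\<close>.\<close>
    have cross: "0 \<le> (h a - h b) * (t - max s (min (h b) t)) + t\<^sup>2" for a b
    proof (cases "h b < t")
      case True
      have "0 \<le> h a * (t - max s (min (h b) t))"
        using h[of a] st by (intro mult_nonneg_nonneg) auto
      moreover have "h b * (t - max s (min (h b) t)) \<le> t * t"
        using h[of b] st True by (intro mult_mono) auto
      ultimately show ?thesis by (simp add: algebra_simps power2_eq_square)
    qed (use st in auto)
    have *: "of_bool (n < a \<and> n < b) * (\<phi> a - \<phi> b)\<^sup>2 \<le>
        (h a - h b) * (\<phi> a - \<phi> b) + t\<^sup>2 * (of_bool (a \<le> n) + of_bool (b \<le> n))"
    proof (cases "a \<le> n"; cases "b \<le> n")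
      assume "a \<le> n" "\<not> b \<le> n"
      then show ?thesis using cross[of a b] by (simp add: \<phi>)
    next
      assume "\<not> a \<le> n" "b \<le> n"
      moreover have "(h a - h b) * (max s (min (h a) t) - t) = (h b - h a) * (t - max s (min (h a) t))"
        by (simp add: algebra_simps)
      ultimately show ?thesis using cross[of b a] by (simp add: \<phi>)
    next
      assume "\<not> a \<le> n" "\<not> b \<le> n"
      then show ?thesis using truncation_energy_ineq[of s t "h a" "h b"] st by (simp add: \<phi>)
    qed (simp add: \<phi>)
    have "indicator (F1 \<union> F2) (a, b) \<le> (of_bool (n < a \<and> n < b) :: real)"
      using n by (auto simp: indicator_def F1_def F2_def)
    then have "(\<phi> a - \<phi> b)\<^sup>2 * indicator (F1 \<union> F2) (a, b) \<le> (\<phi> a - \<phi> b)\<^sup>2 * of_bool (n < a \<and> n < b)"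
      by (intro mult_left_mono) auto
    then have "E x * indicator (F1 \<union> F2) x \<le> c a b * ((\<phi> a - \<phi> b)\<^sup>2 * of_bool (n < a \<and> n < b))"
      using mult_left_mono[OF _ nonneg[of a b]] by (simp only: E_def x case_prod_conv mult.assoc)
    also have "\<dots> \<le> c a b * ((h a - h b) * (\<phi> a - \<phi> b) + t\<^sup>2 * (of_bool (a \<le> n) + of_bool (b \<le> n)))"
      using * nonneg[of a b] by (intro mult_left_mono) (auto simp: mult.commute)
    finally show "E x * indicator (F1 \<union> F2) x \<le>
       (case x of (a, b) \<Rightarrow> c a b * (h a - h b) * (\<phi> a - \<phi> b)) +
       (case x of (a, b) \<Rightarrow> t\<^sup>2 * (c a b * of_bool (a \<le> n) + c a b * of_bool (b \<le> n)))"
      by (simp add: x algebra_simps)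
  qed
  then have "S \<le> T + t\<^sup>2 * A" by (simp add: algebra_simps)
  then show ?thesis by (simp only: S_def A_def)
qed

text \<open>The clipped potential drops by \<open>t - s\<close> between 0 and a far index and has
  energy at most \<open>J * (t - s)\<close>, whereas the nearest neighbour bonds, wired in series,
  need energy at least \<open>(t - s)\<^sup>2 / R\<close> for such a drop. One factor
  \<open>t - s\<close> cancels, and \<open>s\<close> tends to 0. Discarding the longer bonds only
  lowers the energy.\<close>

lemma flow_resistance_bound:
  fixes c :: "int \<Rightarrow> int \<Rightarrow> real" and h :: "int \<Rightarrow> real"
  assumes sym: "\<And>a b. c a b = c b a" and nonneg: "\<And>a b. 0 \<le> c a b" and h: "\<And>a. 0 \<le> h a"
    and pos: "\<And>j. 0 < c j (j + 1)"
    and cut: "\<And>i. (\<lambda>(a, b). c a b * h a * (of_bool (a \<le> i) - of_bool (b \<le> i))) summable_on UNIV"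
    and row: "\<And>i. (\<lambda>b. c i b * h i) summable_on UNIV"
    and col: "\<And>i. (\<lambda>b. c b i * h b) summable_on UNIV"
    and bal: "\<And>i. (\<Sum>\<^sub>\<infinity>b. c i b * h i) = (\<Sum>\<^sub>\<infinity>b. c b i * h b)"
    and small: "(\<lambda>(a, b). c a b * of_bool (a \<le> 0)) summable_on UNIV"
    and lim: "(h \<longlongrightarrow> 0) at_top"
    and res: "summable (\<lambda>j. 1 / c (int j) (int j + 1))"
    and J: "J = (\<Sum>\<^sub>\<infinity>(a, b). c a b * h a * (of_bool (a \<le> (0::int)) - of_bool (b \<le> 0)))"
  shows "h 0 \<le> max 0 J * (\<Sum>j. 1 / c (int j) (int j + 1))"
proof -
  define R where "R = (\<Sum>j. 1 / c (int j) (int j + 1))"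
  have R0: "0 \<le> R" unfolding R_def by (intro suminf_nonneg res) (use pos less_imp_le in auto)
  have Jc: "(\<Sum>\<^sub>\<infinity>(a, b). c a b * h a * (of_bool (a \<le> i) - of_bool (b \<le> i))) = J" for i
    unfolding J by (rule flow_constant) (use cut row col bal in auto)
  \<comment> \<open>The error caused by the artificial cut at \<open>n = - 1 - int N\<close>
    disappears in the limit.\<close>
  have A_lim: "(\<lambda>N. \<Sum>\<^sub>\<infinity>(a, b). c a b * of_bool (a \<le> - 1 - int N)) \<longlonglongrightarrow> (\<Sum>\<^sub>\<infinity>x::int \<times> int. 0)"
    unfolding infsum_eq_integral_count_space
  proof (rule integral_dominated_convergence)
    show "integrable (count_space UNIV) (\<lambda>(a, b). c a b * of_bool (a \<le> 0))"
      using small by (simp add: summable_on_iff_integrable_count_space)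
    show "AE x in count_space UNIV. (\<lambda>N. case x of (a, b) \<Rightarrow> c a b * of_bool (a \<le> - 1 - int N))
        \<longlonglongrightarrow> 0"
    proof (intro AE_I2, clarsimp)
      fix a b
      have "eventually (\<lambda>N. nat \<bar>a\<bar> \<le> N) sequentially" by (rule eventually_ge_at_top)
      then have "eventually (\<lambda>N. c a b * of_bool (a \<le> - 1 - int N) = 0) sequentially"
        by eventually_elim auto
      then show "(\<lambda>N. c a b * of_bool (a \<le> - 1 - int N)) \<longlonglongrightarrow> 0"
        by (rule tendsto_eventually)
    qed
  qed (use nonneg in \<open>auto simp: of_bool_def\<close>)
  \<comment> \<open>A positive level \<open>s\<close> makes the clipped potential constant from a
    finite index on, because \<open>h\<close> tends to 0; summation by parts requires this.\<close>
  have bound: "h 0 - s \<le> max 0 J * R" if s: "0 < s" "s < h 0" for s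
  proof -
    define t where "t = h 0"
    have st: "0 < s" "s < t" using s by (auto simp: t_def)
    obtain M where M: "\<And>b. M \<le> b \<Longrightarrow> h b < s"
      using order_tendstoD(2)[OF lim, of s] s by (auto simp: eventually_at_top_linorder)
    define m where "m = Suc (nat \<bar>M\<bar>)"
    define \<psi> where "\<psi> a = max s (min (h a) t)" for a
    have \<psi>m: "\<psi> a = s" if "int m \<le> a" for a
      proof -
      have "h a < s" using M[of a] that by (simp add: m_def)
      with st show ?thesis by (simp add: \<psi>_def)
    qed
    have \<psi>0: "\<psi> 0 = t" using st by (auto simp: \<psi>_def t_def)
    define S where "S = (\<Sum>j<m. c (int j) (int j + 1) * (\<psi> (int j) - \<psi> (int j + 1))\<^sup>2)"
    have SN: "S \<le> J * (t - s) + t\<^sup>2 * (\<Sum>\<^sub>\<infinity>(a, b). c a b * of_bool (a \<le> - 1 - int N))" for N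
    proof -
      define n where "n = - 1 - int N"
      define \<phi> where "\<phi> a = (if a \<le> n then t else \<psi> a)" for a
      have \<phi>\<psi>: "\<phi> a = \<psi> a" if "0 \<le> a" for a using that by (simp add: \<phi>_def n_def)
      have "((\<lambda>(a, b). c a b * h a * (\<phi> a - \<phi> b)) has_sum J * (\<phi> n - \<phi> (int m))) UNIV"
        using \<psi>m by (intro flow_summation_by_parts cut Jc) (auto simp: \<phi>_def n_def)
      then have "((\<lambda>(a, b). c a b * h a * (\<phi> a - \<phi> b)) has_sum J * (t - s)) UNIV"
        using \<psi>m by (simp add: \<phi>_def n_def)
      then have "(\<Sum>j<m. c (int j) (int j + 1) * (\<phi> (int j) - \<phi> (int j + 1))\<^sup>2)
          \<le> J * (t - s) + t\<^sup>2 * (\<Sum>\<^sub>\<infinity>(a, b). c a b * of_bool (a \<le> n))"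
      proof (intro energy_lower_bound[where s = s and h = h])
        show "(\<lambda>(a, b). c a b * of_bool (a \<le> n)) summable_on UNIV"
          by (rule summable_on_comparison_test[OF small]) (auto simp: nonneg n_def)
      qed (use sym nonneg h st in \<open>auto simp: \<phi>_def \<psi>_def n_def\<close>)
      then show ?thesis by (simp add: S_def \<phi>\<psi> n_def)
    qed
    have "S \<le> J * (t - s) + t\<^sup>2 * 0"
    proof (rule LIMSEQ_le_const)
      show "(\<lambda>N. J * (t - s) + t\<^sup>2 * (\<Sum>\<^sub>\<infinity>(a, b). c a b * of_bool (a \<le> - 1 - int N)))
          \<longlonglongrightarrow> J * (t - s) + t\<^sup>2 * 0"
        using A_lim by (intro tendsto_add tendsto_mult tendsto_const) (simp only: infsum_0_simp)
    qed (use SN in blast)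
    then have S: "S \<le> J * (t - s)" by simp
    have "t - s = \<psi> (int 0) - \<psi> (int m)" by (simp add: \<psi>0 \<psi>m)
    also have "\<dots> = (\<Sum>j<m. \<psi> (int j) - \<psi> (int (Suc j)))"
      by (rule sum_lessThan_telescope'[symmetric])
    also have "\<dots> = (\<Sum>j<m. (1 / sqrt (c (int j) (int j + 1))) *
        (sqrt (c (int j) (int j + 1)) * (\<psi> (int j) - \<psi> (int j + 1))))"
    proof (intro sum.cong refl)
      fix j show "\<psi> (int j) - \<psi> (int (Suc j)) = (1 / sqrt (c (int j) (int j + 1))) *
        (sqrt (c (int j) (int j + 1)) * (\<psi> (int j) - \<psi> (int j + 1)))"
        using pos[of "int j"] by (simp add: add.commute)
    qed
    finally have ts: "t - s = \<dots>" .
    have "(t - s)\<^sup>2 \<le> (\<Sum>j<m. (1 / sqrt (c (int j) (int j + 1)))\<^sup>2) *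
        (\<Sum>j<m. (sqrt (c (int j) (int j + 1)) * (\<psi> (int j) - \<psi> (int j + 1)))\<^sup>2)"
      unfolding ts by (rule Cauchy_Schwarz_ineq_sum)
    also have "\<dots> = (\<Sum>j<m. 1 / c (int j) (int j + 1)) * S"
      unfolding S_def using nonneg by (simp add: power_divide power_mult_distrib)
    also have "\<dots> \<le> R * (max 0 J * (t - s))"
    proof (intro mult_mono)
      show "(\<Sum>j<m. 1 / c (int j) (int j + 1)) \<le> R"
        unfolding R_def by (intro sum_le_suminf res) (use pos less_imp_le in auto)
      have "J * (t - s) \<le> max 0 J * (t - s)" using st by (intro mult_right_mono) auto
      with S show "S \<le> max 0 J * (t - s)" by simp
      show "0 \<le> S" unfolding S_def by (intro sum_nonneg mult_nonneg_nonneg) (auto simp: nonneg)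
    qed (rule R0)
    finally have "(t - s) * (t - s) \<le> (max 0 J * R) * (t - s)"
      by (simp add: power2_eq_square algebra_simps)
    then show ?thesis using st by (simp add: t_def)
  qed
  have "h 0 \<le> max 0 J * R"
  proof (rule ccontr)
    assume *: "\<not> h 0 \<le> max 0 J * R"
    have "0 \<le> max 0 J * R" using R0 by (intro mult_nonneg_nonneg) auto
    \<comment> \<open>For this \<open>s\<close> the value \<open>h 0 - s\<close> is the midpoint
      between \<open>h 0\<close> and the claimed bound, hence exceeds the latter.\<close>
    with * bound[of "(h 0 - max 0 J * R) / 2"] show False by (simp add: field_simps)
  qed
  then show ?thesis by (simp add: R_def)
qed

section \<open>Estimates in a stationary environment\<close>

lemma measurable_pair_count_space:
  fixes f :: "'k::countable \<Rightarrow> 'a \<Rightarrow> 'b"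
  assumes "\<And>k. f k \<in> M \<rightarrow>\<^sub>M N"
  shows "(\<lambda>(\<omega>, k). f k \<omega>) \<in> M \<Otimes>\<^sub>M count_space UNIV \<rightarrow>\<^sub>M N"
proof -
  have "(\<lambda>(k, \<omega>). f k \<omega>) \<in> count_space UNIV \<Otimes>\<^sub>M M \<rightarrow>\<^sub>M N"
    by (rule measurable_pair_measure_countable1) (use assms in auto)
  then show ?thesis
    by (subst measurable_pair_swap_iff) (simp add: case_prod_unfold)
qed

lemma borel_measurable_infsum:
  fixes f :: "'k::countable \<Rightarrow> 'a \<Rightarrow> real"
  assumes "\<And>k. f k \<in> borel_measurable M"
  shows "(\<lambda>\<omega>. \<Sum>\<^sub>\<infinity>k. f k \<omega>) \<in> borel_measurable M"
proof -
  interpret sigma_finite_measure "count_space (UNIV :: 'k set)"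
    by (rule sigma_finite_measure_count_space)
  have "(\<lambda>(\<omega>, k). f k \<omega>) \<in> borel_measurable (M \<Otimes>\<^sub>M count_space UNIV)"
    using assms by (rule measurable_pair_count_space)
  then show ?thesis
    unfolding infsum_eq_integral_count_space
    by (rule borel_measurable_lebesgue_integral)
qed

lemma summable_on_nat_abs_int:
  fixes w :: "nat \<Rightarrow> real"
  assumes "summable w" "\<And>n. 0 \<le> w n"
  shows "(\<lambda>k::int. w (nat \<bar>k\<bar>)) summable_on UNIV"
proof -
  have w: "w summable_on UNIV"
    using assms by (simp add: summable_on_UNIV_nonneg_real_iff)
  have "(\<lambda>k. w (nat \<bar>k\<bar>)) summable_on range int"
    using w by (subst summable_on_reindex) (auto simp: o_def)
  moreover have "(\<lambda>k. w (nat \<bar>k\<bar>)) summable_on range (\<lambda>n. - int n)"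
    using w by (subst summable_on_reindex) (auto simp: o_def inj_on_def)
  moreover have "range int \<union> range (\<lambda>n. - int n) = UNIV"
  proof -
    have "k \<in> range int \<union> range (\<lambda>n. - int n)" for k
      by (cases k rule: int_cases2) auto
    then show ?thesis by blast
  qed
  ultimately show ?thesis
    using summable_on_union by metis
qed

text \<open>Half of the exponential decay is spent on the quadratic factor:
  \<open>x\<^sup>2 / 2 \<le> exp x\<close> at \<open>x = real n * \<kappa> / 2\<close> yields the
  constant \<open>8 / \<kappa>\<^sup>2\<close>.\<close>

lemma summable_square_geometric:
  fixes r :: real
  assumes "0 < r" "r < 1"
  shows "summable (\<lambda>n. (real n)\<^sup>2 * r ^ n)"
proof -
  define \<kappa> where "\<kappa> = - ln r"
  have \<kappa>: "0 < \<kappa>" and r: "r = exp (- \<kappa>)" using assms by (auto simp: \<kappa>_def)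
  have bound: "norm ((real n)\<^sup>2 * r ^ n) \<le> (8 / \<kappa>\<^sup>2) * (exp (- (\<kappa> / 2))) ^ n" for n
  proof -
    have "(real n)\<^sup>2 * \<kappa>\<^sup>2 / 8 = (real n * \<kappa> / 2)\<^sup>2 / 2" by (simp add: power2_eq_square)
    also have "\<dots> \<le> exp (real n * \<kappa> / 2)"
    proof -
      have "0 \<le> real n * \<kappa> / 2" using \<kappa> by simp
      with exp_lower_Taylor_quadratic[OF this] show ?thesis by linarith
    qed
    finally have "(real n)\<^sup>2 \<le> (8 / \<kappa>\<^sup>2) * exp (real n * \<kappa> / 2)"
      using \<kappa> by (simp add: field_simps)
    then have "(real n)\<^sup>2 * r ^ n \<le> (8 / \<kappa>\<^sup>2) * exp (real n * \<kappa> / 2) * r ^ n"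
      using assms by (intro mult_right_mono) auto
    also have "\<dots> = (8 / \<kappa>\<^sup>2) * (exp (- (\<kappa> / 2))) ^ n"
      unfolding r exp_of_nat_mult[symmetric] by (simp add: exp_add[symmetric])
    finally show ?thesis using assms by simp
  qed
  show ?thesis
    by (rule summable_comparison_test'[OF _ bound]) (use \<kappa> in \<open>auto intro!: summable_mult summable_geometric\<close>)
qed

section \<open>Positions and rates under shifts\<close>

lemma site_shift: "site (shift l \<omega>) k = site \<omega> (k + l) - site \<omega> l"
proof (induction k rule: int_induct[where k = 0])
  case base
  then show ?case by (simp add: site_0)
next
  case (step1 k)
  have "site (shift l \<omega>) (k + 1) = site \<omega> (k + l) - site \<omega> l + fst (\<omega> (k + l))"
    using step1 by (simp add: site_add_1) (simp add: shift_def)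
  also have "\<dots> = site \<omega> (k + l + 1) - site \<omega> l" by (simp add: site_add_1)
  finally show ?case by (simp add: algebra_simps)
next
  case (step2 k)
  have "site (shift l \<omega>) k = site (shift l \<omega>) (k - 1) + fst (\<omega> (k - 1 + l))"
    using site_add_1[of "shift l \<omega>" "k - 1"] by (simp add: shift_def)
  moreover have "site \<omega> (k + l) = site \<omega> (k - 1 + l) + fst (\<omega> (k - 1 + l))"
    using site_add_1[of \<omega> "k - 1 + l"] by (simp add: algebra_simps)
  ultimately show ?case using step2 by simp
qed

lemma mott_rate_shift: "mott_rate u lam (shift l \<omega>) i k = mott_rate u lam \<omega> (i + l) (k + l)"
  by (simp add: mott_rate_def site_shift) (simp add: shift_def)

lemma mott_rate_nonneg: "0 \<le> mott_rate u lam \<omega> i k"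
  by (simp add: mott_rate_def)

lemma shift_shift: "shift k (shift l \<omega>) = shift (k + l) \<omega>"
  by (simp add: shift_def algebra_simps)

lemma shift_0: "shift 0 \<omega> = \<omega>"
  by (simp add: shift_def)

lemma shift_in_space: "\<omega> \<in> space env_space \<Longrightarrow> shift l \<omega> \<in> space env_space"
  by (simp add: space_env_space shift_def)

lemma measurable_coordinate [measurable]: "(\<lambda>\<omega>. \<omega> k) \<in> env_space \<rightarrow>\<^sub>M borel"
proof -
  have "(\<lambda>\<omega>. \<omega> k) \<in> env_space \<rightarrow>\<^sub>M restrict_space borel ({0<..} \<times> UNIV)"
    unfolding env_space_def by measurable
  then show ?thesis by (simp add: measurable_restrict_space2_iff)
qed

lemma measurable_fst_coordinate [measurable]: "(\<lambda>\<omega>. fst (\<omega> k)) \<in> borel_measurable env_space"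
  using measurable_compose[OF measurable_coordinate, of fst borel] by (simp add: borel_prod[symmetric])

lemma measurable_snd_coordinate [measurable]: "(\<lambda>\<omega>. snd (\<omega> k)) \<in> borel_measurable env_space"
  using measurable_compose[OF measurable_coordinate, of snd borel] by (simp add: borel_prod[symmetric])

lemma measurable_site [measurable]: "(\<lambda>\<omega>. site \<omega> k) \<in> borel_measurable env_space"
  unfolding site_def by measurable

text \<open>The bias itself is no parameter here, only its upper bound \<open>lmax\<close>. Every
  constant defined in this locale is therefore uniform over the biases considered.\<close>

locale mott_environment = stationary_ergodic_environment +
  fixes u :: "real \<Rightarrow> real \<Rightarrow> real" and U d lmax :: real
  assumes u_sym: "u x y = u y x"
    and u_bound: "\<bar>u x y\<bar> \<le> U"
    and u_measurable: "(\<lambda>(x, y). u x y) \<in> borel_measurable borel"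
    and d_pos: "0 < d" and Z0_ge_d: "AE \<omega> in P. d \<le> fst (\<omega> 0)"
    and lmax: "0 < lmax" "lmax < 1"
    and integrable_exp_Z0: "integrable P (\<lambda>\<omega>. exp (fst (\<omega> 0)))"
begin

lemma sets_P_env [measurable_cong]: "sets P = sets env_space"
  by (rule sets_P)

lemma space_P: "space P = space env_space"
  using sets_P by (rule sets_eq_imp_space_eq)

text \<open>Worst decay per index: the tilted exponent \<open>- \<bar>x\<bar> + lam * x\<close> is
  at most \<open>- (1 - lmax) * \<bar>x\<bar>\<close>, and each index contributes at least
  \<open>d\<close> to the distance.\<close>

definition \<rho> :: real where "\<rho> = exp (- ((1 - lmax) * d))"

lemma \<rho>: "0 < \<rho>" "\<rho> < 1"
  using lmax d_pos by (auto simp: \<rho>_def)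

definition good :: "environment set" where
  "good = {\<omega>\<in>space env_space. \<forall>k. d \<le> fst (\<omega> k)}"

lemma good_shift: "\<omega> \<in> good \<Longrightarrow> shift l \<omega> \<in> good"
  by (auto simp: good_def shift_in_space) (simp add: shift_def)

lemma measurable_mott_rate [measurable]: "(\<lambda>\<omega>. mott_rate u lam \<omega> i k) \<in> borel_measurable env_space"
proof -
  have "(\<lambda>\<omega>. u (snd (\<omega> i)) (snd (\<omega> k))) \<in> borel_measurable env_space"
    using measurable_compose[of "\<lambda>\<omega>. (snd (\<omega> i), snd (\<omega> k))" env_space borel, OF _ u_measurable]
    by (simp add: borel_prod[symmetric])
  then show ?thesis unfolding mott_rate_def by measurable
qed

definition rate_sum :: "real \<Rightarrow> environment \<Rightarrow> real" where
  "rate_sum lam \<omega> = (\<Sum>\<^sub>\<infinity>k. mott_rate u lam \<omega> 0 k)"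

lemma measurable_rate_sum [measurable]: "rate_sum lam \<in> borel_measurable env_space"
  unfolding rate_sum_def [abs_def] by (intro borel_measurable_infsum measurable_mott_rate)

lemma nn_integral_shift:
  assumes [measurable]: "f \<in> borel_measurable env_space"
  shows "(\<integral>\<^sup>+\<omega>. f (shift l \<omega>) \<partial>P) = (\<integral>\<^sup>+\<omega>. f \<omega> \<partial>P)"
proof -
  have "(\<integral>\<^sup>+\<omega>. f (shift l \<omega>) \<partial>P) = (\<integral>\<^sup>+\<omega>. f \<omega> \<partial>distr P env_space (shift l))"
    by (rule nn_integral_distr[symmetric]) measurable
  then show ?thesis by (simp add: stationary)
qed

lemma integral_shift:
  fixes f :: "environment \<Rightarrow> real"
  assumes [measurable]: "f \<in> borel_measurable env_space"
  shows "(\<integral>\<omega>. f (shift l \<omega>) \<partial>P) = (\<integral>\<omega>. f \<omega> \<partial>P)"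
proof -
  have "(\<integral>\<omega>. f (shift l \<omega>) \<partial>P) = (\<integral>\<omega>. f \<omega> \<partial>distr P env_space (shift l))"
    by (rule integral_distr[symmetric]) measurable
  then show ?thesis by (simp add: stationary)
qed

lemma integrable_shift:
  fixes f :: "environment \<Rightarrow> real"
  assumes "integrable P f"
  shows "integrable P (\<lambda>\<omega>. f (shift l \<omega>))"
proof -
  have "integrable (distr P env_space (shift l)) f"
    using assms by (simp add: stationary)
  then show ?thesis by (rule integrable_distr[rotated]) measurable
qed

lemma AE_all_shifts:
  assumes "AE \<omega> in P. R \<omega>"
  shows "AE \<omega> in P. \<forall>l. R (shift l \<omega>)"
proof -
  have "AE \<omega> in P. R (shift l \<omega>)" for l
  proof -
    have "AE \<omega> in distr P env_space (shift l). R \<omega>"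
      using assms by (simp only: stationary)
    then show ?thesis by (rule AE_distrD[rotated]) measurable
  qed
  then show ?thesis by (simp add: AE_all_countable)
qed

lemma AE_good: "AE \<omega> in P. \<omega> \<in> good"
  using AE_all_shifts[OF Z0_ge_d] AE_space
  by eventually_elim (auto simp: good_def space_P shift_def)

section \<open>Geometric decay of the jump rates\<close>

lemma site_diff_ge:
  assumes "\<omega> \<in> good" "i \<le> j"
  shows "d * (real_of_int j - real_of_int i) \<le> site \<omega> j - site \<omega> i"
  using assms(2)
proof (induction j rule: int_ge_induct)
  case (step j)
  have "d \<le> fst (\<omega> j)" using assms(1) by (auto simp: good_def)
  with step.IH site_add_1[of \<omega> j] show ?case by (simp add: algebra_simps)
qed simp

lemma abs_site_diff_ge:
  assumes "\<omega> \<in> good"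
  shows "d * real (nat \<bar>i - j\<bar>) \<le> \<bar>site \<omega> i - site \<omega> j\<bar>"
proof (cases "i \<le> j")
  case True
  then show ?thesis using site_diff_ge[OF assms True] by simp
next
  case False
  then show ?thesis using site_diff_ge[OF assms, of j i] by simp
qed

lemma \<rho>_power: "exp (- ((1 - lmax) * (d * real n))) = \<rho> ^ n"
  by (simp add: \<rho>_def exp_of_nat_mult[symmetric] algebra_simps)

lemma exp_site_le:
  assumes "\<omega> \<in> good"
  shows "exp (- ((1 - lmax) * \<bar>site \<omega> i - site \<omega> j\<bar>)) \<le> \<rho> ^ nat \<bar>i - j\<bar>"
  using abs_site_diff_ge[OF assms, of i j] lmax unfolding \<rho>_power[symmetric] by simp

lemma mott_rate_le_exp:
  assumes "0 \<le> lam" "lam \<le> lmax"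
  shows "mott_rate u lam \<omega> i k \<le> exp U * exp (- ((1 - lmax) * \<bar>site \<omega> i - site \<omega> k\<bar>))"
proof -
  let ?x = "site \<omega> k - site \<omega> i"
  have "lam * ?x \<le> lam * \<bar>?x\<bar>" using assms by (intro mult_left_mono) auto
  also have "\<dots> \<le> lmax * \<bar>?x\<bar>" using assms by (intro mult_right_mono) auto
  finally have "- \<bar>?x\<bar> + lam * ?x \<le> - ((1 - lmax) * \<bar>?x\<bar>)" by (simp add: algebra_simps)
  moreover have "u (snd (\<omega> i)) (snd (\<omega> k)) \<le> U" using u_bound abs_le_D1 by blast
  ultimately have "- \<bar>?x\<bar> + lam * ?x + u (snd (\<omega> i)) (snd (\<omega> k)) \<le> U - (1 - lmax) * \<bar>?x\<bar>"
    by linarith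
  then show ?thesis
    by (auto simp: mott_rate_def exp_add[symmetric] abs_minus_commute)
qed

lemma mott_rate_le:
  assumes "\<omega> \<in> good" "0 \<le> lam" "lam \<le> lmax"
  shows "mott_rate u lam \<omega> i k \<le> exp U * \<rho> ^ nat \<bar>i - k\<bar>"
  using mott_rate_le_exp[OF assms(2,3), of \<omega> i k] exp_site_le[OF assms(1), of i k]
  by (smt (verit) exp_gt_zero mult_left_mono)

lemma summable_on_geometric: "(\<lambda>k::int. \<rho> ^ nat \<bar>k\<bar>) summable_on UNIV"
  using \<rho> by (intro summable_on_nat_abs_int summable_geometric) auto

lemma summable_on_mott_rate:
  assumes "\<omega> \<in> good" "0 \<le> lam" "lam \<le> lmax"
  shows "mott_rate u lam \<omega> 0 summable_on UNIV"
proof (rule summable_on_comparison_test)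
  show "(\<lambda>k. exp U * \<rho> ^ nat \<bar>k\<bar>) summable_on UNIV"
    by (intro summable_on_cmult_right summable_on_geometric)
qed (use mott_rate_le[OF assms, of 0] mott_rate_nonneg in auto)

lemma mott_rate_le_rate_sum:
  assumes "\<omega> \<in> good" "0 \<le> lam" "lam \<le> lmax"
  shows "mott_rate u lam \<omega> 0 k \<le> rate_sum lam \<omega>"
  using finite_sum_le_infsum[OF summable_on_mott_rate[OF assms], of "{k}"]
  by (simp add: rate_sum_def mott_rate_nonneg)

lemma rate_sum_pos:
  assumes "\<omega> \<in> good" "0 \<le> lam" "lam \<le> lmax"
  shows "0 < rate_sum lam \<omega>"
  using mott_rate_le_rate_sum[OF assms, of 1] by (smt (verit) exp_gt_zero mott_rate_def zero_neq_one)

lemma rate_sum_nonneg: "0 \<le> rate_sum lam \<omega>"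
  unfolding rate_sum_def by (intro infsum_nonneg) (simp add: mott_rate_nonneg)

definition rate_const :: real where "rate_const = exp U * (\<Sum>\<^sub>\<infinity>k::int. \<rho> ^ nat \<bar>k\<bar>)"

lemma rate_sum_le:
  assumes "\<omega> \<in> good" "0 \<le> lam" "lam \<le> lmax"
  shows "rate_sum lam \<omega> \<le> rate_const"
proof -
  have "rate_sum lam \<omega> \<le> (\<Sum>\<^sub>\<infinity>k::int. exp U * \<rho> ^ nat \<bar>k\<bar>)"
    unfolding rate_sum_def
    by (intro infsum_mono summable_on_mott_rate[OF assms] summable_on_cmult_right summable_on_geometric)
      (use mott_rate_le[OF assms, of 0] in auto)
  then show ?thesis by (simp add: rate_const_def infsum_cmult_right')
qed

definition jump_const :: real where "jump_const = exp (2 * U) / \<rho>"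

lemma jump_const_nonneg: "0 \<le> jump_const"
  using \<rho> by (simp add: jump_const_def)

text \<open>The total rate has no positive lower bound common to all environments, so the comparison
  is relative: the rate to \<open>k\<close> is compared with the rate to the nearest neighbour on
  the same side, which is one summand of the total rate. The additional distance is at least
  \<open>d * (\<bar>k\<bar> - 1)\<close>, whence the factor \<open>1 / \<rho>\<close> in
  \<open>jump_const\<close>; the two values of \<open>u\<close> cost
  \<open>exp (2 * U)\<close>.\<close>

lemma mott_rate_le_jump:
  assumes "\<omega> \<in> good" "0 \<le> lam" "lam \<le> lmax"
  shows "mott_rate u lam \<omega> 0 k \<le> jump_const * \<rho> ^ nat \<bar>k\<bar> * rate_sum lam \<omega>"
proof (cases "k = 0")
  case False
  define s where "s = sgn k"
  have s: "s = 1 \<or> s = -1" using False by (auto simp: s_def sgn_if)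
  have ds: "d * real_of_int (\<bar>k\<bar> - 1) \<le> \<bar>site \<omega> k\<bar> - \<bar>site \<omega> s\<bar>"
  proof (cases "0 < k")
    case True
    then show ?thesis
      using site_diff_ge[OF assms(1), of 1 k] site_diff_ge[OF assms(1), of 0 1] d_pos
      by (simp add: s_def site_0)
  next
    case F: False
    with False have "k \<le> -1" by simp
    then show ?thesis
      using site_diff_ge[OF assms(1), of k "-1"] site_diff_ge[OF assms(1), of "-1" 0] d_pos False F
      by (simp add: s_def site_0 algebra_simps)
  qed
  have sg: "sgn (site \<omega> k) = of_int s" "sgn (site \<omega> s) = of_int s"
  proof -
    have pos: "0 < site \<omega> j" if "0 < j" for j
      using site_diff_ge[OF assms(1), of 0 j] that d_pos
      by (simp add: site_0) (smt (verit) mult_pos_pos of_int_0_less_iff)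
    have neg: "site \<omega> j < 0" if "j < 0" for j
      using site_diff_ge[OF assms(1), of j 0] that d_pos
      by (simp add: site_0) (smt (verit) mult_pos_neg of_int_less_0_iff)
    show "sgn (site \<omega> k) = of_int s"
      using False pos[of k] neg[of k] by (cases "0 < k") (simp_all add: s_def)
    show "sgn (site \<omega> s) = of_int s"
      using s pos[of 1] neg[of "- 1"] by auto
  qed
  \<comment> \<open>On one side of the origin the bias merely rescales the distance, so
    \<open>k\<close> and the neighbour \<open>s\<close> share the same exponential rate.\<close>
  have r: "mott_rate u lam \<omega> 0 j = exp (- (1 - lam * of_int s) * \<bar>site \<omega> j\<bar> + u (snd (\<omega> 0)) (snd (\<omega> j)))"
    if "j \<noteq> 0" "sgn (site \<omega> j) = of_int s" for j
  proof -
    have "site \<omega> j = of_int s * \<bar>site \<omega> j\<bar>" using that by (metis sgn_mult_abs)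
    then have "- \<bar>site \<omega> j\<bar> + lam * site \<omega> j = - (1 - lam * of_int s) * \<bar>site \<omega> j\<bar>"
      by (simp add: algebra_simps)
    then show ?thesis using that by (simp add: mott_rate_def site_0)
  qed
  have "(1 - lmax) * (d * real_of_int (\<bar>k\<bar> - 1)) \<le> (1 - lam * of_int s) * (\<bar>site \<omega> k\<bar> - \<bar>site \<omega> s\<bar>)"
    using ds s assms lmax d_pos False by (intro mult_mono) (auto intro!: mult_nonneg_nonneg)
  moreover have "u (snd (\<omega> 0)) (snd (\<omega> k)) \<le> U" "- U \<le> u (snd (\<omega> 0)) (snd (\<omega> s))"
    using u_bound[of "snd (\<omega> 0)" "snd (\<omega> k)"] u_bound[of "snd (\<omega> 0)" "snd (\<omega> s)"] by auto
  moreover have "s \<noteq> 0" using s by auto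
  ultimately have "mott_rate u lam \<omega> 0 k \<le>
      exp (2 * U - (1 - lmax) * (d * real_of_int (\<bar>k\<bar> - 1))) * mott_rate u lam \<omega> 0 s"
    using r[OF False sg(1)] r[OF _ sg(2)] by (simp add: exp_add[symmetric] algebra_simps)
  also have "exp (2 * U - (1 - lmax) * (d * real_of_int (\<bar>k\<bar> - 1))) = jump_const * \<rho> ^ nat \<bar>k\<bar>"
    unfolding jump_const_def \<rho>_power[symmetric] by (simp add: \<rho>_def exp_diff[symmetric] exp_add[symmetric] algebra_simps)
  also have "\<dots> * mott_rate u lam \<omega> 0 s \<le> \<dots> * rate_sum lam \<omega>"
    using mott_rate_le_rate_sum[OF assms] \<rho> by (intro mult_left_mono) (auto simp: jump_const_def)
  finally show ?thesis .
next
  case True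
  then show ?thesis using \<rho> rate_sum_nonneg by (simp add: mott_rate_def jump_const_def)
qed

end

section \<open>The current of a stationary density\<close>

lemma borel_measurable_nn_integral_count_space:
  fixes f :: "'k::countable \<Rightarrow> 'a \<Rightarrow> ennreal"
  assumes "\<And>k. f k \<in> borel_measurable M"
  shows "(\<lambda>\<omega>. \<integral>\<^sup>+k. f k \<omega> \<partial>count_space UNIV) \<in> borel_measurable M"
proof -
  interpret sigma_finite_measure "count_space (UNIV :: 'k set)"
    by (rule sigma_finite_measure_count_space)
  have "(\<lambda>(\<omega>, k). f k \<omega>) \<in> borel_measurable (M \<Otimes>\<^sub>M count_space UNIV)"
    using assms by (rule measurable_pair_count_space)
  then show ?thesis
    by (rule borel_measurable_nn_integral)
qed

lemma has_sum_iff_nn_integral_count_space: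
  fixes f :: "'a \<Rightarrow> real"
  assumes "\<And>x. 0 \<le> f x" "0 \<le> s"
  shows "(f has_sum s) UNIV \<longleftrightarrow> (\<integral>\<^sup>+x. ennreal (f x) \<partial>count_space UNIV) = ennreal s"
proof -
  have "(f has_sum s) UNIV \<longleftrightarrow> has_bochner_integral (count_space UNIV) f s"
    by (simp add: has_sum_iff has_bochner_integral_iff summable_on_iff_integrable_count_space
        infsum_eq_integral_count_space)
  also have "\<dots> \<longleftrightarrow> (\<integral>\<^sup>+x. ennreal (f x) \<partial>count_space UNIV) = ennreal s"
  proof
    assume "has_bochner_integral (count_space UNIV) f s"
    then show "(\<integral>\<^sup>+x. ennreal (f x) \<partial>count_space UNIV) = ennreal s"
      using assms by (auto simp: has_bochner_integral_iff nn_integral_eq_integral)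
  next
    assume "(\<integral>\<^sup>+x. ennreal (f x) \<partial>count_space UNIV) = ennreal s"
    then show "has_bochner_integral (count_space UNIV) f s"
      using assms by (intro has_bochner_integral_nn_integral) auto
  qed
  finally show ?thesis .
qed

lemma summable_on_tendsto_0_at_top:
  fixes w :: "int \<Rightarrow> real"
  assumes "w summable_on UNIV"
  shows "(w \<longlongrightarrow> 0) at_top"
proof -
  have "w summable_on range int"
    using assms by (rule summable_on_subset) simp
  then have "summable (\<lambda>n. w (int n))"
    by (subst (asm) summable_on_reindex) (auto simp: o_def intro: summable_on_imp_summable)
  then have "((\<lambda>n. w (int n)) \<longlongrightarrow> 0) at_top"
    by (rule summable_LIMSEQ_zero)
  then have "((\<lambda>a. w (int (nat a))) \<longlongrightarrow> 0) at_top"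
    by (rule filterlim_compose) (rule filterlim_nat_sequentially)
  moreover have "eventually (\<lambda>a. w (int (nat a)) = w a) at_top"
    using eventually_ge_at_top[of "0::int"] by eventually_elim simp
  ultimately show ?thesis
    by (rule Lim_transform_eventually)
qed

text \<open>By Tonelli and stationarity the series has mean \<open>E[w]\<close> times a convergent
  geometric series, so it is finite almost surely.\<close>

lemma (in mott_environment) AE_geometric_summable:
  assumes w: "integrable P w" "\<And>\<omega>. 0 \<le> w \<omega>" and r: "0 < r" "r < (1::real)"
  shows "AE \<omega> in P. (\<lambda>a. w (shift a \<omega>) * r ^ nat \<bar>a\<bar>) summable_on UNIV"
proof -
  have [measurable]: "w \<in> borel_measurable env_space"
    using borel_measurable_integrable[OF w(1)] by (simp cong: measurable_cong_sets add: sets_P)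
  have m: "(\<lambda>\<omega>. ennreal (w (shift a \<omega>) * r ^ nat \<bar>a\<bar>)) \<in> borel_measurable P" for a
    by measurable
  have "(\<integral>\<^sup>+\<omega>. (\<integral>\<^sup>+a. ennreal (w (shift a \<omega>) * r ^ nat \<bar>a\<bar>) \<partial>count_space UNIV) \<partial>P) =
      (\<integral>\<^sup>+a. (\<integral>\<^sup>+\<omega>. ennreal (w (shift a \<omega>) * r ^ nat \<bar>a\<bar>) \<partial>P) \<partial>count_space UNIV)"
    by (rule nn_integral_count_space_nn_integral) (auto simp: m)
  also have "\<dots> = (\<integral>\<^sup>+a. (\<integral>\<^sup>+\<omega>. ennreal (w \<omega>) \<partial>P) * ennreal (r ^ nat \<bar>a\<bar>) \<partial>count_space UNIV)"
  proof (intro nn_integral_cong)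
    fix a :: int
    have "(\<integral>\<^sup>+\<omega>. ennreal (w (shift a \<omega>) * r ^ nat \<bar>a\<bar>) \<partial>P) = (\<integral>\<^sup>+\<omega>. ennreal (w \<omega> * r ^ nat \<bar>a\<bar>) \<partial>P)"
      by (rule nn_integral_shift[of "\<lambda>\<omega>. ennreal (w \<omega> * r ^ nat \<bar>a\<bar>)"]) measurable
    also have "\<dots> = (\<integral>\<^sup>+\<omega>. ennreal (w \<omega>) * ennreal (r ^ nat \<bar>a\<bar>) \<partial>P)"
      using w r by (simp add: ennreal_mult)
    also have "\<dots> = (\<integral>\<^sup>+\<omega>. ennreal (w \<omega>) \<partial>P) * ennreal (r ^ nat \<bar>a\<bar>)"
      by (rule nn_integral_multc) measurable
    finally show "(\<integral>\<^sup>+\<omega>. ennreal (w (shift a \<omega>) * r ^ nat \<bar>a\<bar>) \<partial>P) = \<dots>" .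
  qed
  also have "\<dots> = (\<integral>\<^sup>+\<omega>. ennreal (w \<omega>) \<partial>P) * (\<integral>\<^sup>+a. ennreal (r ^ nat \<bar>a::int\<bar>) \<partial>count_space UNIV)"
    by (rule nn_integral_cmult) auto
  also have "\<dots> < \<infinity>"
  proof -
    have "(\<lambda>k::int. r ^ nat \<bar>k\<bar>) summable_on UNIV"
      using r by (intro summable_on_nat_abs_int summable_geometric) auto
    then have "integrable (count_space UNIV) (\<lambda>k::int. r ^ nat \<bar>k\<bar>)"
      by (simp add: summable_on_iff_integrable_count_space)
    then have "(\<integral>\<^sup>+a. ennreal (r ^ nat \<bar>a::int\<bar>) \<partial>count_space UNIV) < \<infinity>"
      using r by (simp add: nn_integral_eq_integral)
    moreover have "(\<integral>\<^sup>+\<omega>. ennreal (w \<omega>) \<partial>P) < \<infinity>"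
      using w by (simp add: nn_integral_eq_integral)
    ultimately show ?thesis by (simp add: ennreal_mult_less_top)
  qed
  finally have "AE \<omega> in P. (\<integral>\<^sup>+a. ennreal (w (shift a \<omega>) * r ^ nat \<bar>a\<bar>) \<partial>count_space UNIV) \<noteq> \<infinity>"
    by (intro nn_integral_PInf_AE borel_measurable_nn_integral_count_space m) auto
  then show ?thesis
  proof eventually_elim
    case (elim \<omega>)
    then show ?case
      using w r by (auto simp: summable_on_iff_integrable_count_space integrable_iff_bounded top.not_eq_extremum)
  qed
qed

text \<open>Ergodicity concerns strictly invariant sets, whereas the function is invariant only
  almost surely. Requiring \<open>v < F\<close> along the whole orbit gives a strictly invariant
  set. If it had probability 1, the mean would exceed itself, so \<open>F\<close> is at most its
  mean; the same applied to \<open>- J\<close> gives equality.\<close>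

lemma (in stationary_ergodic_environment) invariant_constant:
  fixes J :: "environment \<Rightarrow> real"
  assumes J [measurable]: "J \<in> borel_measurable env_space" and int: "integrable P J"
    and inv: "AE \<omega> in P. \<forall>l. J (shift l \<omega>) = J \<omega>"
  shows "AE \<omega> in P. J \<omega> = (\<integral>\<omega>. J \<omega> \<partial>P)"
proof -
  have [measurable_cong]: "sets P = sets env_space" by (rule sets_P)
  have space: "space P = space env_space" using sets_P by (rule sets_eq_imp_space_eq)
  have le: "AE \<omega> in P. F \<omega> \<le> (\<integral>\<omega>. F \<omega> \<partial>P)"
    if F [measurable]: "F \<in> borel_measurable env_space" and intF: "integrable P F"
      and invF: "AE \<omega> in P. \<forall>l. F (shift l \<omega>) = F \<omega>" for F :: "environment \<Rightarrow> real"
  proof -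
    define v where "v = (\<integral>\<omega>. F \<omega> \<partial>P)"
    define A where "A = {\<omega>\<in>space env_space. \<forall>l. v < F (shift l \<omega>)}"
    have A [measurable]: "A \<in> sets env_space" unfolding A_def by measurable
    have "shift m -` A \<inter> space env_space = A" for m
    proof -
      have *: "(\<forall>l. v < F (shift (l + m) \<omega>)) \<longleftrightarrow> (\<forall>l. v < F (shift l \<omega>))" for \<omega>
        by (metis diff_add_cancel)
      show ?thesis
        unfolding A_def by (auto simp: shift_in_space shift_shift *)
    qed
    with ergodic[OF A] have "prob A = 0 \<or> prob A = 1" by blast
    moreover have "prob A \<noteq> 1"
    proof
      assume "prob A = 1"
      then have "AE \<omega> in P. \<omega> \<in> A" by (rule AE_prob_1)
      then have "AE \<omega> in P. v < F \<omega>"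
      proof eventually_elim
        case (elim \<omega>)
        then have "v < F (shift 0 \<omega>)" unfolding A_def by blast
        then show ?case by (simp add: shift_0)
      qed
      then have "v < (\<integral>\<omega>. F \<omega> \<partial>P)"
        using integral_less_AE_space[of "\<lambda>_. v" F] intF emeasure_space_1
        by (simp add: prob_space)
      then show False by (simp add: v_def)
    qed
    ultimately have "prob A = 0" by blast
    then have "AE \<omega> in P. \<omega> \<notin> A"
      by (subst (asm) prob_eq_0) (auto simp: sets_P)
    with invF AE_space show ?thesis
    proof eventually_elim
      case (elim \<omega>)
      then show ?case
        by (auto simp: A_def space v_def not_less)
    qed
  qed
  have "AE \<omega> in P. - J \<omega> \<le> (\<integral>\<omega>. - J \<omega> \<partial>P)"
    using inv int by (intro le[of "\<lambda>\<omega>. - J \<omega>"]) auto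
  moreover have "(\<integral>\<omega>. - J \<omega> \<partial>P) = - (\<integral>\<omega>. J \<omega> \<partial>P)" by simp
  ultimately have "AE \<omega> in P. (\<integral>\<omega>. J \<omega> \<partial>P) \<le> J \<omega>" by simp
  with le[OF J int inv] show ?thesis by eventually_elim simp
qed

locale mott_stationary_density = mott_environment +
  fixes lam :: real and f :: "environment \<Rightarrow> real"
  assumes lam: "0 < lam" "lam \<le> lmax"
    and f_measurable [measurable]: "f \<in> borel_measurable env_space"
    and f_nonneg: "0 \<le> f \<omega>"
    and nn_integral_f: "(\<integral>\<^sup>+\<omega>. ennreal (f \<omega>) \<partial>P) = 1"
    and invariance: "A \<in> sets env_space \<Longrightarrow>
      (\<integral>\<^sup>+\<omega>. (\<integral>\<^sup>+k. ennreal (f \<omega> * mott_prob u lam \<omega> 0 k) * indicator A (shift k \<omega>) \<partial>count_space UNIV) \<partial>P)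
       = (\<integral>\<^sup>+\<omega>. ennreal (f \<omega>) * indicator A \<omega> \<partial>P)"
begin

lemma integrable_f: "integrable P f"
  using nn_integral_f f_nonneg by (intro integrableI_nonneg) auto

lemma lam_nonneg: "0 \<le> lam" using lam by simp

text \<open>
  \<open>q k\<close> is the intensity of jumps from index \<open>0\<close> to index \<open>k\<close> in the steady state. The division is harmless on
  \<open>good\<close>, where the total rate is positive.
\<close>

definition g :: "environment \<Rightarrow> real" where "g \<omega> = f \<omega> / rate_sum lam \<omega>"

definition q :: "int \<Rightarrow> environment \<Rightarrow> real" where "q k \<omega> = g \<omega> * mott_rate u lam \<omega> 0 k"

lemma measurable_g [measurable]: "g \<in> borel_measurable env_space"
  unfolding g_def [abs_def] by measurable

lemma measurable_q [measurable]: "q k \<in> borel_measurable env_space"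
  unfolding q_def [abs_def] by measurable

lemma g_nonneg: "0 \<le> g \<omega>"
  by (simp add: g_def f_nonneg rate_sum_nonneg)

lemma q_nonneg: "0 \<le> q k \<omega>"
  by (simp add: q_def g_nonneg mott_rate_nonneg)

lemma q_eq: "q k \<omega> = f \<omega> * mott_prob u lam \<omega> 0 k"
  by (simp add: q_def g_def mott_prob_def rate_sum_def)

lemma q_out:
  assumes "\<omega> \<in> good"
  shows "((\<lambda>k. q k \<omega>) has_sum f \<omega>) UNIV"
proof -
  have "(mott_rate u lam \<omega> 0 has_sum rate_sum lam \<omega>) UNIV"
    unfolding rate_sum_def by (intro has_sum_infsum summable_on_mott_rate assms lam lam_nonneg)
  from has_sum_cmult_right[OF this, of "g \<omega>"] show ?thesis
    using rate_sum_pos[OF assms lam_nonneg lam(2)] by (simp add: q_def g_def)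
qed

lemma q_le:
  assumes "\<omega> \<in> good"
  shows "q k \<omega> \<le> jump_const * \<rho> ^ nat \<bar>k\<bar> * f \<omega>"
proof -
  have "q k \<omega> \<le> g \<omega> * (jump_const * \<rho> ^ nat \<bar>k\<bar> * rate_sum lam \<omega>)"
    unfolding q_def by (intro mult_left_mono mott_rate_le_jump assms lam lam_nonneg g_nonneg)
  also have "\<dots> = jump_const * \<rho> ^ nat \<bar>k\<bar> * f \<omega>"
    using rate_sum_pos[OF assms lam_nonneg lam(2)] by (simp add: g_def)
  finally show ?thesis .
qed

text \<open>Stationarity of \<open>P\<close> moves the endpoint of each jump to the origin, so
  integrated invariance becomes the equality of two densities with respect to \<open>P\<close>.
  Uniqueness of densities turns it into the balance of inflow and \<open>f\<close> at almost every
  environment.\<close>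

lemma AE_q_in: "AE \<omega> in P. ((\<lambda>k. q k (shift (- k) \<omega>)) has_sum f \<omega>) UNIV"
proof -
  define F where "F \<omega> = (\<integral>\<^sup>+k. ennreal (q k (shift (- k) \<omega>)) \<partial>count_space UNIV)" for \<omega>
  have [measurable]: "F \<in> borel_measurable env_space"
    unfolding F_def [abs_def] by (rule borel_measurable_nn_integral_count_space) measurable
  have "AE \<omega> in P. ennreal (f \<omega>) = F \<omega>"
  proof (rule density_unique_finite_measure)
    fix A assume "A \<in> events"
    then have A [measurable]: "A \<in> sets env_space" by (simp add: sets_P)
    have "(\<integral>\<^sup>+\<omega>. ennreal (f \<omega>) * indicator A \<omega> \<partial>P) = (\<integral>\<^sup>+\<omega>. (\<integral>\<^sup>+k. ennreal (q k \<omega>) * indicator A (shift k \<omega>) \<partial>count_space UNIV) \<partial>P)"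
      by (subst invariance[symmetric]) (auto simp: q_eq)
    also have "\<dots> = (\<integral>\<^sup>+k. (\<integral>\<^sup>+\<omega>. ennreal (q k \<omega>) * indicator A (shift k \<omega>) \<partial>P) \<partial>count_space UNIV)"
      by (rule nn_integral_count_space_nn_integral) auto
    also have "\<dots> = (\<integral>\<^sup>+k. (\<integral>\<^sup>+\<omega>. ennreal (q k (shift (- k) \<omega>)) * indicator A \<omega> \<partial>P) \<partial>count_space UNIV)"
    proof (rule nn_integral_cong)
      fix k
      have "(\<integral>\<^sup>+\<omega>. ennreal (q k (shift (- k) \<omega>)) * indicator A (shift k (shift (- k) \<omega>)) \<partial>P) =
          (\<integral>\<^sup>+\<omega>. ennreal (q k \<omega>) * indicator A (shift k \<omega>) \<partial>P)"
        by (rule nn_integral_shift[of "\<lambda>\<omega>. ennreal (q k \<omega>) * indicator A (shift k \<omega>)"]) measurable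
      then show "(\<integral>\<^sup>+\<omega>. ennreal (q k \<omega>) * indicator A (shift k \<omega>) \<partial>P) =
          (\<integral>\<^sup>+\<omega>. ennreal (q k (shift (- k) \<omega>)) * indicator A \<omega> \<partial>P)"
        by (simp add: shift_shift shift_0)
    qed
    also have "\<dots> = (\<integral>\<^sup>+\<omega>. (\<integral>\<^sup>+k. ennreal (q k (shift (- k) \<omega>)) * indicator A \<omega> \<partial>count_space UNIV) \<partial>P)"
      by (rule nn_integral_count_space_nn_integral[symmetric]) auto
    also have "\<dots> = (\<integral>\<^sup>+\<omega>. F \<omega> * indicator A \<omega> \<partial>P)"
      unfolding F_def by (intro nn_integral_cong nn_integral_multc) auto
    finally show "(\<integral>\<^sup>+\<omega>. ennreal (f \<omega>) * indicator A \<omega> \<partial>P) = (\<integral>\<^sup>+\<omega>. F \<omega> * indicator A \<omega> \<partial>P)" .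
  qed auto
  then show ?thesis
    by eventually_elim (auto simp: has_sum_iff_nn_integral_count_space q_nonneg f_nonneg F_def)
qed

text \<open>Half of the decay per index of the weight \<open>exp (- 2 * lam * x)\<close>: one factor
  tames \<open>f\<close> along the orbit, the other one \<open>exp Z\<close>.\<close>

definition decay :: real where "decay = exp (- (lam * d))"

lemma decay: "0 < decay" "decay < 1"
  using lam d_pos by (auto simp: decay_def)

text \<open>Collects what the pathwise argument consumes: balance at every vertex, the
  \<open>\<rho>\<close> series for sums over cuts, and the two \<open>decay\<close> series, which
  give the limit of \<open>h\<close> at infinity and the convergence of the resistance.\<close>

definition regular :: "environment \<Rightarrow> bool" where
  "regular \<omega> \<longleftrightarrow> \<omega> \<in> good
    \<and> (\<forall>l. ((\<lambda>k. q k (shift (- k) (shift l \<omega>))) has_sum f (shift l \<omega>)) UNIV)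
    \<and> (\<lambda>a. f (shift a \<omega>) * \<rho> ^ nat \<bar>a\<bar>) summable_on UNIV
    \<and> (\<lambda>a. f (shift a \<omega>) * decay ^ nat \<bar>a\<bar>) summable_on UNIV
    \<and> (\<lambda>a. exp (fst (\<omega> a)) * decay ^ nat \<bar>a\<bar>) summable_on UNIV"

lemma AE_regular: "AE \<omega> in P. regular \<omega>"
  using AE_good AE_all_shifts[OF AE_q_in]
    AE_geometric_summable[OF integrable_f f_nonneg \<rho>]
    AE_geometric_summable[OF integrable_f f_nonneg decay]
    AE_geometric_summable[OF integrable_exp_Z0 exp_ge_zero decay]
  by eventually_elim (simp add: regular_def, simp add: shift_def)

section \<open>The flow in a frozen environment and its flux\<close>

definition flow :: "environment \<Rightarrow> int \<Rightarrow> int \<Rightarrow> real" where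
  "flow \<omega> a b = q (b - a) (shift a \<omega>)"

lemma flow_nonneg: "0 \<le> flow \<omega> a b"
  by (simp add: flow_def q_nonneg)

lemma flow_out:
  assumes "regular \<omega>"
  shows "((\<lambda>b. flow \<omega> a b) has_sum f (shift a \<omega>)) UNIV"
proof -
  have "((\<lambda>k. q k (shift a \<omega>)) has_sum f (shift a \<omega>)) UNIV"
    using assms by (intro q_out good_shift) (simp add: regular_def)
  then show ?thesis unfolding flow_def
    by (subst has_sum_reindex_bij_witness[of UNIV "\<lambda>k. k + a" "\<lambda>b. b - a"]) auto
qed

lemma flow_in:
  assumes "regular \<omega>"
  shows "((\<lambda>b. flow \<omega> b a) has_sum f (shift a \<omega>)) UNIV"
proof -
  have "((\<lambda>k. q k (shift (- k) (shift a \<omega>))) has_sum f (shift a \<omega>)) UNIV"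
    using assms by (simp add: regular_def)
  then show ?thesis unfolding flow_def
    by (subst has_sum_reindex_bij_witness[of UNIV "\<lambda>k. a - k" "\<lambda>b. a - b"]) (auto simp: shift_shift)
qed

text \<open>A bond across the cut has length at least
  \<open>\<bar>a\<bar> + \<bar>b\<bar> - 2 * \<bar>i\<bar>\<close>, so geometric decay in the length
  splits into decay in both endpoints, and the double series is dominated by a product.\<close>

lemma flow_cut_summable:
  assumes "regular \<omega>"
  shows "(\<lambda>(a, b). flow \<omega> a b * (of_bool (a \<le> i) - of_bool (b \<le> i))) summable_on UNIV"
proof -
  have "(\<lambda>a. f (shift a \<omega>) * \<rho> ^ nat \<bar>a\<bar>) summable_on UNIV" (is "?F summable_on _")
    using assms by (simp add: regular_def)
  then have "(\<lambda>(a, b). ?F a * \<rho> ^ nat \<bar>b\<bar>) summable_on UNIV \<times> (UNIV :: int set)"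
    using summable_on_geometric \<rho> f_nonneg
    by (intro summable_on_SigmaI[where g = "\<lambda>a. ?F a * infsum (\<lambda>k::int. \<rho> ^ nat \<bar>k\<bar>) UNIV"])
      (auto intro!: has_sum_cmult_right summable_on_cmult_left)
  from summable_on_cmult_right[OF this, of "jump_const / \<rho> ^ (2 * nat \<bar>i\<bar>)"]
  have sum: "(\<lambda>(a, b). jump_const / \<rho> ^ (2 * nat \<bar>i\<bar>) * (?F a * \<rho> ^ nat \<bar>b\<bar>)) summable_on UNIV"
    by (simp add: case_prod_unfold)
  have "(\<lambda>x. \<bar>case x of (a, b) \<Rightarrow> flow \<omega> a b * (of_bool (a \<le> i) - of_bool (b \<le> i))\<bar>) summable_on UNIV"
  proof (rule summable_on_comparison_test[OF sum], clarify)
    fix a b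
    show "\<bar>flow \<omega> a b * (of_bool (a \<le> i) - of_bool (b \<le> i))\<bar> \<le>
        jump_const / \<rho> ^ (2 * nat \<bar>i\<bar>) * (?F a * \<rho> ^ nat \<bar>b\<bar>)"
    proof (cases "a \<le> i \<longleftrightarrow> b \<le> i")
      case False
      have "\<rho> ^ nat \<bar>b - a\<bar> * \<rho> ^ (2 * nat \<bar>i\<bar>) \<le> \<rho> ^ nat \<bar>a\<bar> * \<rho> ^ nat \<bar>b\<bar>"
        unfolding power_add[symmetric] using False \<rho> by (intro power_decreasing) auto
      then have *: "\<rho> ^ nat \<bar>b - a\<bar> \<le> \<rho> ^ nat \<bar>a\<bar> * \<rho> ^ nat \<bar>b\<bar> / \<rho> ^ (2 * nat \<bar>i\<bar>)"
        using \<rho> by (simp add: field_simps)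
      have "\<bar>flow \<omega> a b * (of_bool (a \<le> i) - of_bool (b \<le> i))\<bar> = flow \<omega> a b"
        using False flow_nonneg[of \<omega> a b] by (auto simp: abs_mult)
      also have "\<dots> \<le> jump_const * \<rho> ^ nat \<bar>b - a\<bar> * f (shift a \<omega>)"
        using q_le[of "shift a \<omega>" "b - a"] assms by (simp add: flow_def regular_def good_shift)
      also have "\<dots> \<le> jump_const * (\<rho> ^ nat \<bar>a\<bar> * \<rho> ^ nat \<bar>b\<bar> / \<rho> ^ (2 * nat \<bar>i\<bar>)) * f (shift a \<omega>)"
        by (intro mult_right_mono mult_left_mono * jump_const_nonneg f_nonneg)
      also have "\<dots> = jump_const / \<rho> ^ (2 * nat \<bar>i\<bar>) * (?F a * \<rho> ^ nat \<bar>b\<bar>)"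
        by simp
      finally show ?thesis .
    next
      case True
      then have "of_bool (a \<le> i) - of_bool (b \<le> i) = (0::real)" by auto
      then show ?thesis
        using \<rho> f_nonneg[of "shift a \<omega>"] by (simp add: jump_const_def)
    qed
  qed simp
  then show ?thesis
    by (subst summable_on_iff_abs_summable_on_real) (simp only: real_norm_def)
qed

text \<open>
  Net flux across the bond between the indices \<open>0\<close> and \<open>1\<close>, summed over ordered pairs.
\<close>

definition current :: "environment \<Rightarrow> real" where
  "current \<omega> = (\<Sum>\<^sub>\<infinity>(a, b). flow \<omega> a b * (of_bool (a \<le> 0) - of_bool (b \<le> 0)))"

lemma measurable_current [measurable]: "current \<in> borel_measurable env_space"
  unfolding current_def [abs_def] flow_def case_prod_unfold
  by (rule borel_measurable_infsum) measurable

text \<open>Shifting the environment only relocates the cut from 0 to \<open>l\<close>.\<close>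

lemma current_shift:
  assumes "regular \<omega>"
  shows "current (shift l \<omega>) = current \<omega>"
proof -
  have "current (shift l \<omega>) = (\<Sum>\<^sub>\<infinity>(a, b). flow \<omega> a b * (of_bool (a \<le> l) - of_bool (b \<le> l)))"
    unfolding current_def
    by (rule infsum_reindex_bij_witness[of UNIV "\<lambda>(a, b). (a - l, b - l)" "\<lambda>(a, b). (a + l, b + l)"])
      (auto simp: flow_def shift_shift)
  also have "\<dots> = current \<omega>"
    unfolding current_def
  proof (rule flow_constant)
    show "flow \<omega> i summable_on UNIV" "(\<lambda>b. flow \<omega> b i) summable_on UNIV" for i
      using flow_out[OF assms, of i] flow_in[OF assms, of i] by (auto simp: summable_on_def)
    show "infsum (flow \<omega> i) UNIV = (\<Sum>\<^sub>\<infinity>b. flow \<omega> b i)" for i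
      using flow_out[OF assms, of i] flow_in[OF assms, of i] by (simp add: infsumI)
  qed (rule flow_cut_summable[OF assms])
  finally show ?thesis .
qed

text \<open>
  Up to the factor \<open>exp U\<close>, the resistance between \<open>0\<close> and \<open>\<infinity>\<close> of the nearest neighbour network.
\<close>

definition resistance :: "environment \<Rightarrow> real" where
  "resistance \<omega> = (\<Sum>j. exp (- (2 * lam * site \<omega> (int j)) + (1 - lam) * fst (\<omega> (int j))))"

lemma resistance_term_le:
  assumes "\<omega> \<in> good"
  shows "exp (- (2 * lam * site \<omega> (int j)) + (1 - lam) * fst (\<omega> (int j))) \<le> exp (fst (\<omega> (int j))) * (decay ^ j) ^ 2"
proof -
  have "lam * (d * real j) \<le> lam * site \<omega> (int j)"
    using site_diff_ge[OF assms, of 0 "int j"] lam by (intro mult_left_mono) (auto simp: site_0)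
  moreover have "0 \<le> lam * fst (\<omega> (int j))"
    using assms lam d_pos by (intro mult_nonneg_nonneg) (auto simp: good_def intro: order_trans less_imp_le)
  moreover have "(decay ^ j) ^ 2 = exp (- (2 * (lam * (d * real j))))"
    unfolding decay_def exp_of_nat_mult[symmetric] by (simp add: algebra_simps)
  ultimately show ?thesis by (simp add: exp_add[symmetric] algebra_simps)
qed

lemma summable_resistance:
  assumes "regular \<omega>"
  shows "summable (\<lambda>j. exp (- (2 * lam * site \<omega> (int j)) + (1 - lam) * fst (\<omega> (int j))))"
proof (rule summable_comparison_test')
  have "(\<lambda>a. exp (fst (\<omega> a)) * decay ^ nat \<bar>a\<bar>) summable_on range int"
    by (rule summable_on_subset[of _ UNIV]) (use assms in \<open>auto simp: regular_def\<close>)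
  then show "summable (\<lambda>j. exp (fst (\<omega> (int j))) * decay ^ j)"
    by (subst (asm) summable_on_reindex) (auto simp: o_def intro: summable_on_imp_summable)
  fix j
  have "exp (- (2 * lam * site \<omega> (int j)) + (1 - lam) * fst (\<omega> (int j))) \<le> exp (fst (\<omega> (int j))) * (decay ^ j) ^ 2"
    using assms by (intro resistance_term_le) (simp add: regular_def)
  also have "\<dots> \<le> exp (fst (\<omega> (int j))) * decay ^ j"
    using decay by (intro mult_left_mono) (auto simp: power2_eq_square intro!: mult_left_le power_le_one)
  finally show "norm (exp (- (2 * lam * site \<omega> (int j)) + (1 - lam) * fst (\<omega> (int j)))) \<le> exp (fst (\<omega> (int j))) * decay ^ j"
    by simp
qed

text \<open>Here the network bound meets the environment. To the left, the conductances are summable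
  because \<open>exp (2 * lam * x)\<close> decays there; to the right, the same tilt drives
  \<open>h\<close> to 0. At the origin \<open>h\<close> is just \<open>g\<close>.\<close>

lemma g_le_current:
  assumes reg: "regular \<omega>"
  shows "g \<omega> \<le> max 0 (current \<omega>) * (exp U * resistance \<omega>)"
proof -
  have good: "\<omega> \<in> good" using reg by (simp add: regular_def)
  define c where "c a b = exp (2 * lam * site \<omega> a) * mott_rate u lam \<omega> a b" for a b
  define h where "h a = exp (- (2 * lam * site \<omega> a)) * g (shift a \<omega>)" for a
  have ch: "c a b * h a = flow \<omega> a b" for a b
    by (simp add: c_def h_def flow_def q_def mott_rate_shift exp_minus)
  have sym: "c a b = c b a" for a b
    by (auto simp: c_def mott_rate_def exp_add[symmetric] u_sym abs_minus_commute algebra_simps)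
  have res: "1 / c (int j) (int j + 1) \<le> exp U * exp (- (2 * lam * site \<omega> (int j)) + (1 - lam) * fst (\<omega> (int j)))" for j
  proof -
    have "d \<le> fst (\<omega> (int j))" using good by (auto simp: good_def)
    then have "mott_rate u lam \<omega> (int j) (int j + 1) =
        exp (- ((1 - lam) * fst (\<omega> (int j))) + u (snd (\<omega> (int j))) (snd (\<omega> (int j + 1))))"
      using d_pos by (simp add: mott_rate_def site_add_1) (simp add: algebra_simps)
    then have "c (int j) (int j + 1) = exp (2 * lam * site \<omega> (int j) - (1 - lam) * fst (\<omega> (int j))
        + u (snd (\<omega> (int j))) (snd (\<omega> (int j + 1))))"
      unfolding c_def by (simp add: exp_add[symmetric])
    then have "1 / c (int j) (int j + 1) = exp (- (2 * lam * site \<omega> (int j)) + (1 - lam) * fst (\<omega> (int j)) - u (snd (\<omega> (int j))) (snd (\<omega> (int j + 1))))"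
      by (simp add: exp_minus[symmetric] inverse_eq_divide[symmetric])
    moreover have "- u (snd (\<omega> (int j))) (snd (\<omega> (int j + 1))) \<le> U"
      using u_bound abs_le_D2 by blast
    ultimately show ?thesis by (simp add: exp_add[symmetric])
  qed
  have c0: "0 \<le> c a b" for a b by (simp add: c_def mott_rate_nonneg)
  have cpos: "0 < c j (j + 1)" for j by (simp add: c_def mott_rate_def)
  have res_sum: "summable (\<lambda>j. 1 / c (int j) (int j + 1))"
    by (rule summable_comparison_test'[OF summable_mult[OF summable_resistance[OF reg], of "exp U"]])
      (use res c0 in auto)
  have "h 0 \<le> max 0 (current \<omega>) * (\<Sum>j. 1 / c (int j) (int j + 1))"
  proof (rule flow_resistance_bound)
    show "c a b = c b a" for a b by (rule sym)
    show "0 \<le> c a b" for a b by (rule c0)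
    show "0 \<le> h a" for a by (simp add: h_def g_nonneg)
    show "0 < c j (j + 1)" for j by (rule cpos)
    show "(\<lambda>(a, b). c a b * h a * (of_bool (a \<le> i) - of_bool (b \<le> i))) summable_on UNIV" for i
      unfolding ch by (rule flow_cut_summable[OF reg])
    show "(\<lambda>b. c i b * h i) summable_on UNIV" "(\<lambda>b. c b i * h b) summable_on UNIV" for i
      unfolding ch using flow_out[OF reg, of i] flow_in[OF reg, of i] by (auto simp: summable_on_def)
    show "(\<Sum>\<^sub>\<infinity>b. c i b * h i) = (\<Sum>\<^sub>\<infinity>b. c b i * h b)" for i
      unfolding ch using flow_out[OF reg, of i] flow_in[OF reg, of i] by (simp add: infsumI)
    show "summable (\<lambda>j. 1 / c (int j) (int j + 1))" by (rule res_sum)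
    show "current \<omega> = (\<Sum>\<^sub>\<infinity>(a, b). c a b * h a * (of_bool (a \<le> (0::int)) - of_bool (b \<le> 0)))"
      unfolding ch by (simp add: current_def)
    show "(\<lambda>(a, b). c a b * of_bool (a \<le> 0)) summable_on UNIV"
    proof (rule summable_on_comparison_test)
      have "(\<lambda>(a, k). decay ^ nat \<bar>a\<bar> * \<rho> ^ nat \<bar>k\<bar>) summable_on UNIV \<times> (UNIV :: int set)"
        using summable_on_geometric \<rho> decay
        by (intro summable_on_SigmaI[where g = "\<lambda>a::int. decay ^ nat \<bar>a\<bar> * infsum (\<lambda>k::int. \<rho> ^ nat \<bar>k\<bar>) UNIV"])
          (auto intro!: has_sum_cmult_right summable_on_cmult_left summable_on_nat_abs_int summable_geometric)
      then have "(\<lambda>(a, b). decay ^ nat \<bar>a\<bar> * \<rho> ^ nat \<bar>b - a\<bar>) summable_on UNIV"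
        by (subst summable_on_reindex_bij_witness[of UNIV "\<lambda>(a, k). (a, k + a)" "\<lambda>(a, b). (a, b - a)"]) auto
      from summable_on_cmult_right[OF this, of "exp U"]
      show "(\<lambda>(a, b). exp U * (decay ^ nat \<bar>a\<bar> * \<rho> ^ nat \<bar>b - a\<bar>)) summable_on UNIV"
        by (simp add: case_prod_unfold)
      fix x :: "int \<times> int"
      obtain a b where x: "x = (a, b)" by (cases x)
      have "c a b \<le> exp U * (decay ^ nat \<bar>a\<bar> * \<rho> ^ nat \<bar>b - a\<bar>)" if a: "a \<le> 0"
      proof -
        have "site \<omega> a \<le> d * real_of_int a"
          using site_diff_ge[OF good a] by (simp add: site_0)
        then have "lam * site \<omega> a \<le> lam * (d * real_of_int a)"
          using lam by (intro mult_left_mono) auto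
        moreover have "lam * (d * real_of_int a) \<le> 0"
          using lam d_pos a by (simp add: mult_nonneg_nonpos)
        moreover have "decay ^ nat \<bar>a\<bar> = exp (lam * (d * real_of_int a))"
          unfolding decay_def exp_of_nat_mult[symmetric] using a by (simp add: algebra_simps)
        ultimately have 1: "exp (2 * lam * site \<omega> a) \<le> decay ^ nat \<bar>a\<bar>"
          by simp
        have 2: "mott_rate u lam \<omega> a b \<le> exp U * \<rho> ^ nat \<bar>b - a\<bar>"
          using mott_rate_le[OF good lam_nonneg lam(2), of a b] by (simp add: abs_minus_commute)
        show ?thesis
          using mult_mono[OF 1 2] decay mott_rate_nonneg by (simp add: c_def mult_ac)
      qed
      then show "(case x of (a, b) \<Rightarrow> c a b * of_bool (a \<le> 0)) \<le>
          (case x of (a, b) \<Rightarrow> exp U * (decay ^ nat \<bar>a\<bar> * \<rho> ^ nat \<bar>b - a\<bar>))"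
        using decay \<rho> by (auto simp: x)
    qed (use c0 in auto)
    show "(h \<longlongrightarrow> 0) at_top"
    proof (rule tendsto_sandwich[where f = "\<lambda>_. 0"])
      have "((\<lambda>a. exp U * ((f (shift a \<omega>) * decay ^ nat \<bar>a\<bar>) * (exp (fst (\<omega> a)) * decay ^ nat \<bar>a\<bar>))) \<longlongrightarrow> exp U * (0 * 0)) at_top"
        using reg by (intro tendsto_intros summable_on_tendsto_0_at_top) (auto simp: regular_def)
      then show "((\<lambda>a. exp U * ((f (shift a \<omega>) * decay ^ nat \<bar>a\<bar>) * (exp (fst (\<omega> a)) * decay ^ nat \<bar>a\<bar>))) \<longlongrightarrow> 0) at_top"
        by simp
      show "\<forall>\<^sub>F a in at_top. h a \<le> exp U * ((f (shift a \<omega>) * decay ^ nat \<bar>a\<bar>) * (exp (fst (\<omega> a)) * decay ^ nat \<bar>a\<bar>))"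
        using eventually_ge_at_top[of "0::int"]
      proof eventually_elim
        case (elim a)
        have good': "shift a \<omega> \<in> good" using good by (rule good_shift)
        have Z: "0 < fst (\<omega> a)" using good d_pos by (auto simp: good_def intro: less_le_trans)
        \<comment> \<open>\<open>g\<close> divides by a total rate that may be tiny; the jump to the
          right neighbour bounds that rate from below, which costs \<open>exp Z\<close> at
          \<open>a\<close>.\<close>
        have "- (fst (\<omega> a)) - U \<le> - ((1 - lam) * fst (\<omega> a)) + u (snd (\<omega> a)) (snd (\<omega> (a + 1)))"
          using abs_le_D2[OF u_bound, of "snd (\<omega> a)" "snd (\<omega> (a + 1))"] mult_nonneg_nonneg[OF lam_nonneg less_imp_le[OF Z]]
          by (simp add: algebra_simps)
        then have "exp (- (fst (\<omega> a)) - U) \<le> mott_rate u lam \<omega> a (a + 1)"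
          using Z by (simp add: mott_rate_def site_add_1) (simp add: algebra_simps)
        also have "\<dots> = mott_rate u lam (shift a \<omega>) 0 1"
          by (simp add: mott_rate_shift add.commute)
        also have "\<dots> \<le> rate_sum lam (shift a \<omega>)"
          by (intro mott_rate_le_rate_sum good' lam lam_nonneg)
        finally have "exp (- (fst (\<omega> a)) - U) \<le> rate_sum lam (shift a \<omega>)" .
        then have "g (shift a \<omega>) \<le> f (shift a \<omega>) / exp (- (fst (\<omega> a)) - U)"
          unfolding g_def
          by (intro divide_left_mono f_nonneg mult_pos_pos rate_sum_pos good' lam lam_nonneg exp_gt_zero)
        also have "\<dots> = f (shift a \<omega>) * (exp U * exp (fst (\<omega> a)))"
          by (simp add: exp_diff exp_minus field_simps)
        finally have 1: "g (shift a \<omega>) \<le> f (shift a \<omega>) * (exp U * exp (fst (\<omega> a)))" .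
        have "lam * (d * real_of_int a) \<le> lam * site \<omega> a"
          using site_diff_ge[OF good elim] lam by (intro mult_left_mono) (auto simp: site_0)
        moreover have "decay ^ nat \<bar>a\<bar> = exp (- (lam * (d * real_of_int a)))"
          unfolding decay_def exp_of_nat_mult[symmetric] using elim by (simp add: algebra_simps)
        ultimately have 2: "exp (- (2 * lam * site \<omega> a)) \<le> decay ^ nat \<bar>a\<bar> * decay ^ nat \<bar>a\<bar>"
          by (simp only: exp_add[symmetric] exp_le_cancel_iff)
        show ?case
          using mult_mono[OF 2 1] decay g_nonneg by (simp add: h_def mult_ac)
      qed
    qed (auto simp: h_def g_nonneg)
  qed
  also have "(\<Sum>j. 1 / c (int j) (int j + 1)) \<le> exp U * resistance \<omega>"
    unfolding resistance_def suminf_mult[OF summable_resistance[OF reg], symmetric]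
    by (intro suminf_le res res_sum summable_mult summable_resistance reg)
  finally show ?thesis
    by (simp add: h_def site_0 shift_0 mult_left_mono)
qed

end

section \<open>Expectations of countable sums\<close>

context sigma_finite_measure
begin

context
  fixes a :: "'k::countable \<Rightarrow> 'a \<Rightarrow> real"
  assumes a: "\<And>k. a k \<in> borel_measurable M"
    and fin: "(\<integral>\<^sup>+k. (\<integral>\<^sup>+\<omega>. ennreal (norm (a k \<omega>)) \<partial>M) \<partial>count_space UNIV) < \<infinity>"
begin

interpretation C: sigma_finite_measure "count_space (UNIV :: 'k set)"
  by (rule sigma_finite_measure_count_space)

interpretation MC: pair_sigma_finite M "count_space (UNIV :: 'k set)" ..

lemma integrable_pair_count_space: "integrable (M \<Otimes>\<^sub>M count_space UNIV) (\<lambda>(\<omega>, k). a k \<omega>)"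
proof (rule integrableI_bounded)
  show m: "(\<lambda>(\<omega>, k). a k \<omega>) \<in> borel_measurable (M \<Otimes>\<^sub>M count_space UNIV)"
    by (rule measurable_pair_count_space) (rule a)
  have "(\<integral>\<^sup>+z. ennreal (norm (case z of (\<omega>, k) \<Rightarrow> a k \<omega>)) \<partial>(M \<Otimes>\<^sub>M count_space UNIV)) =
      (\<integral>\<^sup>+k. (\<integral>\<^sup>+\<omega>. ennreal (norm (a k \<omega>)) \<partial>M) \<partial>count_space UNIV)"
    using m by (subst MC.nn_integral_snd[symmetric]) (auto simp: case_prod_unfold)
  then show "(\<integral>\<^sup>+z. ennreal (norm (case z of (\<omega>, k) \<Rightarrow> a k \<omega>)) \<partial>(M \<Otimes>\<^sub>M count_space UNIV)) < \<infinity>"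
    using fin by simp
qed

lemma integrable_of_nn_integral_count_space: "integrable M (a k)"
  using MC.AE_integrable_snd[OF integrable_pair_count_space] by (simp add: AE_count_space)

lemma integrable_infsum: "integrable M (\<lambda>\<omega>. \<Sum>\<^sub>\<infinity>k. a k \<omega>)"
  using MC.integrable_fst[OF integrable_pair_count_space]
  by (simp add: infsum_eq_integral_count_space)

lemma has_sum_integral: "((\<lambda>k. \<integral>\<omega>. a k \<omega> \<partial>M) has_sum (\<integral>\<omega>. (\<Sum>\<^sub>\<infinity>k. a k \<omega>) \<partial>M)) UNIV"
  using MC.integrable_snd[OF integrable_pair_count_space] MC.Fubini_integral[OF integrable_pair_count_space]
  by (simp add: has_sum_iff summable_on_iff_integrable_count_space infsum_eq_integral_count_space)

end

end

definition steps :: "int \<Rightarrow> int set" where "steps k = {min 0 k..<max 0 k}"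

lemma finite_steps: "finite (steps k)"
  by (simp add: steps_def)

lemma card_steps: "card (steps k) = nat \<bar>k\<bar>"
  by (simp add: steps_def max_def min_def)

text \<open>A jump from \<open>a\<close> to \<open>k + a\<close> crosses the bond between 0 and 1
  exactly when this bond, seen from the start of the jump, is one of \<open>steps k\<close>; the
  sign is the direction.\<close>

lemma of_bool_diff_steps:
  "of_bool (a \<le> 0) - of_bool (k + a \<le> 0) = (if - a \<in> steps k then of_int (sgn k) else (0::real))"
  by (auto simp: steps_def of_bool_def sgn_if)

lemma site_eq_sum_steps: "site \<omega> k = of_int (sgn k) * (\<Sum>a\<in>steps k. fst (\<omega> a))"
  by (auto simp: site_def steps_def max_def min_def sgn_if)

context mott_stationary_density
begin

text \<open>
  Regrouping the flux by jump length: a jump of length \<open>k\<close> crosses \<open>k\<close> bonds, each seen with weight \<open>w\<close>. The weights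
  \<open>1\<close> and \<open>Z\<^sub>0\<close> turn the current into the mean displacement in index and in space.
\<close>

lemma current_weighted:
  assumes w [measurable]: "w \<in> borel_measurable env_space" and w0: "\<And>\<omega>. 0 \<le> w \<omega>"
    and fin: "(\<integral>\<^sup>+k. (\<integral>\<^sup>+\<omega>. ennreal (q k \<omega> * (\<Sum>a\<in>steps k. w (shift a \<omega>))) \<partial>P) \<partial>count_space UNIV) < \<infinity>"
  shows "integrable P (\<lambda>\<omega>. w \<omega> * current \<omega>)"
    and "((\<lambda>k. \<integral>\<omega>. q k \<omega> * (of_int (sgn k) * (\<Sum>a\<in>steps k. w (shift a \<omega>))) \<partial>P) has_sum (\<integral>\<omega>. w \<omega> * current \<omega> \<partial>P)) UNIV"
proof -
  define s where "s k a = (of_bool (a \<le> 0) - of_bool (k + a \<le> 0) :: real)" for k a :: int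
  have s: "s k a = (if a \<in> uminus ` steps k then of_int (sgn k) else 0)" for k a
    unfolding s_def of_bool_diff_steps by (auto simp: image_iff)
  have s_abs: "\<bar>s k a\<bar> = (if a \<in> uminus ` steps k then 1 else 0)" for k a
    unfolding s by (auto simp: sgn_if steps_def)
  define F where "F x \<omega> = (case x of (k, a) \<Rightarrow> w \<omega> * (q k (shift a \<omega>) * s k a))" for x \<omega>
  have F_meas [measurable]: "F x \<in> borel_measurable env_space" for x
    unfolding F_def [abs_def] by (cases x) measurable
  have F_meas': "F x \<in> borel_measurable P" for x by measurable
  \<comment> \<open>Shifting by \<open>- a\<close> puts the start of the jump at the origin, while
    the weight \<open>w\<close> is then evaluated at the crossed bond.\<close>
  have shift_eq: "(\<integral>\<^sup>+\<omega>. ennreal (norm (F (k, a) \<omega>)) \<partial>P) =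
      (\<integral>\<^sup>+\<omega>. ennreal (q k \<omega> * w (shift (- a) \<omega>) * \<bar>s k a\<bar>) \<partial>P)" for k a
  proof -
    have "(\<integral>\<^sup>+\<omega>. ennreal (norm (F (k, a) (shift (- a) \<omega>))) \<partial>P) = (\<integral>\<^sup>+\<omega>. ennreal (norm (F (k, a) \<omega>)) \<partial>P)"
      by (rule nn_integral_shift[of "\<lambda>\<omega>. ennreal (norm (F (k, a) \<omega>))"]) measurable
    then show ?thesis
      by (simp add: F_def shift_shift shift_0 abs_mult w0 q_nonneg mult_ac)
  qed
  have fin': "(\<integral>\<^sup>+x. (\<integral>\<^sup>+\<omega>. ennreal (norm (F x \<omega>)) \<partial>P) \<partial>count_space UNIV) < \<infinity>"
  proof -
    have "(\<integral>\<^sup>+x. (\<integral>\<^sup>+\<omega>. ennreal (norm (F x \<omega>)) \<partial>P) \<partial>count_space UNIV) =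
        (\<integral>\<^sup>+k. (\<integral>\<^sup>+a. (\<integral>\<^sup>+\<omega>. ennreal (norm (F (k, a) \<omega>)) \<partial>P) \<partial>count_space UNIV) \<partial>count_space UNIV)"
      by (rule nn_integral_fst_count_space[symmetric])
    also have "\<dots> = (\<integral>\<^sup>+k. (\<integral>\<^sup>+\<omega>. ennreal (q k \<omega> * (\<Sum>a\<in>steps k. w (shift a \<omega>))) \<partial>P) \<partial>count_space UNIV)"
    proof (rule nn_integral_cong)
      fix k :: int
      have "(\<integral>\<^sup>+a. (\<integral>\<^sup>+\<omega>. ennreal (norm (F (k, a) \<omega>)) \<partial>P) \<partial>count_space UNIV) =
          (\<Sum>a\<in>uminus ` steps k. (\<integral>\<^sup>+\<omega>. ennreal (norm (F (k, a) \<omega>)) \<partial>P))"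
        by (rule nn_integral_count_space') (auto simp: shift_eq[unfolded real_norm_def] s_abs finite_steps)
      also have "\<dots> = (\<Sum>a\<in>steps k. (\<integral>\<^sup>+\<omega>. ennreal (q k \<omega> * w (shift a \<omega>)) \<partial>P))"
        by (subst sum.reindex) (auto simp: shift_eq[unfolded real_norm_def] s_abs)
      also have "\<dots> = (\<integral>\<^sup>+\<omega>. (\<Sum>a\<in>steps k. ennreal (q k \<omega> * w (shift a \<omega>))) \<partial>P)"
        by (rule nn_integral_sum[symmetric]) measurable
      also have "\<dots> = (\<integral>\<^sup>+\<omega>. ennreal (q k \<omega> * (\<Sum>a\<in>steps k. w (shift a \<omega>))) \<partial>P)"
        by (simp add: sum_distrib_left sum_ennreal w0 q_nonneg)
      finally show "(\<integral>\<^sup>+a. (\<integral>\<^sup>+\<omega>. ennreal (norm (F (k, a) \<omega>)) \<partial>P) \<partial>count_space UNIV) = \<dots>" .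
    qed
    finally show ?thesis
      using fin by simp
  qed
  have cur: "(\<Sum>\<^sub>\<infinity>x. F x \<omega>) = w \<omega> * current \<omega>" for \<omega>
  proof -
    have "(\<Sum>\<^sub>\<infinity>x. F x \<omega>) = (\<Sum>\<^sub>\<infinity>(a, b). w \<omega> * (flow \<omega> a b * (of_bool (a \<le> 0) - of_bool (b \<le> 0))))"
      by (rule infsum_reindex_bij_witness[of UNIV "\<lambda>(a, b). (b - a, a)" "\<lambda>(k, a). (a, k + a)"])
        (auto simp: F_def flow_def s_def)
    also have "\<dots> = w \<omega> * current \<omega>"
      unfolding current_def by (subst infsum_cmult_right'[symmetric]) (simp add: case_prod_unfold)
    finally show ?thesis .
  qed
  show "integrable P (\<lambda>\<omega>. w \<omega> * current \<omega>)"
    using integrable_infsum[OF F_meas' fin'] by (simp add: cur)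
  have Fint: "integrable P (F x)" for x
    using integrable_of_nn_integral_count_space[OF F_meas' fin'] .
  have "((\<lambda>x. \<integral>\<omega>. F x \<omega> \<partial>P) has_sum (\<integral>\<omega>. w \<omega> * current \<omega> \<partial>P)) (UNIV \<times> UNIV)"
    using has_sum_integral[OF F_meas' fin'] by (simp add: cur)
  moreover have "((\<lambda>a. \<integral>\<omega>. F (k, a) \<omega> \<partial>P) has_sum
      (\<integral>\<omega>. q k \<omega> * (of_int (sgn k) * (\<Sum>a\<in>steps k. w (shift a \<omega>))) \<partial>P)) UNIV" for k
  proof -
    have E: "integrable P (\<lambda>\<omega>. q k \<omega> * w (shift (- a) \<omega>) * s k a)"
      "(\<integral>\<omega>. F (k, a) \<omega> \<partial>P) = (\<integral>\<omega>. q k \<omega> * w (shift (- a) \<omega>) * s k a \<partial>P)" for a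
    proof -
      have "F (k, a) (shift (- a) \<omega>) = q k \<omega> * w (shift (- a) \<omega>) * s k a" for \<omega>
        by (simp add: F_def shift_shift shift_0)
      then show "integrable P (\<lambda>\<omega>. q k \<omega> * w (shift (- a) \<omega>) * s k a)"
        "(\<integral>\<omega>. F (k, a) \<omega> \<partial>P) = (\<integral>\<omega>. q k \<omega> * w (shift (- a) \<omega>) * s k a \<partial>P)"
        using integrable_shift[OF Fint[of "(k, a)"], of "- a"] integral_shift[OF F_meas, of "(k, a)" "- a"]
        by simp_all
    qed
    have "(\<Sum>a\<in>uminus ` steps k. \<integral>\<omega>. F (k, a) \<omega> \<partial>P) =
        (\<Sum>a\<in>steps k. \<integral>\<omega>. q k \<omega> * w (shift a \<omega>) * of_int (sgn k) \<partial>P)"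
      unfolding E by (subst sum.reindex) (auto simp: s image_iff)
    also have "\<dots> = (\<integral>\<omega>. (\<Sum>a\<in>steps k. q k \<omega> * w (shift a \<omega>) * of_int (sgn k)) \<partial>P)"
    proof (rule Bochner_Integration.integral_sum[symmetric])
      fix a assume "a \<in> steps k"
      then have "s k (- a) = of_int (sgn k)" by (simp add: s)
      with E(1)[of "- a"] show "integrable P (\<lambda>\<omega>. q k \<omega> * w (shift a \<omega>) * of_int (sgn k))" by simp
    qed
    also have "\<dots> = (\<integral>\<omega>. q k \<omega> * (of_int (sgn k) * (\<Sum>a\<in>steps k. w (shift a \<omega>))) \<partial>P)"
      by (simp add: sum_distrib_left mult_ac)
    finally have "((\<lambda>a. \<integral>\<omega>. F (k, a) \<omega> \<partial>P) has_sum
        (\<integral>\<omega>. q k \<omega> * (of_int (sgn k) * (\<Sum>a\<in>steps k. w (shift a \<omega>))) \<partial>P)) (uminus ` steps k)"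
      using has_sum_finite[of "uminus ` steps k" "\<lambda>a. \<integral>\<omega>. F (k, a) \<omega> \<partial>P"] by (simp add: finite_steps)
    then show ?thesis
      by (rule has_sum_cong_neutral[THEN iffD1, rotated -1]) (auto simp: F_def s)
  qed
  ultimately show "((\<lambda>k. \<integral>\<omega>. q k \<omega> * (of_int (sgn k) * (\<Sum>a\<in>steps k. w (shift a \<omega>))) \<partial>P) has_sum
      (\<integral>\<omega>. w \<omega> * current \<omega> \<partial>P)) UNIV"
    by (rule has_sum_SigmaD)
qed

section \<open>Mean jump intensities and the constancy of the current\<close>

lemma integral_f: "(\<integral>\<omega>. f \<omega> \<partial>P) = 1"
  using nn_integral_f integrable_f f_nonneg by (simp add: nn_integral_eq_integral)

lemma integrable_q: "integrable P (q k)"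
proof (rule Bochner_Integration.integrable_bound)
  show "integrable P (\<lambda>\<omega>. jump_const * \<rho> ^ nat \<bar>k\<bar> * f \<omega>)"
    by (intro integrable_mult_right integrable_f)
  show "AE \<omega> in P. norm (q k \<omega>) \<le> norm (jump_const * \<rho> ^ nat \<bar>k\<bar> * f \<omega>)"
    using AE_good
  proof eventually_elim
    case (elim \<omega>)
    then show ?case
      using q_le[of \<omega> k] q_nonneg[of k \<omega>] by simp
  qed
qed measurable

lemma integral_q_nonneg: "0 \<le> (\<integral>\<omega>. q k \<omega> \<partial>P)"
  by (simp add: q_nonneg)

lemma integral_q_le: "(\<integral>\<omega>. q k \<omega> \<partial>P) \<le> jump_const * \<rho> ^ nat \<bar>k\<bar>"
proof -
  have "(\<integral>\<omega>. q k \<omega> \<partial>P) \<le> (\<integral>\<omega>. jump_const * \<rho> ^ nat \<bar>k\<bar> * f \<omega> \<partial>P)"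
    using AE_good
    by (intro integral_mono_AE integrable_q integrable_mult_right integrable_f)
      (auto elim!: eventually_mono intro: q_le)
  then show ?thesis by (simp add: integral_f)
qed

lemma summable_on_square_geometric:
  "(\<lambda>k::int. (real_of_int k)\<^sup>2 * \<rho> ^ nat \<bar>k\<bar>) summable_on UNIV"
proof -
  have "(\<lambda>k::int. (real (nat \<bar>k\<bar>))\<^sup>2 * \<rho> ^ nat \<bar>k\<bar>) summable_on UNIV"
    using \<rho> by (intro summable_on_nat_abs_int summable_square_geometric) auto
  then show ?thesis by simp
qed

lemma summable_on_square_integral_q:
  "(\<lambda>k::int. (real_of_int k)\<^sup>2 * (\<integral>\<omega>. q k \<omega> \<partial>P)) summable_on UNIV"
proof (rule summable_on_comparison_test[OF summable_on_cmult_right[OF summable_on_square_geometric, of jump_const]])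
  fix k :: int
  show "(real_of_int k)\<^sup>2 * (\<integral>\<omega>. q k \<omega> \<partial>P) \<le> jump_const * ((real_of_int k)\<^sup>2 * \<rho> ^ nat \<bar>k\<bar>)"
    using mult_left_mono[OF integral_q_le[of k], of "(real_of_int k)\<^sup>2"] by (simp add: mult_ac)
qed (simp add: integral_q_nonneg)

definition mean_current :: real where "mean_current = (\<integral>\<omega>. current \<omega> \<partial>P)"

lemma AE_current_eq: "AE \<omega> in P. current \<omega> = mean_current" (is ?const)
  and has_sum_mean_current: "((\<lambda>k. of_int k * (\<integral>\<omega>. q k \<omega> \<partial>P)) has_sum mean_current) UNIV" (is ?v)
proof -
  have "(\<integral>\<^sup>+k. (\<integral>\<^sup>+\<omega>. ennreal (q k \<omega> * (\<Sum>a\<in>steps k. 1)) \<partial>P) \<partial>count_space UNIV) =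
      (\<integral>\<^sup>+k. ennreal (\<bar>of_int k\<bar> * (\<integral>\<omega>. q k \<omega> \<partial>P)) \<partial>count_space UNIV)"
    by (simp add: card_steps nn_integral_eq_integral integrable_q q_nonneg mult.commute)
  also have "\<dots> < \<infinity>"
  proof -
    have "(\<lambda>k::int. \<bar>of_int k\<bar> * (\<integral>\<omega>. q k \<omega> \<partial>P)) summable_on UNIV"
    proof (rule summable_on_comparison_test[OF summable_on_square_integral_q])
      fix k :: int
      have "\<bar>k\<bar> \<le> k\<^sup>2"
        using self_le_power[of "\<bar>k\<bar>" 2] by (cases "k = 0") auto
      then have "real_of_int \<bar>k\<bar> \<le> real_of_int (k\<^sup>2)" by (rule of_int_le_iff[THEN iffD2])
      then show "\<bar>of_int k\<bar> * (\<integral>\<omega>. q k \<omega> \<partial>P) \<le> (real_of_int k)\<^sup>2 * (\<integral>\<omega>. q k \<omega> \<partial>P)"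
        by (intro mult_right_mono) (simp_all add: integral_q_nonneg)
    qed (simp add: integral_q_nonneg)
    then show ?thesis
      by (simp add: summable_on_iff_integrable_count_space nn_integral_eq_integral integral_q_nonneg)
  qed
  finally have fin: "(\<integral>\<^sup>+k. (\<integral>\<^sup>+\<omega>. ennreal (q k \<omega> * (\<Sum>a\<in>steps k. 1)) \<partial>P) \<partial>count_space UNIV) < \<infinity>" .
  have cw: "integrable P (\<lambda>\<omega>. 1 * current \<omega>)"
    "((\<lambda>k. \<integral>\<omega>. q k \<omega> * (of_int (sgn k) * (\<Sum>a\<in>steps k. 1)) \<partial>P) has_sum (\<integral>\<omega>. 1 * current \<omega> \<partial>P)) UNIV"
    by (rule current_weighted[where w = "\<lambda>_. 1"]; use fin in simp)+
  have "AE \<omega> in P. \<forall>l. current (shift l \<omega>) = current \<omega>"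
    using AE_regular by eventually_elim (simp add: current_shift)
  with cw(1) show ?const
    unfolding mean_current_def by (intro invariant_constant) auto
  have "real_of_int (sgn k) * \<bar>real_of_int k\<bar> = real_of_int k" for k
    by (simp add: sgn_if)
  then show ?v
    using cw(2) by (simp add: card_steps mean_current_def mult.commute)
qed

end

section \<open>Moments of the density for a fixed bias\<close>

lemma powr_above_tangent:
  fixes p m y :: real
  assumes "1 \<le> p" "0 < m" "0 < y"
  shows "m powr p + p * m powr (p - 1) * (y - m) \<le> y powr p"
proof -
  have "p * m powr (p - 1) * (y - m) \<le> y powr p - m powr p"
  proof (rule convex_on_imp_above_tangent[OF powr_convex[OF assms(1)]])
    show "((\<lambda>x. x powr p) has_real_derivative p * m powr (p - 1)) (at m within {0<..})"
      by (rule has_field_derivative_at_within[OF has_real_derivative_powr]) (rule assms)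
  qed (use assms in \<open>auto simp: interior_open\<close>)
  then show ?thesis by simp
qed

text \<open>Averaging the tangent inequality at the mean \<open>m\<close> cancels the linear term.
  With values in \<open>ennreal\<close> a divergent right-hand side is covered as well.\<close>

lemma jensen_powr_suminf:
  fixes w y :: "nat \<Rightarrow> real"
  assumes p: "1 \<le> p" and w: "\<And>j. 0 \<le> w j" "w sums 1" and y: "\<And>j. 0 < y j"
    and sum: "summable (\<lambda>j. w j * y j)"
  shows "ennreal ((\<Sum>j. w j * y j) powr p) \<le> (\<Sum>j. ennreal (w j * y j powr p))"
proof (cases "summable (\<lambda>j. w j * y j powr p)")
  case True
  define m where "m = (\<Sum>j. w j * y j)"
  have "m \<noteq> 0"
  proof
    assume "m = 0"
    then have "w j * y j = 0" for j
      using suminf_eq_zero_iff[OF sum] w y by (simp add: m_def less_imp_le)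
    then have "w j = 0" for j using y by (metis less_irrefl mult_eq_0_iff)
    then have "w sums 0" by (rule sums_0)
    from sums_unique2[OF w(2) this] show False by simp
  qed
  moreover have "0 \<le> m" unfolding m_def by (intro suminf_nonneg sum mult_nonneg_nonneg w(1) less_imp_le[OF y])
  ultimately have m: "0 < m" by simp
  define C where "C = p * m powr (p - 1)"
  have "(\<lambda>j. m powr p * w j + C * (w j * y j - m * w j)) sums (m powr p * 1 + C * (m - m * 1))"
    by (intro sums_add sums_mult sums_diff w(2) summable_sums[OF sum, folded m_def])
  moreover have "m powr p * w j + C * (w j * y j - m * w j) = w j * (m powr p + C * (y j - m))" for j
    by (simp add: algebra_simps)
  ultimately have sums_m: "(\<lambda>j. w j * (m powr p + C * (y j - m))) sums (m powr p)"
    by simp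
  have "m powr p \<le> (\<Sum>j. w j * y j powr p)"
  proof (rule sums_le[OF _ sums_m summable_sums[OF True]])
    fix j
    show "w j * (m powr p + C * (y j - m)) \<le> w j * y j powr p"
      unfolding C_def by (intro mult_left_mono powr_above_tangent p m y w(1))
  qed
  also have "ennreal \<dots> = (\<Sum>j. ennreal (w j * y j powr p))"
    using True w by (intro suminf_ennreal2[symmetric]) auto
  finally show ?thesis by (simp add: m_def ennreal_leI)
next
  case False
  moreover have "0 \<le> w j * y j powr p" for j using w(1) by simp
  ultimately have "(\<Sum>j. ennreal (w j * y j powr p)) = \<top>"
    using summable_suminf_not_top[of "\<lambda>j. w j * y j powr p"] by blast
  then show ?thesis by (simp only: top_greatest)
qed

context mott_environment
begin

definition exp_series :: "real \<Rightarrow> environment \<Rightarrow> real" where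
  "exp_series r \<omega> = (\<Sum>j. exp (fst (\<omega> (int j))) * r ^ j)"

lemma measurable_exp_series [measurable]: "exp_series r \<in> borel_measurable env_space"
  unfolding exp_series_def [abs_def] by measurable

lemma AE_summable_exp_series:
  assumes "0 < r" "r < 1"
  shows "AE \<omega> in P. summable (\<lambda>j. exp (fst (\<omega> (int j))) * r ^ j)"
  using AE_geometric_summable[OF integrable_exp_Z0 exp_ge_zero assms]
proof eventually_elim
  case (elim \<omega>)
  then have "(\<lambda>a. exp (fst (\<omega> a)) * r ^ nat \<bar>a\<bar>) summable_on range int"
    by (intro summable_on_subset[OF elim[THEN summable_on_cong[THEN iffD1, rotated]]]) (auto simp: shift_def)
  then show ?case
    by (subst (asm) summable_on_reindex) (auto simp: o_def intro: summable_on_imp_summable)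
qed

text \<open>The numbers \<open>(1 - r) * r ^ j\<close> are probability weights. Jensen moves the
  power inside, stationarity gives every term the same moment, and the normalisation leaves
  \<open>1 / (1 - r)\<close> to the power \<open>p\<close>.\<close>

lemma exp_series_moment:
  assumes r: "0 < r" "r < 1" and p: "1 \<le> p"
  shows "(\<integral>\<^sup>+\<omega>. ennreal (exp_series r \<omega> powr p) \<partial>P) \<le>
    ennreal ((1 / (1 - r)) powr p) * (\<integral>\<^sup>+\<omega>. ennreal (exp (p * fst (\<omega> 0))) \<partial>P)"
proof -
  have ge: "(\<lambda>j. (1 - r) * r ^ j) sums 1"
    using sums_mult[OF geometric_sums[of r], of "1 - r"] r by simp
  have "AE \<omega> in P. ennreal (exp_series r \<omega> powr p) \<le>
      (\<Sum>j. ennreal ((1 / (1 - r)) powr p * ((1 - r) * r ^ j * exp (p * fst (\<omega> (int j))))))"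
    using AE_summable_exp_series[OF r]
  proof eventually_elim
    case (elim \<omega>)
    define m where "m = (\<Sum>j. (1 - r) * r ^ j * exp (fst (\<omega> (int j))))"
    have sum: "summable (\<lambda>j. (1 - r) * r ^ j * exp (fst (\<omega> (int j))))"
      using summable_mult[OF elim, of "1 - r"] by (simp add: mult_ac)
    have m0: "0 \<le> m" unfolding m_def by (intro suminf_nonneg sum) (use r in auto)
    have "m = (1 - r) * exp_series r \<omega>"
      unfolding m_def exp_series_def by (subst suminf_mult[OF elim, symmetric]) (simp add: mult_ac)
    then have "exp_series r \<omega> = (1 / (1 - r)) * m" using r by simp
    then have "exp_series r \<omega> powr p = (1 / (1 - r)) powr p * m powr p"
      using r m0 by (simp only: powr_mult)
    then have "ennreal (exp_series r \<omega> powr p) = ennreal ((1 / (1 - r)) powr p) * ennreal (m powr p)"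
      by (simp add: ennreal_mult)
    also have "ennreal (m powr p) \<le> (\<Sum>j. ennreal ((1 - r) * r ^ j * exp (fst (\<omega> (int j))) powr p))"
      unfolding m_def by (rule jensen_powr_suminf[OF p _ ge _ sum]) (use r in auto)
    also have "ennreal ((1 / (1 - r)) powr p) * \<dots> =
        (\<Sum>j. ennreal ((1 / (1 - r)) powr p * ((1 - r) * r ^ j * exp (p * fst (\<omega> (int j))))))"
      using r by (simp add: ennreal_suminf_cmult[symmetric] ennreal_mult[symmetric] exp_powr_real mult.commute[of p])
    finally show ?case by (simp add: mult_left_mono)
  qed
  then have "(\<integral>\<^sup>+\<omega>. ennreal (exp_series r \<omega> powr p) \<partial>P) \<le>
      (\<integral>\<^sup>+\<omega>. (\<Sum>j. ennreal ((1 / (1 - r)) powr p * ((1 - r) * r ^ j * exp (p * fst (\<omega> (int j)))))) \<partial>P)"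
    by (rule nn_integral_mono_AE)
  also have "\<dots> = (\<Sum>j. \<integral>\<^sup>+\<omega>. ennreal ((1 / (1 - r)) powr p * ((1 - r) * r ^ j * exp (p * fst (\<omega> (int j))))) \<partial>P)"
    by (rule nn_integral_suminf) measurable
  also have "\<dots> = (\<Sum>j. ennreal ((1 / (1 - r)) powr p * ((1 - r) * r ^ j)) * (\<integral>\<^sup>+\<omega>. ennreal (exp (p * fst (\<omega> 0))) \<partial>P))"
  proof (intro suminf_cong)
    fix j
    have "(\<integral>\<^sup>+\<omega>. ennreal ((1 / (1 - r)) powr p * ((1 - r) * r ^ j * exp (p * fst (\<omega> (int j))))) \<partial>P) =
        (\<integral>\<^sup>+\<omega>. ennreal ((1 / (1 - r)) powr p * ((1 - r) * r ^ j)) * ennreal (exp (p * fst (\<omega> (int j)))) \<partial>P)"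
      using r by (simp add: ennreal_mult[symmetric] mult.assoc)
    also have "\<dots> = ennreal ((1 / (1 - r)) powr p * ((1 - r) * r ^ j)) * (\<integral>\<^sup>+\<omega>. ennreal (exp (p * fst (\<omega> (int j)))) \<partial>P)"
      by (rule nn_integral_cmult) measurable
    also have "(\<integral>\<^sup>+\<omega>. ennreal (exp (p * fst (\<omega> (int j)))) \<partial>P) = (\<integral>\<^sup>+\<omega>. ennreal (exp (p * fst (\<omega> 0))) \<partial>P)"
      using nn_integral_shift[of "\<lambda>\<omega>. ennreal (exp (p * fst (\<omega> 0)))" "int j"] by (simp add: shift_def)
    finally show "(\<integral>\<^sup>+\<omega>. ennreal ((1 / (1 - r)) powr p * ((1 - r) * r ^ j * exp (p * fst (\<omega> (int j))))) \<partial>P) =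
        ennreal ((1 / (1 - r)) powr p * ((1 - r) * r ^ j)) * (\<integral>\<^sup>+\<omega>. ennreal (exp (p * fst (\<omega> 0))) \<partial>P)" .
  qed
  also have "\<dots> = (\<Sum>j. ennreal ((1 / (1 - r)) powr p * ((1 - r) * r ^ j))) * (\<integral>\<^sup>+\<omega>. ennreal (exp (p * fst (\<omega> 0))) \<partial>P)"
    by (rule ennreal_suminf_multc)
  also have "(\<Sum>j. ennreal ((1 / (1 - r)) powr p * ((1 - r) * r ^ j))) = ennreal ((1 / (1 - r)) powr p)"
    using sums_mult[OF ge, of "(1 / (1 - r)) powr p"] r by (intro suminf_ennreal_eq) auto
  finally show ?thesis .
qed

lemma integrable_exp_series:
  assumes "0 < r" "r < 1"
  shows "integrable P (exp_series r)"
proof (rule integrableI_nonneg)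
  show nn: "AE \<omega> in P. 0 \<le> exp_series r \<omega>"
    using AE_summable_exp_series[OF assms]
    by eventually_elim (use assms in \<open>auto simp: exp_series_def intro!: suminf_nonneg\<close>)
  have "(\<integral>\<^sup>+\<omega>. ennreal (exp_series r \<omega>) \<partial>P) = (\<integral>\<^sup>+\<omega>. ennreal (exp_series r \<omega> powr 1) \<partial>P)"
    using nn by (intro nn_integral_cong_AE) (auto elim!: eventually_mono)
  also have "\<dots> \<le> ennreal ((1 / (1 - r)) powr 1) * (\<integral>\<^sup>+\<omega>. ennreal (exp (1 * fst (\<omega> 0))) \<partial>P)"
    by (rule exp_series_moment) (use assms in auto)
  also have "\<dots> < \<infinity>"
    using integrable_exp_Z0 by (simp add: nn_integral_eq_integral ennreal_mult_less_top)
  finally show "(\<integral>\<^sup>+\<omega>. ennreal (exp_series r \<omega>) \<partial>P) < \<infinity>" .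
qed measurable

definition site_const :: real where "site_const = 2 * exp U / (1 - lmax)"

lemma site_const_nonneg: "0 \<le> site_const"
  using lmax by (simp add: site_const_def)

text \<open>Half of the exponential decay absorbs the linear factor, through
  \<open>y \<le> 2 * exp (y / 2)\<close>; the other half leaves \<open>sqrt \<rho>\<close> per
  index.\<close>

lemma mott_rate_mult_site_le:
  assumes "\<omega> \<in> good" "0 \<le> lam" "lam \<le> lmax"
  shows "mott_rate u lam \<omega> 0 k * \<bar>site \<omega> k\<bar> \<le> site_const * sqrt \<rho> ^ nat \<bar>k\<bar>"
proof -
  define \<kappa> where "\<kappa> = 1 - lmax"
  have \<kappa>: "0 < \<kappa>" using lmax by (simp add: \<kappa>_def)
  let ?x = "\<bar>site \<omega> k\<bar>"
  have x: "\<kappa> * ?x \<le> 2 * exp (\<kappa> * ?x / 2)"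
    using exp_ge_add_one_self[of "\<kappa> * ?x / 2"] by linarith
  have "mott_rate u lam \<omega> 0 k * ?x \<le> exp U * exp (- (\<kappa> * ?x)) * ?x"
    using mott_rate_le_exp[OF assms(2,3), of \<omega> 0 k] by (intro mult_right_mono) (auto simp: site_0 \<kappa>_def)
  also have "\<dots> = exp U / \<kappa> * exp (- (\<kappa> * ?x)) * (\<kappa> * ?x)"
    using \<kappa> by simp
  also have "\<dots> \<le> exp U / \<kappa> * exp (- (\<kappa> * ?x)) * (2 * exp (\<kappa> * ?x / 2))"
    using \<kappa> x by (intro mult_left_mono) auto
  also have "\<dots> = site_const * exp (- (\<kappa> * ?x / 2))"
    by (simp add: site_const_def \<kappa>_def mult_exp_exp)
  also have "exp (- (\<kappa> * ?x / 2)) = sqrt (exp (- (\<kappa> * ?x)))"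
    by (rule real_sqrt_unique[symmetric]) (auto simp: power2_eq_square mult_exp_exp)
  also have "\<dots> \<le> sqrt (\<rho> ^ nat \<bar>k\<bar>)"
    using exp_site_le[OF assms(1), of k 0] by (simp add: site_0 \<kappa>_def)
  also have "\<dots> = sqrt \<rho> ^ nat \<bar>k\<bar>" by (rule real_sqrt_power)
  finally show ?thesis using site_const_nonneg by (simp add: mult_left_mono)
qed

definition mean_gap :: real where "mean_gap = (\<integral>\<omega>. fst (\<omega> 0) \<partial>P)"

lemma mean_gap_pos: "0 < mean_gap"
proof -
  have "(\<integral>\<omega>. d \<partial>P) \<le> mean_gap"
    unfolding mean_gap_def by (intro integral_mono_AE integrable_Z0 Z0_ge_d) simp
  then show ?thesis using d_pos by (simp add: prob_space)
qed

end

section \<open>Displacement in space\<close>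

context mott_stationary_density
begin

lemma resistance_le:
  assumes "regular \<omega>" "summable (\<lambda>j. exp (fst (\<omega> (int j))) * (decay\<^sup>2) ^ j)"
  shows "resistance \<omega> \<le> exp_series (decay\<^sup>2) \<omega>"
  unfolding resistance_def exp_series_def
proof (intro suminf_le summable_resistance assms)
  show "exp (- (2 * lam * site \<omega> (int j)) + (1 - lam) * fst (\<omega> (int j))) \<le> exp (fst (\<omega> (int j))) * (decay\<^sup>2) ^ j" for j
    using resistance_term_le[of \<omega> j] assms(1) by (simp add: regular_def power_mult[symmetric] mult.commute)
qed

lemma decay2: "0 < decay\<^sup>2" "decay\<^sup>2 < 1"
  using decay by (auto simp: power_less_one_iff)

lemma AE_g_le: "AE \<omega> in P. g \<omega> \<le> max 0 mean_current * (exp U * resistance \<omega>)"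
  using AE_regular AE_current_eq
proof eventually_elim
  case (elim \<omega>)
  then show ?case using g_le_current[OF elim(1)] by simp
qed

text \<open>Qualitative use of the flux bound, with a majorant that depends on \<open>lam\<close>.
  It is what makes the spatial displacement integrable.\<close>

lemma integrable_g: "integrable P g"
proof (rule Bochner_Integration.integrable_bound)
  show "integrable P (\<lambda>\<omega>. max 0 mean_current * (exp U * exp_series (decay\<^sup>2) \<omega>))"
    by (intro integrable_mult_right integrable_exp_series decay2)
  show "AE \<omega> in P. norm (g \<omega>) \<le> norm (max 0 mean_current * (exp U * exp_series (decay\<^sup>2) \<omega>))"
    using AE_g_le AE_regular AE_summable_exp_series[OF decay2]
  proof eventually_elim
    case (elim \<omega>)
    note elim(1)
    also have "max 0 mean_current * (exp U * resistance \<omega>) \<le> max 0 mean_current * (exp U * exp_series (decay\<^sup>2) \<omega>)"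
      by (intro mult_left_mono resistance_le elim) auto
    finally show ?case using g_nonneg[of \<omega>] by simp
  qed
qed measurable

lemma AE_q_site_le: "AE \<omega> in P. q k \<omega> * \<bar>site \<omega> k\<bar> \<le> site_const * sqrt \<rho> ^ nat \<bar>k\<bar> * g \<omega>"
  using AE_good
proof eventually_elim
  case (elim \<omega>)
  from mult_left_mono[OF mott_rate_mult_site_le[OF elim lam_nonneg lam(2), of k] g_nonneg]
  show ?case by (simp add: q_def mult_ac)
qed

lemma integrable_q_site: "integrable P (\<lambda>\<omega>. q k \<omega> * \<bar>site \<omega> k\<bar>)"
proof (rule Bochner_Integration.integrable_bound)
  show "integrable P (\<lambda>\<omega>. site_const * sqrt \<rho> ^ nat \<bar>k\<bar> * g \<omega>)"
    by (intro integrable_mult_right integrable_g)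
  show "AE \<omega> in P. norm (q k \<omega> * \<bar>site \<omega> k\<bar>) \<le> norm (site_const * sqrt \<rho> ^ nat \<bar>k\<bar> * g \<omega>)"
    using AE_q_site_le[of k]
    by eventually_elim (use q_nonneg g_nonneg site_const_nonneg \<rho> in \<open>auto simp: abs_mult\<close>)
qed measurable

lemma summable_on_integral_q_site: "(\<lambda>k. \<integral>\<omega>. q k \<omega> * \<bar>site \<omega> k\<bar> \<partial>P) summable_on UNIV"
proof (rule summable_on_comparison_test)
  have "(\<lambda>k::int. sqrt \<rho> ^ nat \<bar>k\<bar>) summable_on UNIV"
    using \<rho> by (intro summable_on_nat_abs_int summable_geometric) auto
  then show "(\<lambda>k::int. sqrt \<rho> ^ nat \<bar>k\<bar> * (site_const * (\<integral>\<omega>. g \<omega> \<partial>P))) summable_on UNIV"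
    by (rule summable_on_cmult_left)
  fix k
  have "(\<integral>\<omega>. q k \<omega> * \<bar>site \<omega> k\<bar> \<partial>P) \<le> (\<integral>\<omega>. site_const * sqrt \<rho> ^ nat \<bar>k\<bar> * g \<omega> \<partial>P)"
    by (intro integral_mono_AE integrable_q_site integrable_mult_right integrable_g AE_q_site_le)
  then show "(\<integral>\<omega>. q k \<omega> * \<bar>site \<omega> k\<bar> \<partial>P) \<le> sqrt \<rho> ^ nat \<bar>k\<bar> * (site_const * (\<integral>\<omega>. g \<omega> \<partial>P))"
    by (simp add: mult_ac)
qed (simp add: q_nonneg)

text \<open>\<open>current_weighted\<close> asks for a weight that is nonnegative on the whole type,
  hence the absolute value of the gap; on \<open>good\<close> it changes nothing.\<close>

lemma AE_sum_steps_eq: "AE \<omega> in P. (\<Sum>a\<in>steps k. \<bar>fst (shift a \<omega> 0)\<bar>) = \<bar>site \<omega> k\<bar>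
    \<and> of_int (sgn k) * (\<Sum>a\<in>steps k. \<bar>fst (shift a \<omega> 0)\<bar>) = site \<omega> k"
  using AE_good
proof eventually_elim
  case (elim \<omega>)
  then have pos: "0 \<le> fst (\<omega> a)" for a using d_pos by (auto simp: good_def intro: order_trans less_imp_le)
  then have "(\<Sum>a\<in>steps k. \<bar>fst (shift a \<omega> 0)\<bar>) = (\<Sum>a\<in>steps k. fst (\<omega> a))"
    by (simp add: shift_def)
  moreover have "\<bar>real_of_int (sgn k) * (\<Sum>a\<in>steps k. fst (\<omega> a))\<bar> = (\<Sum>a\<in>steps k. fst (\<omega> a))"
    using sum_nonneg[of "steps k" "\<lambda>a. fst (\<omega> a)"] pos by (auto simp: abs_mult sgn_if steps_def)
  ultimately show ?case by (simp add: site_eq_sum_steps)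
qed

text \<open>The mean displacement in space is the mean of the current weighted by the gap, and it
  factorises because the current is almost surely constant.\<close>

lemma has_sum_q_site: "((\<lambda>k. \<integral>\<omega>. q k \<omega> * site \<omega> k \<partial>P) has_sum mean_gap * mean_current) UNIV"
proof -
  have "(\<integral>\<^sup>+k. (\<integral>\<^sup>+\<omega>. ennreal (q k \<omega> * (\<Sum>a\<in>steps k. \<bar>fst (shift a \<omega> 0)\<bar>)) \<partial>P) \<partial>count_space UNIV) =
      (\<integral>\<^sup>+k. ennreal (\<integral>\<omega>. q k \<omega> * \<bar>site \<omega> k\<bar> \<partial>P) \<partial>count_space UNIV)"
  proof (rule nn_integral_cong)
    fix k :: int
    have "(\<integral>\<^sup>+\<omega>. ennreal (q k \<omega> * (\<Sum>a\<in>steps k. \<bar>fst (shift a \<omega> 0)\<bar>)) \<partial>P) =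
        (\<integral>\<^sup>+\<omega>. ennreal (q k \<omega> * \<bar>site \<omega> k\<bar>) \<partial>P)"
    proof (rule nn_integral_cong_AE)
      show "AE \<omega> in P. ennreal (q k \<omega> * (\<Sum>a\<in>steps k. \<bar>fst (shift a \<omega> 0)\<bar>)) = ennreal (q k \<omega> * \<bar>site \<omega> k\<bar>)"
        using AE_sum_steps_eq[of k] by eventually_elim (simp only:)
    qed
    then show "(\<integral>\<^sup>+\<omega>. ennreal (q k \<omega> * (\<Sum>a\<in>steps k. \<bar>fst (shift a \<omega> 0)\<bar>)) \<partial>P) =
        ennreal (\<integral>\<omega>. q k \<omega> * \<bar>site \<omega> k\<bar> \<partial>P)"
      using nn_integral_eq_integral[OF integrable_q_site] by (simp add: q_nonneg)
  qed
  also have "\<dots> < \<infinity>"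
    using summable_on_integral_q_site
    by (simp add: summable_on_iff_integrable_count_space nn_integral_eq_integral q_nonneg)
  finally have "((\<lambda>k. \<integral>\<omega>. q k \<omega> * (of_int (sgn k) * (\<Sum>a\<in>steps k. \<bar>fst (shift a \<omega> 0)\<bar>)) \<partial>P) has_sum
      (\<integral>\<omega>. \<bar>fst (\<omega> 0)\<bar> * current \<omega> \<partial>P)) UNIV"
    by (intro current_weighted(2)[where w = "\<lambda>\<omega>. \<bar>fst (\<omega> 0)\<bar>"]) auto
  also have "(\<lambda>k. \<integral>\<omega>. q k \<omega> * (of_int (sgn k) * (\<Sum>a\<in>steps k. \<bar>fst (shift a \<omega> 0)\<bar>)) \<partial>P) =
      (\<lambda>k. \<integral>\<omega>. q k \<omega> * site \<omega> k \<partial>P)"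
  proof
    fix k
    show "(\<integral>\<omega>. q k \<omega> * (of_int (sgn k) * (\<Sum>a\<in>steps k. \<bar>fst (shift a \<omega> 0)\<bar>)) \<partial>P) =
      (\<integral>\<omega>. q k \<omega> * site \<omega> k \<partial>P)"
    proof (rule integral_cong_AE)
      show "AE \<omega> in P. q k \<omega> * (of_int (sgn k) * (\<Sum>a\<in>steps k. \<bar>fst (shift a \<omega> 0)\<bar>)) = q k \<omega> * site \<omega> k"
        using AE_sum_steps_eq[of k] by eventually_elim metis
    qed measurable
  qed
  also have "(\<integral>\<omega>. \<bar>fst (\<omega> 0)\<bar> * current \<omega> \<partial>P) = (\<integral>\<omega>. fst (\<omega> 0) * mean_current \<partial>P)"
  proof (rule integral_cong_AE)
    show "AE \<omega> in P. \<bar>fst (\<omega> 0)\<bar> * current \<omega> = fst (\<omega> 0) * mean_current"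
      using AE_current_eq Z0_ge_d by eventually_elim (use d_pos in auto)
  qed measurable
  also have "\<dots> = mean_gap * mean_current" by (simp add: mean_gap_def)
  finally show ?thesis .
qed

end

section \<open>Entropy production\<close>

text \<open>
  The logarithm of \<open>g\<close> need not be integrable, hence the clipping; it also avoids the junk value \<open>ln 0 = 0\<close>.
\<close>

definition log_clip :: "nat \<Rightarrow> real \<Rightarrow> real" where
  "log_clip n x = ln (max (1 / real (Suc n)) (min (real (Suc n)) x))"

lemma log_clip_bound: "\<bar>log_clip n x\<bar> \<le> ln (real (Suc n))"
proof -
  let ?y = "max (1 / real (Suc n)) (min (real (Suc n)) x)"
  have "1 / real (Suc n) \<le> real (Suc n)" by (simp add: field_simps)
  moreover have "0 < 1 / real (Suc n)" by simp
  ultimately have "1 / real (Suc n) \<le> ?y" "?y \<le> real (Suc n)" "0 < ?y"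
    by (simp_all only: less_max_iff_disj) auto
  then have "ln (1 / real (Suc n)) \<le> ln ?y" "ln ?y \<le> ln (real (Suc n))"
    by (intro ln_mono; simp)+
  then show ?thesis by (simp add: log_clip_def ln_div abs_le_iff del: of_nat_Suc)
qed

lemma log_clip_eventually_ln:
  assumes "0 < x"
  shows "eventually (\<lambda>n. log_clip n x = ln x) sequentially"
proof -
  have "eventually (\<lambda>n. max x (1 / x) \<le> real n) sequentially"
    by (rule eventually_ge_at_top[THEN eventually_compose_filterlim, OF filterlim_real_sequentially])
  then show ?thesis
  proof eventually_elim
    case (elim n)
    then have "x \<le> real (Suc n)" "1 / x \<le> real (Suc n)" by auto
    then have "1 / real (Suc n) \<le> x" using assms by (simp add: field_simps)
    with \<open>x \<le> real (Suc n)\<close> show ?case by (simp only: log_clip_def min_absorb2 max_absorb2)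
  qed
qed

text \<open>If the difference of the clipped logarithms is nonnegative, the term with
  \<open>\<bar>\<alpha>\<bar>\<close> suffices. Otherwise \<open>x < y\<close>, and clipping only
  shrinks the ratio \<open>y / x\<close>, so that \<open>ln s \<le> s - 1\<close> at
  \<open>s = (y / x) * exp (- \<alpha>)\<close> applies.\<close>

lemma entropy_lower_bound:
  fixes x y \<alpha> :: real
  assumes "0 \<le> x" "0 \<le> y"
  shows "0 \<le> x * (\<alpha> + log_clip n x - log_clip n y) + y * exp (- \<alpha>) - x + x * (\<bar>\<alpha>\<bar> + 1)"
proof (cases "log_clip n y \<le> log_clip n x \<or> x = 0")
  case True
  then have "0 \<le> x * (\<alpha> + \<bar>\<alpha>\<bar> + (log_clip n x - log_clip n y))"
  proof
    assume "log_clip n y \<le> log_clip n x"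
    then show ?thesis using assms by (intro mult_nonneg_nonneg) auto
  qed simp
  moreover have "0 \<le> y * exp (- \<alpha>)" using assms by simp
  ultimately show ?thesis by (simp add: algebra_simps)
next
  case False
  define K where "K = real (Suc n)"
  have K: "1 \<le> K" by (simp add: K_def)
  have "1 / K \<le> 1" using K by simp
  then have KK: "1 / K \<le> K" using K by linarith
  define c where "c z = max (1 / K) (min K z)" for z
  have c0: "0 < c z" for z using K by (simp add: c_def less_max_iff_disj)
  have lc: "log_clip n z = ln (c z)" for z by (simp add: log_clip_def c_def K_def)
  have x: "0 < x" using False assms by auto
  have "c x < c y" using False c0 by (simp add: lc not_le)
  then have "x < y" by (auto simp: c_def max_def min_def split: if_splits)
  have "c y * x \<le> c x * y"
  proof -
    consider "x \<le> 1 / K" | "K \<le> y" | "1 / K < x" "y < K" by linarith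
    then show ?thesis
    proof cases
      case 1
      then have cx: "c x = 1 / K" using K by (simp add: c_def max_def min_def)
      have "c y \<le> y \<or> c y = 1 / K" by (auto simp: c_def max_def min_def)
      then show ?thesis
      proof
        assume "c y \<le> y"
        then have "c y * x \<le> y * (1 / K)" using 1 x c0[of y] by (intro mult_mono) auto
        then show ?thesis by (simp add: cx)
      next
        assume "c y = 1 / K"
        then show ?thesis using \<open>c x < c y\<close> cx by simp
      qed
    next
      case 2
      then have cy: "c y = K" using KK by (simp add: c_def)
      have "c x \<ge> x \<or> c x = K" using KK by (auto simp: c_def max_def min_def)
      then show ?thesis
      proof
        assume "x \<le> c x"
        then have "K * x \<le> y * c x" using 2 x K by (intro mult_mono) auto
        then show ?thesis by (simp add: cy mult.commute)
      next
        assume "c x = K"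
        then show ?thesis using \<open>c x < c y\<close> cy by simp
      qed
    next
      case 3
      with \<open>x < y\<close> have "c x = x" "c y = y" by (auto simp: c_def)
      then show ?thesis by simp
    qed
  qed
  then have "c y / c x \<le> y / x" using c0[of x] x by (simp add: field_simps)
  then have "ln (c y / c x) \<le> ln (y / x)"
    using c0[of x] c0[of y] x \<open>x < y\<close> by (intro ln_mono) auto
  then have D: "log_clip n x - log_clip n y \<ge> - ln (y / x)"
    using c0[of x] c0[of y] by (simp add: lc ln_div)
  define s where "s = (y / x) * exp (- \<alpha>)"
  have s: "0 < s" using x \<open>x < y\<close> by (simp add: s_def)
  have "ln s = ln (y / x) - \<alpha>" unfolding s_def using x \<open>x < y\<close> by (subst ln_mult_pos) auto
  moreover have "ln s \<le> s - 1" using s by (rule ln_le_minus_one)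
  ultimately have "0 \<le> \<alpha> + (log_clip n x - log_clip n y) + s - 1" using D by simp
  then have "0 \<le> x * (\<alpha> + (log_clip n x - log_clip n y) + s - 1)" using x by simp
  also have "x * s = y * exp (- \<alpha>)" using x by (simp add: s_def)
  then have "x * (\<alpha> + (log_clip n x - log_clip n y) + s - 1) = x * (\<alpha> + log_clip n x - log_clip n y) + y * exp (- \<alpha>) - x"
    by (simp add: algebra_simps)
  finally show ?thesis using x by (simp add: add_nonneg_nonneg)
qed

text \<open>For positive \<open>x\<close> and \<open>y\<close> the clipping is eventually inactive
  and the claim reduces to \<open>ln s \<le> 2 * (sqrt s - 1)\<close> with
  \<open>s = (y / x) * exp (- \<alpha>)\<close>. For \<open>y = 0\<close> the clipped logarithm of
  \<open>y\<close> tends to minus infinity.\<close>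

lemma entropy_eventually_ge:
  fixes x y \<alpha> :: real
  assumes "0 \<le> x" "0 \<le> y"
  shows "eventually (\<lambda>n. (sqrt x - sqrt (y * exp (- \<alpha>)))\<^sup>2 \<le>
    x * (\<alpha> + log_clip n x - log_clip n y) + y * exp (- \<alpha>) - x) sequentially"
proof -
  consider "x = 0" | "0 < x" "y = 0" | "0 < x" "0 < y" using assms by linarith
  then show ?thesis
  proof cases
    case 1
    then show ?thesis using assms by simp
  next
    case 2
    have "filterlim (\<lambda>n. ln (real (Suc n))) at_top sequentially"
      by (intro filterlim_compose[OF ln_at_top] filterlim_compose[OF filterlim_real_sequentially] filterlim_Suc)
    \<comment> \<open>The bracket has to reach 2: one unit compensates \<open>- x\<close>, the other
      provides \<open>(sqrt x)\<^sup>2\<close>.\<close>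
    then have "eventually (\<lambda>n. 2 - \<alpha> - ln x \<le> ln (real (Suc n))) sequentially"
      by (simp add: filterlim_at_top)
    with log_clip_eventually_ln[OF 2(1)] show ?thesis
    proof eventually_elim
      case (elim n)
      have "log_clip n 0 = - ln (real (Suc n))"
        by (simp add: log_clip_def max_def min_def ln_div)
      with elim have "2 \<le> \<alpha> + log_clip n x - log_clip n 0" by simp
      then have "x * 2 \<le> x * (\<alpha> + log_clip n x - log_clip n 0)" using 2 by (intro mult_left_mono) auto
      then show ?case using 2 by simp
    qed
  next
    case 3
    from log_clip_eventually_ln[OF 3(1)] log_clip_eventually_ln[OF 3(2)] show ?thesis
    proof eventually_elim
      case (elim n)
      define s where "s = (y / x) * exp (- \<alpha>)"
      have s: "0 < s" using 3 by (simp add: s_def)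
      have xs: "y * exp (- \<alpha>) = x * s" using 3 by (simp add: s_def)
      have "ln s = ln y - ln x - \<alpha>" unfolding s_def using 3 by (subst ln_mult_pos) (auto simp: ln_div)
      moreover have "ln s \<le> 2 * (sqrt s - 1)"
        using ln_le_minus_one[of "sqrt s"] s by (simp add: ln_sqrt)
      ultimately have "1 - 2 * sqrt s + s \<le> (\<alpha> + ln x - ln y) + s - 1" by simp
      then have "x * (1 - 2 * sqrt s + s) \<le> x * ((\<alpha> + ln x - ln y) + s - 1)"
        using 3 by (intro mult_left_mono) auto
      moreover have "(sqrt x - sqrt (x * s))\<^sup>2 = x * (1 - 2 * sqrt s + s)"
        using 3 s by (simp add: power2_diff real_sqrt_mult power_mult_distrib) (simp add: algebra_simps)
      ultimately show ?case
        unfolding elim xs by (simp add: algebra_simps)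
    qed
  qed
qed

text \<open>Bounds the stationary second moment of the jump length in index, for every bias.\<close>

definition (in mott_environment) drift_const :: real where
  "drift_const = jump_const * (\<Sum>\<^sub>\<infinity>k::int. (real_of_int k)\<^sup>2 * \<rho> ^ nat \<bar>k\<bar>)"

context mott_stationary_density
begin

definition q_rev :: "int \<Rightarrow> environment \<Rightarrow> real" where
  "q_rev k \<omega> = q (- k) (shift k \<omega>)"

lemma measurable_q_rev [measurable]: "q_rev k \<in> borel_measurable env_space"
  unfolding q_rev_def [abs_def] by measurable

lemma q_rev_nonneg: "0 \<le> q_rev k \<omega>"
  by (simp add: q_rev_def q_nonneg)

lemma integrable_q_rev: "integrable P (q_rev k)"
  unfolding q_rev_def [abs_def] by (intro integrable_shift integrable_q)

lemma integral_q_rev: "(\<integral>\<omega>. q_rev k \<omega> \<partial>P) = (\<integral>\<omega>. q (- k) \<omega> \<partial>P)"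
  unfolding q_rev_def by (rule integral_shift) measurable

text \<open>Local detailed balance: by symmetry of \<open>u\<close>, the rates of a jump and of its
  reversal differ only by the tilt.\<close>

lemma q_rev_eq: "q_rev k \<omega> = g (shift k \<omega>) * mott_rate u lam \<omega> 0 k * exp (- (2 * lam * site \<omega> k))"
proof -
  have "mott_rate u lam \<omega> k 0 = mott_rate u lam \<omega> 0 k * exp (- (2 * lam * site \<omega> k))"
    by (simp add: mott_rate_def site_0 u_sym[of "snd (\<omega> 0)"] mult_exp_exp algebra_simps)
  then show ?thesis by (simp add: q_rev_def q_def mott_rate_shift)
qed

text \<open>Stated for any nonnegative terms adding up to \<open>f\<close>, so that it serves both
  the outgoing and the incoming jumps.\<close>

lemma has_sum_integral_weighted:
  assumes a [measurable]: "\<And>k. a k \<in> borel_measurable env_space" and a0: "\<And>k \<omega>. 0 \<le> a k \<omega>"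
    and sum: "AE \<omega> in P. ((\<lambda>k. a k \<omega>) has_sum f \<omega>) UNIV"
    and \<psi> [measurable]: "\<psi> \<in> borel_measurable env_space" and C: "\<And>\<omega>. \<bar>\<psi> \<omega>\<bar> \<le> C"
  shows "((\<lambda>k::int. \<integral>\<omega>. a k \<omega> * \<psi> \<omega> \<partial>P) has_sum (\<integral>\<omega>. f \<omega> * \<psi> \<omega> \<partial>P)) UNIV"
    and "integrable P (\<lambda>\<omega>. a k \<omega> * \<psi> \<omega>)"
proof -
  have m: "(\<lambda>\<omega>. a k \<omega> * \<psi> \<omega>) \<in> borel_measurable P" for k by measurable
  have C0: "0 \<le> C" using C[of undefined] by simp
  have "(\<integral>\<^sup>+k. (\<integral>\<^sup>+\<omega>. ennreal (norm (a k \<omega> * \<psi> \<omega>)) \<partial>P) \<partial>count_space UNIV) \<le>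
      (\<integral>\<^sup>+k. (\<integral>\<^sup>+\<omega>. ennreal C * ennreal (a k \<omega>) \<partial>P) \<partial>count_space UNIV)"
    using C a0 C0 by (intro nn_integral_mono)
      (auto simp: ennreal_mult[symmetric] abs_mult mult.commute[of C] intro!: ennreal_leI mult_left_mono)
  also have "\<dots> = (\<integral>\<^sup>+\<omega>. (\<integral>\<^sup>+k. ennreal C * ennreal (a k \<omega>) \<partial>count_space UNIV) \<partial>P)"
    by (rule nn_integral_count_space_nn_integral[symmetric]) auto
  also have "\<dots> = (\<integral>\<^sup>+\<omega>. ennreal C * ennreal (f \<omega>) \<partial>P)"
  proof (rule nn_integral_cong_AE)
    show "AE \<omega> in P. (\<integral>\<^sup>+k. ennreal C * ennreal (a k \<omega>) \<partial>count_space UNIV) = ennreal C * ennreal (f \<omega>)"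
      using sum
    proof eventually_elim
      case (elim \<omega>)
      then have "(\<integral>\<^sup>+k. ennreal (a k \<omega>) \<partial>count_space UNIV) = ennreal (f \<omega>)"
        using has_sum_iff_nn_integral_count_space[of "\<lambda>k. a k \<omega>" "f \<omega>"] a0 f_nonneg by simp
      then show ?case by (simp add: nn_integral_cmult)
    qed
  qed
  also have "\<dots> = ennreal C * 1"
    by (subst nn_integral_cmult) (auto simp: nn_integral_f)
  also have "\<dots> < \<infinity>" by simp
  finally have fin: "(\<integral>\<^sup>+k. (\<integral>\<^sup>+\<omega>. ennreal (norm (a k \<omega> * \<psi> \<omega>)) \<partial>P) \<partial>count_space UNIV) < \<infinity>" .
  have "(\<integral>\<omega>. (\<Sum>\<^sub>\<infinity>k. a k \<omega> * \<psi> \<omega>) \<partial>P) = (\<integral>\<omega>. f \<omega> * \<psi> \<omega> \<partial>P)"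
  proof (rule integral_cong_AE)
    show "AE \<omega> in P. (\<Sum>\<^sub>\<infinity>k. a k \<omega> * \<psi> \<omega>) = f \<omega> * \<psi> \<omega>"
      using sum by eventually_elim (intro infsumI has_sum_cmult_left)
    show "(\<lambda>\<omega>. \<Sum>\<^sub>\<infinity>k. a k \<omega> * \<psi> \<omega>) \<in> borel_measurable P"
      by (rule borel_measurable_infsum) (rule m)
  qed measurable
  with has_sum_integral[OF m fin]
  show "((\<lambda>k::int. \<integral>\<omega>. a k \<omega> * \<psi> \<omega> \<partial>P) has_sum (\<integral>\<omega>. f \<omega> * \<psi> \<omega> \<partial>P)) UNIV" by simp
  show "integrable P (\<lambda>\<omega>. a k \<omega> * \<psi> \<omega>)"
    by (rule integrable_of_nn_integral_count_space[OF m fin])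
qed

lemma AE_q_out: "AE \<omega> in P. ((\<lambda>k. q k \<omega>) has_sum f \<omega>) UNIV"
  using AE_good by eventually_elim (rule q_out)

lemma has_sum_integral_q: "((\<lambda>k. \<integral>\<omega>. q k \<omega> \<partial>P) has_sum 1) UNIV"
  using has_sum_integral_weighted(1)[of q "\<lambda>_. 1" 1, OF _ _ AE_q_out] by (simp add: q_nonneg integral_f)

lemma has_sum_integral_q_rev: "((\<lambda>k. \<integral>\<omega>. q_rev k \<omega> \<partial>P) has_sum 1) UNIV"
proof -
  have "((\<lambda>k. \<integral>\<omega>. q (- k) \<omega> \<partial>P) has_sum 1) UNIV"
    using has_sum_integral_q by (subst has_sum_reindex_bij_witness[of UNIV uminus uminus]) auto
  then show ?thesis by (simp add: integral_q_rev)
qed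

text \<open>Stationarity tested on a bounded observable: evaluated at the start or at the end of a
  jump, it has the same mean.\<close>

lemma log_clip_stationary:
  shows "((\<lambda>k. \<integral>\<omega>. q k \<omega> * (log_clip n (g \<omega>) - log_clip n (g (shift k \<omega>))) \<partial>P) has_sum 0) UNIV"
    and "integrable P (\<lambda>\<omega>. q k \<omega> * (log_clip n (g \<omega>) - log_clip n (g (shift k \<omega>))))"
proof -
  define \<psi> where "\<psi> \<omega> = log_clip n (g \<omega>)" for \<omega>
  have \<psi> [measurable]: "\<psi> \<in> borel_measurable env_space"
    unfolding \<psi>_def [abs_def] log_clip_def by measurable
  have C: "\<bar>\<psi> \<omega>\<bar> \<le> ln (real (Suc n))" for \<omega> unfolding \<psi>_def by (rule log_clip_bound)
  note out = has_sum_integral_weighted[of q, OF _ _ AE_q_out \<psi> C]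
  note inn = has_sum_integral_weighted[of "\<lambda>k \<omega>. q k (shift (- k) \<omega>)", OF _ _ AE_q_in \<psi> C]
  have eq: "(\<integral>\<omega>. q k \<omega> * \<psi> (shift k \<omega>) \<partial>P) = (\<integral>\<omega>. q k (shift (- k) \<omega>) * \<psi> \<omega> \<partial>P)" for k
    using integral_shift[of "\<lambda>\<omega>. q k \<omega> * \<psi> (shift k \<omega>)" "- k"] by (simp add: shift_shift shift_0)
  have int2: "integrable P (\<lambda>\<omega>. q k \<omega> * \<psi> (shift k \<omega>))" for k
    using integrable_shift[OF inn(2), of k k] by (simp add: shift_shift shift_0 q_nonneg)
  have int1: "integrable P (\<lambda>\<omega>. q k \<omega> * \<psi> \<omega>)" for k
    by (rule out(2)) (auto simp: q_nonneg)
  show "integrable P (\<lambda>\<omega>. q k \<omega> * (log_clip n (g \<omega>) - log_clip n (g (shift k \<omega>))))" for k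
    using Bochner_Integration.integrable_diff[OF int1[of k] int2[of k]] by (simp add: \<psi>_def algebra_simps)
  have "((\<lambda>k. (\<integral>\<omega>. q k \<omega> * \<psi> \<omega> \<partial>P) + (-1) * (\<integral>\<omega>. q k (shift (- k) \<omega>) * \<psi> \<omega> \<partial>P)) has_sum
      (\<integral>\<omega>. f \<omega> * \<psi> \<omega> \<partial>P) + (-1) * (\<integral>\<omega>. f \<omega> * \<psi> \<omega> \<partial>P)) UNIV"
    by (intro has_sum_add has_sum_cmult_right out(1) inn(1)) (auto simp: q_nonneg)
  also have "(\<lambda>k. (\<integral>\<omega>. q k \<omega> * \<psi> \<omega> \<partial>P) + (-1) * (\<integral>\<omega>. q k (shift (- k) \<omega>) * \<psi> \<omega> \<partial>P)) =
      (\<lambda>k. \<integral>\<omega>. q k \<omega> * (log_clip n (g \<omega>) - log_clip n (g (shift k \<omega>))) \<partial>P)"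
  proof
    fix k
    show "(\<integral>\<omega>. q k \<omega> * \<psi> \<omega> \<partial>P) + (-1) * (\<integral>\<omega>. q k (shift (- k) \<omega>) * \<psi> \<omega> \<partial>P) =
        (\<integral>\<omega>. q k \<omega> * (log_clip n (g \<omega>) - log_clip n (g (shift k \<omega>))) \<partial>P)"
      unfolding eq[symmetric] using Bochner_Integration.integral_diff[OF int1[of k] int2[of k]]
      by (simp add: \<psi>_def algebra_simps)
  qed
  finally show "((\<lambda>k. \<integral>\<omega>. q k \<omega> * (log_clip n (g \<omega>) - log_clip n (g (shift k \<omega>))) \<partial>P) has_sum 0) UNIV"
    by simp
qed

text \<open>
  As \<open>n\<close> tends to \<open>\<infinity>\<close>, \<open>entropy_term n k\<close> becomes \<open>q k * ln (q k / q_rev k) + q_rev k - q k\<close>. Its negative part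
  is at most \<open>entropy_floor k\<close> for every \<open>n\<close>, so that Fatou's lemma applies.
\<close>

definition sqrt_flux :: "int \<Rightarrow> environment \<Rightarrow> real" where
  "sqrt_flux k \<omega> = (sqrt (q k \<omega>) - sqrt (q_rev k \<omega>))\<^sup>2"

definition entropy_term :: "nat \<Rightarrow> int \<Rightarrow> environment \<Rightarrow> real" where
  "entropy_term n k \<omega> = 2 * lam * (q k \<omega> * site \<omega> k)
    + q k \<omega> * (log_clip n (g \<omega>) - log_clip n (g (shift k \<omega>))) + q_rev k \<omega> - q k \<omega>"

definition entropy_floor :: "int \<Rightarrow> environment \<Rightarrow> real" where
  "entropy_floor k \<omega> = 2 * lam * (q k \<omega> * \<bar>site \<omega> k\<bar>) + q k \<omega>"

lemma measurable_sqrt_flux [measurable]: "sqrt_flux k \<in> borel_measurable env_space"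
  unfolding sqrt_flux_def [abs_def] by measurable

lemma measurable_entropy_term [measurable]: "entropy_term n k \<in> borel_measurable env_space"
  unfolding entropy_term_def [abs_def] log_clip_def by measurable

lemma measurable_entropy_floor [measurable]: "entropy_floor k \<in> borel_measurable env_space"
  unfolding entropy_floor_def [abs_def] by measurable

lemma entropy_term_plus_floor_nonneg: "0 \<le> entropy_term n k \<omega> + entropy_floor k \<omega>"
proof -
  have "0 \<le> mott_rate u lam \<omega> 0 k * (g \<omega> * (2 * lam * site \<omega> k + log_clip n (g \<omega>) - log_clip n (g (shift k \<omega>)))
      + g (shift k \<omega>) * exp (- (2 * lam * site \<omega> k)) - g \<omega> + g \<omega> * (\<bar>2 * lam * site \<omega> k\<bar> + 1))"
    by (intro mult_nonneg_nonneg entropy_lower_bound g_nonneg mott_rate_nonneg)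
  also have "\<dots> = entropy_term n k \<omega> + entropy_floor k \<omega>"
    using lam by (simp add: entropy_term_def entropy_floor_def q_rev_eq q_def abs_mult algebra_simps)
  finally show ?thesis .
qed

lemma eventually_sqrt_flux_le: "eventually (\<lambda>n. sqrt_flux k \<omega> \<le> entropy_term n k \<omega>) sequentially"
  using entropy_eventually_ge[OF g_nonneg g_nonneg, of \<omega> "shift k \<omega>" "2 * lam * site \<omega> k"]
proof eventually_elim
  case (elim n)
  define R where "R = mott_rate u lam \<omega> 0 k"
  have R: "0 \<le> R" by (simp add: R_def mott_rate_nonneg)
  let ?y = "g (shift k \<omega>) * exp (- (2 * lam * site \<omega> k))"
  have "sqrt_flux k \<omega> = (sqrt R * (sqrt (g \<omega>) - sqrt ?y))\<^sup>2"
    by (simp add: sqrt_flux_def q_rev_eq q_def R_def real_sqrt_mult algebra_simps)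
  also have "\<dots> = R * (sqrt (g \<omega>) - sqrt ?y)\<^sup>2"
    using R by (simp add: power_mult_distrib)
  also have "\<dots> \<le> R * (g \<omega> * (2 * lam * site \<omega> k + log_clip n (g \<omega>) - log_clip n (g (shift k \<omega>))) + ?y - g \<omega>)"
    by (rule mult_left_mono[OF elim R])
  also have "\<dots> = entropy_term n k \<omega>"
    by (simp add: entropy_term_def q_rev_eq q_def R_def algebra_simps)
  finally show ?case .
qed

lemma sqrt_flux_nonneg: "0 \<le> sqrt_flux k \<omega>"
  by (simp add: sqrt_flux_def)

lemma integrable_sqrt_flux: "integrable P (sqrt_flux k)"
proof (rule Bochner_Integration.integrable_bound)
  show "integrable P (\<lambda>\<omega>. q k \<omega> + q_rev k \<omega>)"
    by (intro Bochner_Integration.integrable_add integrable_q integrable_q_rev)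
  have "sqrt_flux k \<omega> \<le> q k \<omega> + q_rev k \<omega>" for \<omega>
    using q_nonneg[of k \<omega>] q_rev_nonneg[of k \<omega>] by (simp add: sqrt_flux_def power2_diff)
  then show "AE \<omega> in P. norm (sqrt_flux k \<omega>) \<le> norm (q k \<omega> + q_rev k \<omega>)"
    by (intro AE_I2) (simp add: sqrt_flux_nonneg q_nonneg q_rev_nonneg)
qed measurable

lemma integrable_q_signed_site: "integrable P (\<lambda>\<omega>. q k \<omega> * site \<omega> k)"
  by (rule Bochner_Integration.integrable_bound[OF integrable_q_site[of k]])
    (auto simp: abs_mult)

lemma integrable_entropy_floor: "integrable P (entropy_floor k)"
  unfolding entropy_floor_def [abs_def]
  by (intro Bochner_Integration.integrable_add integrable_mult_right integrable_q_site integrable_q)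

lemma summable_on_entropy_floor: "(\<lambda>k. \<integral>\<omega>. entropy_floor k \<omega> \<partial>P) summable_on UNIV"
proof -
  have "(\<lambda>k. 2 * lam * (\<integral>\<omega>. q k \<omega> * \<bar>site \<omega> k\<bar> \<partial>P) + (\<integral>\<omega>. q k \<omega> \<partial>P)) summable_on UNIV"
    by (intro summable_on_add summable_on_cmult_right summable_on_integral_q_site
        has_sum_imp_summable[OF has_sum_integral_q])
  moreover have "(\<integral>\<omega>. entropy_floor k \<omega> \<partial>P) =
      2 * lam * (\<integral>\<omega>. q k \<omega> * \<bar>site \<omega> k\<bar> \<partial>P) + (\<integral>\<omega>. q k \<omega> \<partial>P)" for k
    unfolding entropy_floor_def
    by (subst Bochner_Integration.integral_add) (auto intro: integrable_q_site integrable_q)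
  ultimately show ?thesis by simp
qed

lemma integrable_entropy_term: "integrable P (entropy_term n k)"
  unfolding entropy_term_def [abs_def]
  by (intro Bochner_Integration.integrable_add Bochner_Integration.integrable_diff integrable_mult_right
      integrable_q_signed_site integrable_q integrable_q_rev log_clip_stationary(2))

text \<open>The logarithms contribute 0 by stationarity and the total masses of \<open>q\<close> and
  \<open>q_rev\<close> cancel, so only the drift remains.\<close>

lemma has_sum_entropy_term:
  "((\<lambda>k. \<integral>\<omega>. entropy_term n k \<omega> \<partial>P) has_sum 2 * lam * (mean_gap * mean_current)) UNIV"
proof -
  have "((\<lambda>k. 2 * lam * (\<integral>\<omega>. q k \<omega> * site \<omega> k \<partial>P)
      + (\<integral>\<omega>. q k \<omega> * (log_clip n (g \<omega>) - log_clip n (g (shift k \<omega>))) \<partial>P)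
      + (\<integral>\<omega>. q_rev k \<omega> \<partial>P) + (-1) * (\<integral>\<omega>. q k \<omega> \<partial>P)) has_sum
      2 * lam * (mean_gap * mean_current) + 0 + 1 + (-1) * 1) UNIV"
    by (intro has_sum_add has_sum_cmult_right has_sum_q_site log_clip_stationary(1)
        has_sum_integral_q has_sum_integral_q_rev)
  moreover have "(\<integral>\<omega>. entropy_term n k \<omega> \<partial>P) = 2 * lam * (\<integral>\<omega>. q k \<omega> * site \<omega> k \<partial>P)
      + (\<integral>\<omega>. q k \<omega> * (log_clip n (g \<omega>) - log_clip n (g (shift k \<omega>))) \<partial>P)
      + (\<integral>\<omega>. q_rev k \<omega> \<partial>P) + (-1) * (\<integral>\<omega>. q k \<omega> \<partial>P)" for k
    unfolding entropy_term_def
    using integrable_q_signed_site[of k] log_clip_stationary(2)[of k n] integrable_q[of k] integrable_q_rev[of k]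
    by (subst Bochner_Integration.integral_diff Bochner_Integration.integral_add;
        (intro Bochner_Integration.integrable_add integrable_mult_right)?; simp)+
  ultimately show ?thesis by simp
qed

text \<open>With the floor added, all terms are nonnegative and their total does not depend on
  \<open>n\<close>. Fatou's lemma is applied first in the environment and then in \<open>k\<close>;
  the floor has finite total \<open>b\<close>, which is subtracted at the end.\<close>

lemma sum_sqrt_flux_le:
  shows "(\<lambda>k. \<integral>\<omega>. sqrt_flux k \<omega> \<partial>P) summable_on UNIV"
    and "(\<Sum>\<^sub>\<infinity>k. \<integral>\<omega>. sqrt_flux k \<omega> \<partial>P) \<le> 2 * lam * (mean_gap * mean_current)"
proof -
  define y where "y k = (\<integral>\<omega>. sqrt_flux k \<omega> \<partial>P)" for k
  define B where "B k = (\<integral>\<omega>. entropy_floor k \<omega> \<partial>P)" for k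
  define b where "b = infsum B UNIV"
  define c where "c = 2 * lam * (mean_gap * mean_current)"
  have fl: "0 \<le> entropy_floor k \<omega>" for k \<omega>
    using lam by (simp add: entropy_floor_def q_nonneg)
  have y0: "0 \<le> y k" for k unfolding y_def by (simp add: sqrt_flux_nonneg)
  have B0: "0 \<le> B k" for k unfolding B_def by (simp add: fl)
  have Bs: "(B has_sum b) UNIV"
    unfolding b_def B_def by (intro has_sum_infsum summable_on_entropy_floor)
  have tot: "(\<integral>\<^sup>+k. (\<integral>\<^sup>+\<omega>. ennreal (entropy_term n k \<omega> + entropy_floor k \<omega>) \<partial>P) \<partial>count_space UNIV) = ennreal (c + b)"
    and cb: "0 \<le> c + b" for n
  proof -
    have int: "integrable P (\<lambda>\<omega>. entropy_term n k \<omega> + entropy_floor k \<omega>)" for k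
      by (intro Bochner_Integration.integrable_add integrable_entropy_term integrable_entropy_floor)
    have E: "(\<integral>\<omega>. entropy_term n k \<omega> + entropy_floor k \<omega> \<partial>P) = (\<integral>\<omega>. entropy_term n k \<omega> \<partial>P) + B k" for k
      unfolding B_def by (intro Bochner_Integration.integral_add integrable_entropy_term integrable_entropy_floor)
    have hs: "((\<lambda>k. \<integral>\<omega>. entropy_term n k \<omega> + entropy_floor k \<omega> \<partial>P) has_sum c + b) UNIV"
      unfolding E c_def by (intro has_sum_add has_sum_entropy_term Bs)
    have nn: "0 \<le> (\<integral>\<omega>. entropy_term n k \<omega> + entropy_floor k \<omega> \<partial>P)" for k
      by (intro Bochner_Integration.integral_nonneg entropy_term_plus_floor_nonneg)
    show "0 \<le> c + b" using hs nn by (rule has_sum_nonneg)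
    with hs nn have "(\<integral>\<^sup>+k. ennreal (\<integral>\<omega>. entropy_term n k \<omega> + entropy_floor k \<omega> \<partial>P) \<partial>count_space UNIV) = ennreal (c + b)"
      by (subst (asm) has_sum_iff_nn_integral_count_space) auto
    then show "(\<integral>\<^sup>+k. (\<integral>\<^sup>+\<omega>. ennreal (entropy_term n k \<omega> + entropy_floor k \<omega>) \<partial>P) \<partial>count_space UNIV) = ennreal (c + b)"
      by (simp add: nn_integral_eq_integral[OF int] entropy_term_plus_floor_nonneg)
  qed
  have "(\<integral>\<^sup>+k. ennreal (y k + B k) \<partial>count_space UNIV) =
      (\<integral>\<^sup>+k. (\<integral>\<^sup>+\<omega>. ennreal (sqrt_flux k \<omega> + entropy_floor k \<omega>) \<partial>P) \<partial>count_space UNIV)"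
  proof (rule nn_integral_cong)
    fix k
    have "integrable P (\<lambda>\<omega>. sqrt_flux k \<omega> + entropy_floor k \<omega>)"
      by (intro Bochner_Integration.integrable_add integrable_sqrt_flux integrable_entropy_floor)
    from nn_integral_eq_integral[OF this]
    show "ennreal (y k + B k) = (\<integral>\<^sup>+\<omega>. ennreal (sqrt_flux k \<omega> + entropy_floor k \<omega>) \<partial>P)"
      by (simp add: y_def B_def fl sqrt_flux_nonneg integrable_sqrt_flux integrable_entropy_floor)
  qed
  also have "\<dots> \<le> (\<integral>\<^sup>+k. (\<integral>\<^sup>+\<omega>. liminf (\<lambda>n. ennreal (entropy_term n k \<omega> + entropy_floor k \<omega>)) \<partial>P) \<partial>count_space UNIV)"
  proof (intro nn_integral_mono Liminf_bounded)
    fix k \<omega>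
    show "eventually (\<lambda>n. ennreal (sqrt_flux k \<omega> + entropy_floor k \<omega>) \<le> ennreal (entropy_term n k \<omega> + entropy_floor k \<omega>)) sequentially"
      using eventually_sqrt_flux_le[of k \<omega>] by eventually_elim (simp add: ennreal_leI)
  qed
  also have "\<dots> \<le> (\<integral>\<^sup>+k. liminf (\<lambda>n. \<integral>\<^sup>+\<omega>. ennreal (entropy_term n k \<omega> + entropy_floor k \<omega>) \<partial>P) \<partial>count_space UNIV)"
    by (rule nn_integral_mono) (rule nn_integral_liminf, measurable)
  also have "\<dots> \<le> liminf (\<lambda>n. \<integral>\<^sup>+k. (\<integral>\<^sup>+\<omega>. ennreal (entropy_term n k \<omega> + entropy_floor k \<omega>) \<partial>P) \<partial>count_space UNIV)"
    by (rule nn_integral_liminf) simp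
  also have "\<dots> = ennreal (c + b)"
    unfolding tot by (simp add: Liminf_const)
  finally have le: "(\<integral>\<^sup>+k. ennreal (y k + B k) \<partial>count_space UNIV) \<le> ennreal (c + b)" .
  have yB0: "0 \<le> y k + B k" for k using y0 B0 by (simp add: add_nonneg_nonneg)
  have int: "integrable (count_space UNIV) (\<lambda>k. y k + B k)"
    using le yB0 by (intro integrableI_nonneg) (auto intro: le_less_trans)
  then have yB: "(\<lambda>k. y k + B k) summable_on UNIV"
    by (simp add: summable_on_iff_integrable_count_space)
  have sum_le: "(\<Sum>\<^sub>\<infinity>k. y k + B k) \<le> c + b"
    using le cb nn_integral_eq_integral[OF int] yB0 by (simp add: infsum_eq_integral_count_space)
  show ys: "(\<lambda>k. \<integral>\<omega>. sqrt_flux k \<omega> \<partial>P) summable_on UNIV"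
    unfolding y_def[symmetric]
    by (rule summable_on_comparison_test[OF yB]) (use y0 B0 in auto)
  have "(\<Sum>\<^sub>\<infinity>k. y k + B k) = infsum y UNIV + b"
    unfolding b_def using ys Bs by (intro infsum_add) (auto simp: y_def[abs_def] summable_on_def)
  moreover have "infsum y UNIV = (\<Sum>\<^sub>\<infinity>k. \<integral>\<omega>. sqrt_flux k \<omega> \<partial>P)"
    by (rule infsum_cong) (simp add: y_def)
  ultimately show "(\<Sum>\<^sub>\<infinity>k. \<integral>\<omega>. sqrt_flux k \<omega> \<partial>P) \<le> 2 * lam * (mean_gap * mean_current)"
    using sum_le by (simp add: c_def)
qed

text \<open>
  Here \<open>\<alpha>\<close> is the weight in the AM-GM inequality. The entropy production is itself a multiple of the mean current, and
  \<open>\<alpha>\<close> is chosen such that half of the left-hand side can be absorbed.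
\<close>

lemma mean_current_le: "mean_current \<le> 2 * drift_const * lam * mean_gap"
proof -
  define \<alpha> where "\<alpha> = 1 / (lam * mean_gap)"
  have \<alpha>: "0 < \<alpha>" using lam mean_gap_pos by (simp add: \<alpha>_def)
  define T where "T = (\<Sum>\<^sub>\<infinity>k::int. (real_of_int k)\<^sup>2 * (\<integral>\<omega>. q k \<omega> \<partial>P))"
  have T: "((\<lambda>k::int. (real_of_int k)\<^sup>2 * (\<integral>\<omega>. q k \<omega> \<partial>P)) has_sum T) UNIV"
    unfolding T_def by (intro has_sum_infsum summable_on_square_integral_q)
  have T': "((\<lambda>k::int. (real_of_int k)\<^sup>2 * (\<integral>\<omega>. q_rev k \<omega> \<partial>P)) has_sum T) UNIV"
    using T by (subst has_sum_reindex_bij_witness[of UNIV uminus uminus]) (auto simp: integral_q_rev)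
  \<comment> \<open>Reversing a jump flips its displacement, so twice the mean current is a sum over
    the differences of \<open>q\<close> and \<open>q_rev\<close>.\<close>
  have "((\<lambda>k::int. (-1) * (real_of_int k * (\<integral>\<omega>. q_rev k \<omega> \<partial>P))) has_sum mean_current) UNIV"
    using has_sum_mean_current by (subst has_sum_reindex_bij_witness[of UNIV uminus uminus]) (auto simp: integral_q_rev)
  from has_sum_add[OF has_sum_mean_current this]
  have "((\<lambda>k::int. real_of_int k * (\<integral>\<omega>. q k \<omega> \<partial>P) + (-1) * (real_of_int k * (\<integral>\<omega>. q_rev k \<omega> \<partial>P))) has_sum mean_current + mean_current) UNIV" .
  then have "mean_current + mean_current \<le> \<alpha> / 2 * (\<Sum>\<^sub>\<infinity>k. \<integral>\<omega>. sqrt_flux k \<omega> \<partial>P) + 1 / \<alpha> * (T + T)"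
  proof (rule has_sum_mono)
    show "((\<lambda>k::int. \<alpha> / 2 * (\<integral>\<omega>. sqrt_flux k \<omega> \<partial>P) +
        1 / \<alpha> * ((real_of_int k)\<^sup>2 * (\<integral>\<omega>. q k \<omega> \<partial>P) + (real_of_int k)\<^sup>2 * (\<integral>\<omega>. q_rev k \<omega> \<partial>P))) has_sum
        \<alpha> / 2 * (\<Sum>\<^sub>\<infinity>k. \<integral>\<omega>. sqrt_flux k \<omega> \<partial>P) + 1 / \<alpha> * (T + T)) UNIV"
      by (intro has_sum_add has_sum_cmult_right T T' has_sum_infsum sum_sqrt_flux_le)
    fix k :: int
    define \<kappa> where "\<kappa> = real_of_int k"
    have pw: "\<kappa> * q k \<omega> - \<kappa> * q_rev k \<omega> \<le>
        \<alpha> / 2 * sqrt_flux k \<omega> + 1 / \<alpha> * (\<kappa>\<^sup>2 * q k \<omega> + \<kappa>\<^sup>2 * q_rev k \<omega>)" for \<omega>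
    proof -
      define a where "a = sqrt (q k \<omega>)"
      define b where "b = sqrt (q_rev k \<omega>)"
      have ab: "q k \<omega> = a\<^sup>2" "q_rev k \<omega> = b\<^sup>2"
        by (simp_all add: a_def b_def q_nonneg q_rev_nonneg)
      have flux: "sqrt_flux k \<omega> = (a - b)\<^sup>2" by (simp add: sqrt_flux_def a_def b_def)
      \<comment> \<open>Uses \<open>a\<^sup>2 - b\<^sup>2 = (a - b) * (a + b)\<close>; the second
        square completes \<open>(a + b)\<^sup>2\<close> to
        \<open>2 * a\<^sup>2 + 2 * b\<^sup>2\<close>.\<close>
      have "0 \<le> (\<alpha> * (a - b) - \<kappa> * (a + b))\<^sup>2 + \<kappa>\<^sup>2 * (a - b)\<^sup>2" by simp
      then have "2 * \<alpha> * (\<kappa> * a\<^sup>2 - \<kappa> * b\<^sup>2) \<le> \<alpha>\<^sup>2 * (a - b)\<^sup>2 + 2 * (\<kappa>\<^sup>2 * a\<^sup>2 + \<kappa>\<^sup>2 * b\<^sup>2)"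
        by (simp add: power2_eq_square algebra_simps)
      then have "\<kappa> * a\<^sup>2 - \<kappa> * b\<^sup>2 \<le> (\<alpha>\<^sup>2 * (a - b)\<^sup>2 + 2 * (\<kappa>\<^sup>2 * a\<^sup>2 + \<kappa>\<^sup>2 * b\<^sup>2)) / (2 * \<alpha>)"
        using \<alpha> by (simp add: pos_le_divide_eq mult.commute)
      also have "\<dots> = \<alpha> / 2 * (a - b)\<^sup>2 + 1 / \<alpha> * (\<kappa>\<^sup>2 * a\<^sup>2 + \<kappa>\<^sup>2 * b\<^sup>2)"
        using \<alpha> by (simp add: add_divide_distrib power2_eq_square[of \<alpha>])
      finally show ?thesis unfolding flux unfolding ab .
    qed
    note ints = integrable_q[of k] integrable_q_rev[of k] integrable_sqrt_flux[of k]
    have "(\<integral>\<omega>. \<kappa> * q k \<omega> - \<kappa> * q_rev k \<omega> \<partial>P) \<le>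
        (\<integral>\<omega>. \<alpha> / 2 * sqrt_flux k \<omega> + 1 / \<alpha> * (\<kappa>\<^sup>2 * q k \<omega> + \<kappa>\<^sup>2 * q_rev k \<omega>) \<partial>P)"
      by (rule integral_mono) (use ints pw in auto)
    then show "real_of_int k * (\<integral>\<omega>. q k \<omega> \<partial>P) + (-1) * (real_of_int k * (\<integral>\<omega>. q_rev k \<omega> \<partial>P)) \<le>
        \<alpha> / 2 * (\<integral>\<omega>. sqrt_flux k \<omega> \<partial>P) +
        1 / \<alpha> * ((real_of_int k)\<^sup>2 * (\<integral>\<omega>. q k \<omega> \<partial>P) + (real_of_int k)\<^sup>2 * (\<integral>\<omega>. q_rev k \<omega> \<partial>P))"
      using ints by (simp add: \<kappa>_def)
  qed
  also have "\<dots> \<le> \<alpha> / 2 * (2 * lam * (mean_gap * mean_current)) + 1 / \<alpha> * (T + T)"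
    using \<alpha> by (intro add_right_mono mult_left_mono sum_sqrt_flux_le) auto
  also have "\<dots> = mean_current + 2 * (lam * mean_gap) * T"
    using lam mean_gap_pos by (simp add: \<alpha>_def)
  finally have "mean_current \<le> 2 * (lam * mean_gap) * T" by simp
  also have "T \<le> drift_const"
  proof -
    have "T \<le> (\<Sum>\<^sub>\<infinity>k::int. jump_const * ((real_of_int k)\<^sup>2 * \<rho> ^ nat \<bar>k\<bar>))"
      unfolding T_def
    proof (intro infsum_mono summable_on_square_integral_q summable_on_cmult_right summable_on_square_geometric)
      fix k :: int
      show "(real_of_int k)\<^sup>2 * (\<integral>\<omega>. q k \<omega> \<partial>P) \<le> jump_const * ((real_of_int k)\<^sup>2 * \<rho> ^ nat \<bar>k\<bar>)"
        using mult_left_mono[OF integral_q_le[of k], of "(real_of_int k)\<^sup>2"] by (simp add: mult_ac)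
    qed
    then show ?thesis by (simp add: drift_const_def infsum_cmult_right')
  qed
  finally show ?thesis using lam mean_gap_pos by (simp add: mult_ac)
qed

end

section \<open>The \<open>L\<^sup>p\<close> bound\<close>

context mott_environment
begin

definition ratio_const :: real where
  "ratio_const = 1 + jump_const * (\<Sum>\<^sub>\<infinity>k::int. \<rho> ^ nat \<bar>k\<bar>)"

lemma ratio_const_pos: "0 < ratio_const"
  unfolding ratio_const_def using \<rho> jump_const_nonneg
  by (intro add_pos_nonneg mult_nonneg_nonneg infsum_nonneg) auto

text \<open>Jumps to the left lose weight under the bias. A jump to the right is compared with the
  unbiased jump to the right neighbour: the tilt over the first gap remains as
  \<open>exp (lam * Z)\<close>, and the rest of the way is dominated by the geometric decay.\<close>

lemma mott_rate_le_unbiased: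
  assumes good: "\<omega> \<in> good" and lam: "0 \<le> lam" "lam \<le> lmax"
  shows "mott_rate u lam \<omega> 0 k \<le> exp (lam * fst (\<omega> 0)) *
    (mott_rate u 0 \<omega> 0 k + jump_const * \<rho> ^ nat \<bar>k\<bar> * rate_sum 0 \<omega>)"
proof (cases "0 < k")
  case False
  have Z: "0 \<le> fst (\<omega> 0)" using good d_pos by (auto simp: good_def intro: order_trans less_imp_le)
  have "site \<omega> k \<le> 0"
    using site_diff_ge[OF good, of k 0] False mult_nonneg_nonneg[of d "- real_of_int k"] d_pos
    by (simp add: site_0)
  then have "lam * site \<omega> k \<le> 0" using lam by (simp add: mult_nonneg_nonpos)
  then have "mott_rate u lam \<omega> 0 k \<le> 1 * mott_rate u 0 \<omega> 0 k"
    by (simp add: mott_rate_def site_0)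
  also have "\<dots> \<le> exp (lam * fst (\<omega> 0)) * mott_rate u 0 \<omega> 0 k"
    using Z lam by (intro mult_right_mono mott_rate_nonneg) auto
  also have "\<dots> \<le> exp (lam * fst (\<omega> 0)) *
    (mott_rate u 0 \<omega> 0 k + jump_const * \<rho> ^ nat \<bar>k\<bar> * rate_sum 0 \<omega>)"
    using \<rho> jump_const_nonneg rate_sum_nonneg by (intro mult_left_mono) auto
  finally show ?thesis .
next
  case True
  have x1: "site \<omega> 1 = fst (\<omega> 0)" using site_add_1[of \<omega> 0] by (simp add: site_0)
  have Z: "0 < fst (\<omega> 0)" using good d_pos by (auto simp: good_def intro: less_le_trans)
  define \<Delta> where "\<Delta> = site \<omega> k - site \<omega> 1"
  have \<Delta>: "d * (real_of_int k - 1) \<le> \<Delta>"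
    using site_diff_ge[OF good, of 1 k] True by (simp add: \<Delta>_def)
  moreover have "0 \<le> d * (real_of_int k - 1)" using d_pos True by simp
  ultimately have \<Delta>0: "0 \<le> \<Delta>" by linarith
  have xk: "site \<omega> k = fst (\<omega> 0) + \<Delta>" by (simp add: \<Delta>_def x1)
  have "(1 - lmax) * (d * (real_of_int k - 1)) \<le> (1 - lam) * \<Delta>"
    using \<Delta> \<Delta>0 lam lmax \<open>0 \<le> d * (real_of_int k - 1)\<close> by (intro mult_mono) auto
  then have "- \<bar>site \<omega> 0 - site \<omega> k\<bar> + lam * (site \<omega> k - site \<omega> 0) + u (snd (\<omega> 0)) (snd (\<omega> k)) \<le>
      lam * fst (\<omega> 0) + (2 * U - (1 - lmax) * (d * (real_of_int k - 1))) +
      (- fst (\<omega> 0) + u (snd (\<omega> 0)) (snd (\<omega> 1)))"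
    using u_bound[of "snd (\<omega> 0)" "snd (\<omega> k)"] u_bound[of "snd (\<omega> 0)" "snd (\<omega> 1)"] Z \<Delta>0
    by (simp add: site_0 xk abs_le_iff algebra_simps)
  then have "mott_rate u lam \<omega> 0 k \<le> exp (lam * fst (\<omega> 0)) *
      exp (2 * U - (1 - lmax) * (d * (real_of_int k - 1))) * mott_rate u 0 \<omega> 0 1"
    using True Z by (simp add: mott_rate_def mult_exp_exp x1 site_0)
  also have "exp (2 * U - (1 - lmax) * (d * (real_of_int k - 1))) = jump_const * \<rho> ^ nat \<bar>k\<bar>"
    unfolding jump_const_def \<rho>_power[symmetric] using True
    by (simp add: \<rho>_def exp_diff[symmetric] exp_add[symmetric] algebra_simps)
  also have "exp (lam * fst (\<omega> 0)) * (jump_const * \<rho> ^ nat \<bar>k\<bar>) * mott_rate u 0 \<omega> 0 1 \<le>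
      exp (lam * fst (\<omega> 0)) * (jump_const * \<rho> ^ nat \<bar>k\<bar>) * rate_sum 0 \<omega>"
    using mott_rate_le_rate_sum[OF good, of 0 1] lmax \<rho> jump_const_nonneg by (intro mult_left_mono) auto
  also have "\<dots> \<le> exp (lam * fst (\<omega> 0)) *
    (mott_rate u 0 \<omega> 0 k + jump_const * \<rho> ^ nat \<bar>k\<bar> * rate_sum 0 \<omega>)"
    using mott_rate_nonneg[of u 0 \<omega> 0 k] by (simp add: algebra_simps)
  finally show ?thesis .
qed

lemma rate_sum_le_unbiased:
  assumes good: "\<omega> \<in> good" and lam: "0 \<le> lam" "lam \<le> lmax"
  shows "rate_sum lam \<omega> \<le> ratio_const * exp (lam * fst (\<omega> 0)) * rate_sum 0 \<omega>"
proof -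
  have s0: "mott_rate u 0 \<omega> 0 summable_on UNIV"
    using lmax by (intro summable_on_mott_rate good) auto
  have s1: "(\<lambda>k::int. jump_const * \<rho> ^ nat \<bar>k\<bar> * rate_sum 0 \<omega>) summable_on UNIV"
    by (intro summable_on_cmult_left summable_on_cmult_right summable_on_geometric)
  have "rate_sum lam \<omega> \<le> (\<Sum>\<^sub>\<infinity>k. exp (lam * fst (\<omega> 0)) *
      (mott_rate u 0 \<omega> 0 k + jump_const * \<rho> ^ nat \<bar>k\<bar> * rate_sum 0 \<omega>))"
    unfolding rate_sum_def[of lam]
    by (intro infsum_mono summable_on_mott_rate good lam summable_on_cmult_right summable_on_add s0 s1
        mott_rate_le_unbiased)
  also have "\<dots> = ratio_const * exp (lam * fst (\<omega> 0)) * rate_sum 0 \<omega>"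
    unfolding infsum_cmult_right' infsum_add[OF s0 s1] infsum_cmult_left'
    by (simp add: rate_sum_def[symmetric] ratio_const_def algebra_simps)
  finally show ?thesis .
qed

text \<open>Product of the constants from the current divided by \<open>lam\<close>, the resistance,
  its majorant \<open>exp_series\<close>, and the ratio of the total rates.\<close>

definition density_const :: real where
  "density_const = 2 * drift_const * mean_gap * exp U * exp (2 * d) * ratio_const"

lemma drift_const_nonneg: "0 \<le> drift_const"
  unfolding drift_const_def using \<rho> jump_const_nonneg
  by (intro mult_nonneg_nonneg infsum_nonneg) auto

lemma density_const_nonneg: "0 \<le> density_const"
  using drift_const_nonneg mean_gap_pos ratio_const_pos by (simp add: density_const_def)

end

context mott_stationary_density
begin

text \<open>
  The factor \<open>exp (lam * Z\<^sub>0)\<close> comes from comparing the total rates with and without bias. It is compensated by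
  \<open>exp (- 2 * lam * x\<^sub>j)\<close> if \<open>j > 0\<close> and by \<open>exp (- lam * Z\<^sub>0)\<close> in the term \<open>j = 0\<close>.
\<close>

lemma exp_mult_resistance_le:
  assumes reg: "regular \<omega>" and sum: "summable (\<lambda>j. exp (fst (\<omega> (int j))) * (decay\<^sup>2) ^ j)"
  shows "exp (lam * fst (\<omega> 0)) * resistance \<omega> \<le> exp (2 * d) * exp_series (decay\<^sup>2) \<omega>"
proof -
  have good: "\<omega> \<in> good" using reg by (simp add: regular_def)
  have Z: "0 \<le> fst (\<omega> a)" for a using good d_pos by (auto simp: good_def intro: order_trans less_imp_le)
  have term_le: "exp (lam * fst (\<omega> 0)) * exp (- (2 * lam * site \<omega> (int j)) + (1 - lam) * fst (\<omega> (int j)))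
      \<le> exp (2 * d) * (exp (fst (\<omega> (int j))) * (decay\<^sup>2) ^ j)" for j
  proof -
    have "(decay\<^sup>2) ^ j = exp (- (2 * (lam * (d * real j))))"
      unfolding decay_def exp_of_nat_mult[symmetric] power2_eq_square mult_exp_exp by (simp add: algebra_simps)
    then have rhs: "exp (2 * d) * (exp (fst (\<omega> (int j))) * (decay\<^sup>2) ^ j) =
        exp (2 * d + fst (\<omega> (int j)) - 2 * (lam * (d * real j)))"
      by (simp add: mult_exp_exp algebra_simps)
    have "lam * fst (\<omega> 0) - 2 * lam * site \<omega> (int j) + (1 - lam) * fst (\<omega> (int j)) \<le>
        2 * d + fst (\<omega> (int j)) - 2 * (lam * (d * real j))"
    proof (cases j)
      case 0
      then show ?thesis using d_pos by (simp add: site_0 algebra_simps)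
    next
      \<comment> \<open>Beyond the first gap only \<open>j - 1\<close> gaps remain to be bounded by
        \<open>d\<close>; the missing one costs \<open>2 * lam * d \<le> 2 * d\<close>, the origin
        of \<open>exp (2 * d)\<close>.\<close>
      case (Suc i)
      have "site \<omega> 1 = fst (\<omega> 0)" using site_add_1[of \<omega> 0] by (simp add: site_0)
      then have "fst (\<omega> 0) + d * (real j - 1) \<le> site \<omega> (int j)"
        using site_diff_ge[OF good, of 1 "int j"] Suc by simp
      then have "lam * (fst (\<omega> 0) + d * (real j - 1)) \<le> lam * site \<omega> (int j)"
        using lam by (intro mult_left_mono) auto
      moreover have "lam * d \<le> 1 * d" using lam lmax d_pos by (intro mult_right_mono) auto
      moreover have "0 \<le> lam * fst (\<omega> 0)" "0 \<le> lam * fst (\<omega> (int j))" using lam Z by auto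
      ultimately show ?thesis by (simp add: algebra_simps)
    qed
    then show ?thesis unfolding rhs mult_exp_exp by (simp add: algebra_simps)
  qed
  have "exp (lam * fst (\<omega> 0)) * resistance \<omega> =
      (\<Sum>j. exp (lam * fst (\<omega> 0)) * exp (- (2 * lam * site \<omega> (int j)) + (1 - lam) * fst (\<omega> (int j))))"
    unfolding resistance_def by (rule suminf_mult[symmetric]) (rule summable_resistance[OF reg])
  also have "\<dots> \<le> (\<Sum>j. exp (2 * d) * (exp (fst (\<omega> (int j))) * (decay\<^sup>2) ^ j))"
    by (intro suminf_le term_le summable_mult summable_resistance reg sum)
  also have "\<dots> = exp (2 * d) * exp_series (decay\<^sup>2) \<omega>"
    unfolding exp_series_def by (rule suminf_mult) (rule sum)
  finally show ?thesis .
qed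

lemma AE_density_le:
  "AE \<omega> in P. f \<omega> \<le> density_const * (lam * exp_series (decay\<^sup>2) \<omega>) * rate_sum 0 \<omega>"
  using AE_g_le AE_regular AE_summable_exp_series[OF decay2]
proof eventually_elim
  case (elim \<omega>)
  have good: "\<omega> \<in> good" using elim by (simp add: regular_def)
  have resistance_nonneg: "0 \<le> resistance \<omega>" unfolding resistance_def by (intro suminf_nonneg summable_resistance elim) simp
  have "max 0 mean_current \<le> 2 * drift_const * lam * mean_gap"
    using mean_current_le lam drift_const_nonneg mean_gap_pos by simp
  then have g: "g \<omega> \<le> 2 * drift_const * lam * mean_gap * (exp U * resistance \<omega>)"
    using elim(1) resistance_nonneg by (smt (verit) exp_ge_zero mult_nonneg_nonneg mult_right_mono)
  have "f \<omega> = g \<omega> * rate_sum lam \<omega>"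
    using rate_sum_pos[OF good lam_nonneg lam(2)] by (simp add: g_def)
  also have "\<dots> \<le> (2 * drift_const * lam * mean_gap * (exp U * resistance \<omega>)) *
      (ratio_const * exp (lam * fst (\<omega> 0)) * rate_sum 0 \<omega>)"
    using resistance_nonneg drift_const_nonneg lam mean_gap_pos
    by (intro mult_mono g rate_sum_le_unbiased good) (auto simp: rate_sum_nonneg)
  also have "\<dots> = 2 * drift_const * lam * mean_gap * exp U * ratio_const * rate_sum 0 \<omega> *
      (exp (lam * fst (\<omega> 0)) * resistance \<omega>)" by simp
  also have "\<dots> \<le> 2 * drift_const * lam * mean_gap * exp U * ratio_const * rate_sum 0 \<omega> *
      (exp (2 * d) * exp_series (decay\<^sup>2) \<omega>)"
    using drift_const_nonneg lam mean_gap_pos ratio_const_pos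
    by (intro mult_left_mono exp_mult_resistance_le elim) (auto simp: rate_sum_nonneg)
  also have "\<dots> = density_const * (lam * exp_series (decay\<^sup>2) \<omega>) * rate_sum 0 \<omega>"
    by (simp add: density_const_def)
  finally show ?case .
qed

text \<open>The cancellation that makes the bound uniform: \<open>1 - exp (- x)\<close> is at least
  \<open>x / (1 + x)\<close>, here with \<open>x = 2 * lam * d\<close>.\<close>

lemma lam_over_decay: "lam / (1 - decay\<^sup>2) \<le> (1 + 2 * d) / (2 * d)"
proof -
  define x where "x = 2 * lam * d"
  have x: "0 < x" using lam d_pos by (simp add: x_def)
  have "decay\<^sup>2 = exp (- x)"
    by (simp add: decay_def power2_eq_square mult_exp_exp x_def)
  moreover have "exp (- x) \<le> 1 / (1 + x)"
    using exp_ge_add_one_self[of x] x by (simp add: exp_minus field_simps)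
  ultimately have "x / (1 + x) \<le> 1 - decay\<^sup>2" using x by (simp add: field_simps)
  then have "lam / (1 - decay\<^sup>2) \<le> lam / (x / (1 + x))"
    using lam x decay2 by (intro divide_left_mono mult_pos_pos) auto
  also have "\<dots> = (1 + x) / (2 * d)" using lam d_pos by (simp add: x_def field_simps)
  also have "\<dots> \<le> (1 + 2 * d) / (2 * d)"
    using lam lmax d_pos by (intro divide_right_mono) (auto simp: x_def)
  finally show ?thesis .
qed

end

section \<open>The reversible law and the moment bound\<close>

context mott_environment
begin

definition mean_rate :: real where "mean_rate = (\<integral>\<omega>. rate_sum 0 \<omega> \<partial>P)"

definition unbiased_law :: "environment measure" where
  "unbiased_law = density P (\<lambda>\<omega>. ennreal (rate_sum 0 \<omega> / mean_rate))"

lemma sets_unbiased_law [measurable_cong, simp]: "sets unbiased_law = sets env_space"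
  by (simp add: unbiased_law_def sets_P)

lemma AE_rate_sum_0: "AE \<omega> in P. 0 < rate_sum 0 \<omega> \<and> rate_sum 0 \<omega> \<le> rate_const"
  using AE_good by eventually_elim (use rate_sum_pos rate_sum_le lmax in auto)

lemma integrable_rate_sum_0: "integrable P (rate_sum 0)"
proof (rule integrable_const_bound)
  show "AE \<omega> in P. norm (rate_sum 0 \<omega>) \<le> rate_const"
    using AE_rate_sum_0 by eventually_elim simp
qed measurable

lemma mean_rate_pos: "0 < mean_rate"
proof -
  have "(\<integral>\<omega>. 0 \<partial>P) < (\<integral>\<omega>. rate_sum 0 \<omega> \<partial>P)"
    using AE_rate_sum_0 integrable_rate_sum_0
    by (intro integral_less_AE_space) (auto simp: emeasure_space_1)
  then show ?thesis by (simp add: mean_rate_def)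
qed

lemma prob_space_unbiased_law: "prob_space unbiased_law"
proof
  have "emeasure unbiased_law (space unbiased_law) = (\<integral>\<^sup>+\<omega>. ennreal (rate_sum 0 \<omega> / mean_rate) \<partial>P)"
    by (simp add: unbiased_law_def emeasure_density cong: nn_integral_cong)
  also have "\<dots> = ennreal (\<integral>\<omega>. rate_sum 0 \<omega> / mean_rate \<partial>P)"
    using integrable_rate_sum_0 mean_rate_pos rate_sum_nonneg
    by (intro nn_integral_eq_integral) auto
  also have "\<dots> = 1" using mean_rate_pos by (simp add: mean_rate_def[symmetric])
  finally show "emeasure unbiased_law (space unbiased_law) = 1" .
qed

end

text \<open>The density with respect to the reversible law divides \<open>f\<close> by the unbiased
  total rate, which is a factor of the bound on \<open>f\<close> and cancels. What remains is
  \<open>lam\<close> times \<open>exp_series\<close>, whose moments are known.\<close>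

lemma (in mott_stationary_density) Lp_moment_bound:
  assumes p: "1 \<le> p" and Q: "density P (\<lambda>\<omega>. ennreal (f \<omega>)) = Q"
  shows "(\<integral>\<^sup>+\<omega>. ennreal (\<bar>enn2real (RN_deriv unbiased_law Q \<omega>)\<bar> powr p) \<partial>unbiased_law) \<le>
    ennreal (rate_const / mean_rate * (mean_rate * density_const * ((1 + 2 * d) / (2 * d))) powr p) *
      (\<integral>\<^sup>+\<omega>. ennreal (exp (p * fst (\<omega> 0))) \<partial>P)"
proof -
  interpret U: prob_space unbiased_law by (rule prob_space_unbiased_law)
  define D where "D \<omega> = f \<omega> * mean_rate / rate_sum 0 \<omega>" for \<omega>
  have [measurable]: "D \<in> borel_measurable env_space" unfolding D_def [abs_def] by measurable
  have D0: "0 \<le> D \<omega>" for \<omega>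
    using f_nonneg mean_rate_pos rate_sum_nonneg by (simp add: D_def)
  have "density unbiased_law (\<lambda>\<omega>. ennreal (D \<omega>)) = density P (\<lambda>\<omega>. ennreal (rate_sum 0 \<omega> / mean_rate) * ennreal (D \<omega>))"
    unfolding unbiased_law_def by (rule density_density_eq) measurable
  also have "\<dots> = density P (\<lambda>\<omega>. ennreal (f \<omega>))"
  proof (rule density_cong)
    show "AE \<omega> in P. ennreal (rate_sum 0 \<omega> / mean_rate) * ennreal (D \<omega>) = ennreal (f \<omega>)"
      using AE_rate_sum_0
    proof eventually_elim
      case (elim \<omega>)
      then show ?case
        using mean_rate_pos D0 by (subst ennreal_mult[symmetric]) (auto simp: D_def)
    qed
  qed measurable
  finally have "density unbiased_law (\<lambda>\<omega>. ennreal (D \<omega>)) = Q" by (simp add: Q)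
  then have RN: "AE \<omega> in unbiased_law. ennreal (D \<omega>) = RN_deriv unbiased_law Q \<omega>"
    by (intro U.RN_deriv_unique) measurable
  let ?c = "mean_rate * density_const * lam"
  have "(\<integral>\<^sup>+\<omega>. ennreal (\<bar>enn2real (RN_deriv unbiased_law Q \<omega>)\<bar> powr p) \<partial>unbiased_law) =
      (\<integral>\<^sup>+\<omega>. ennreal (D \<omega> powr p) \<partial>unbiased_law)"
    using RN by (intro nn_integral_cong_AE, eventually_elim) (metis D0 abs_of_nonneg enn2real_ennreal)
  also have "\<dots> = (\<integral>\<^sup>+\<omega>. ennreal (rate_sum 0 \<omega> / mean_rate) * ennreal (D \<omega> powr p) \<partial>P)"
    unfolding unbiased_law_def by (rule nn_integral_density) measurable
  also have "\<dots> \<le> (\<integral>\<^sup>+\<omega>. ennreal (rate_const / mean_rate * ?c powr p) * ennreal (exp_series (decay\<^sup>2) \<omega> powr p) \<partial>P)"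
  proof (rule nn_integral_mono_AE)
    show "AE \<omega> in P. ennreal (rate_sum 0 \<omega> / mean_rate) * ennreal (D \<omega> powr p) \<le>
        ennreal (rate_const / mean_rate * ?c powr p) * ennreal (exp_series (decay\<^sup>2) \<omega> powr p)"
      using AE_rate_sum_0 AE_density_le
    proof eventually_elim
      case (elim \<omega>)
      have "D \<omega> \<le> density_const * (lam * exp_series (decay\<^sup>2) \<omega>) * rate_sum 0 \<omega> * mean_rate / rate_sum 0 \<omega>"
        unfolding D_def using elim mean_rate_pos by (intro divide_right_mono mult_right_mono) auto
      then have "D \<omega> \<le> ?c * exp_series (decay\<^sup>2) \<omega>" using elim by (simp add: mult_ac)
      then have "D \<omega> powr p \<le> (?c * exp_series (decay\<^sup>2) \<omega>) powr p"
        using D0 p by (intro powr_mono2) auto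
      also have "\<dots> = ?c powr p * exp_series (decay\<^sup>2) \<omega> powr p"
        by (rule powr_mult)
      finally have "rate_sum 0 \<omega> / mean_rate * D \<omega> powr p \<le>
          rate_const / mean_rate * (?c powr p * exp_series (decay\<^sup>2) \<omega> powr p)"
        using elim mean_rate_pos by (intro mult_mono divide_right_mono) auto
      then show ?case
        using elim mean_rate_pos
        by (subst (1 2) ennreal_mult[symmetric]) (auto intro!: ennreal_leI simp: mult.assoc)
    qed
  qed
  also have "\<dots> = ennreal (rate_const / mean_rate * ?c powr p) * (\<integral>\<^sup>+\<omega>. ennreal (exp_series (decay\<^sup>2) \<omega> powr p) \<partial>P)"
    by (rule nn_integral_cmult) measurable
  also have "\<dots> \<le> ennreal (rate_const / mean_rate * ?c powr p) *
      (ennreal ((1 / (1 - decay\<^sup>2)) powr p) * (\<integral>\<^sup>+\<omega>. ennreal (exp (p * fst (\<omega> 0))) \<partial>P))"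
    by (intro mult_left_mono exp_series_moment decay2 p) simp
  also have "\<dots> = ennreal (rate_const / mean_rate * ?c powr p * (1 / (1 - decay\<^sup>2)) powr p) *
      (\<integral>\<^sup>+\<omega>. ennreal (exp (p * fst (\<omega> 0))) \<partial>P)"
    by (subst ennreal_mult'') (auto simp: mult.assoc)
  also have "\<dots> \<le> ennreal (rate_const / mean_rate * (mean_rate * density_const * ((1 + 2 * d) / (2 * d))) powr p) *
      (\<integral>\<^sup>+\<omega>. ennreal (exp (p * fst (\<omega> 0))) \<partial>P)"
  proof (intro mult_right_mono ennreal_leI)
    have "?c powr p * (1 / (1 - decay\<^sup>2)) powr p = (?c * (1 / (1 - decay\<^sup>2))) powr p"
      by (rule powr_mult[symmetric])
    also have "?c * (1 / (1 - decay\<^sup>2)) = mean_rate * density_const * (lam / (1 - decay\<^sup>2))" by simp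
    also have "\<dots> powr p \<le> (mean_rate * density_const * ((1 + 2 * d) / (2 * d))) powr p"
      using lam_over_decay mean_rate_pos density_const_nonneg p decay2 lam
      by (intro powr_mono2 mult_left_mono) auto
    finally have *: "?c powr p * (1 / (1 - decay\<^sup>2)) powr p \<le> \<dots>" .
    have "0 \<le> rate_const"
      using \<rho> by (auto simp: rate_const_def intro!: mult_nonneg_nonneg infsum_nonneg)
    with mult_left_mono[OF *, of "rate_const / mean_rate"] mean_rate_pos
    show "rate_const / mean_rate * ?c powr p * (1 / (1 - decay\<^sup>2)) powr p \<le>
        rate_const / mean_rate * (mean_rate * density_const * ((1 + 2 * d) / (2 * d))) powr p"
      by (simp add: mult.assoc)
  qed simp
  finally show ?thesis .
qed

section \<open>From the kernel to a stationary density\<close>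

lemma emeasure_env_kernel:
  assumes "\<omega> \<in> space env_space" "A \<in> sets env_space"
  shows "emeasure (env_kernel u lam \<omega>) A =
    (\<integral>\<^sup>+k. ennreal (mott_prob u lam \<omega> 0 k) * indicator A (shift k \<omega>) \<partial>count_space UNIV)"
proof -
  have "(\<lambda>k. shift k \<omega>) \<in> density (count_space UNIV) (\<lambda>k. ennreal (mott_prob u lam \<omega> 0 k)) \<rightarrow>\<^sub>M env_space"
    using assms(1) by (auto simp: shift_in_space)
  then have "emeasure (env_kernel u lam \<omega>) A =
      emeasure (density (count_space UNIV) (\<lambda>k. ennreal (mott_prob u lam \<omega> 0 k))) ((\<lambda>k. shift k \<omega>) -` A)"
    using assms(2) by (simp add: env_kernel_def emeasure_distr)
  also have "\<dots> = (\<integral>\<^sup>+k. ennreal (mott_prob u lam \<omega> 0 k) * indicator ((\<lambda>k. shift k \<omega>) -` A) k \<partial>count_space UNIV)"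
    by (rule emeasure_density) auto
  finally show ?thesis by (simp add: indicator_def)
qed

lemma (in mott_environment) steady_state_density:
  assumes lam: "0 < lam" "lam \<le> lmax" and steady: "steady_state P u lam Q"
  obtains f where "mott_stationary_density P u U d lmax lam f" "density P (\<lambda>\<omega>. ennreal (f \<omega>)) = Q"
proof -
  have setsQ: "sets Q = sets env_space" and ac: "absolutely_continuous P Q"
    and inv: "invariant_distribution Q (env_kernel u lam)"
    using steady by (auto simp: steady_state_def)
  interpret Q: prob_space Q using inv by (simp add: invariant_distribution_def)
  define f where "f \<omega> = enn2real (RN_deriv P Q \<omega>)" for \<omega>
  have [measurable]: "f \<in> borel_measurable env_space"
  proof -
    have "f \<in> borel_measurable P" unfolding f_def [abs_def] by measurable
    then show ?thesis by (simp cong: measurable_cong_sets add: sets_P)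
  qed
  have sPQ: "sets Q = sets P" by (simp add: setsQ sets_P)
  have fin: "AE \<omega> in P. RN_deriv P Q \<omega> \<noteq> \<infinity>"
    by (rule RN_deriv_finite[OF Q.sigma_finite_measure_axioms ac sPQ])
  have "density P (\<lambda>\<omega>. ennreal (f \<omega>)) = density P (RN_deriv P Q)"
  proof (rule density_cong)
    show "AE \<omega> in P. ennreal (f \<omega>) = RN_deriv P Q \<omega>"
      using fin by eventually_elim (simp add: f_def less_top)
  qed measurable
  also have "\<dots> = Q" by (rule density_RN_deriv[OF ac sPQ])
  finally have Q: "density P (\<lambda>\<omega>. ennreal (f \<omega>)) = Q" .
  have "mott_stationary_density P u U d lmax lam f"
  proof
    show "(\<integral>\<^sup>+\<omega>. ennreal (f \<omega>) \<partial>P) = 1"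
    proof -
      have "(\<integral>\<^sup>+\<omega>. ennreal (f \<omega>) \<partial>P) = emeasure (density P (\<lambda>\<omega>. ennreal (f \<omega>))) (space P)"
        by (simp add: emeasure_density cong: nn_integral_cong)
      also have "space P = space Q" using sPQ by (metis sets_eq_imp_space_eq)
      finally show ?thesis by (simp add: Q Q.emeasure_space_1)
    qed
    fix A assume A [measurable]: "A \<in> sets env_space"
    have mp [measurable]: "(\<lambda>\<omega>. mott_prob u lam \<omega> 0 k) \<in> borel_measurable env_space" for k
      unfolding mott_prob_def by (intro borel_measurable_divide measurable_mott_rate borel_measurable_infsum)
    have mp0: "0 \<le> mott_prob u lam \<omega> 0 k" for \<omega> k
      unfolding mott_prob_def by (intro divide_nonneg_nonneg infsum_nonneg mott_rate_nonneg)
    let ?K = "\<lambda>\<omega>. \<integral>\<^sup>+k. ennreal (mott_prob u lam \<omega> 0 k) * indicator A (shift k \<omega>) \<partial>count_space UNIV"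
    have K [measurable]: "?K \<in> borel_measurable env_space"
      by (rule borel_measurable_nn_integral_count_space) measurable
    have "(\<integral>\<^sup>+\<omega>. ?K \<omega> \<partial>Q) = (\<integral>\<^sup>+\<omega>. emeasure (env_kernel u lam \<omega>) A \<partial>Q)"
      by (intro nn_integral_cong emeasure_env_kernel[symmetric] A)
        (use setsQ in \<open>auto dest: sets_eq_imp_space_eq\<close>)
    also have "\<dots> = emeasure Q A"
      using inv A by (simp add: invariant_distribution_def setsQ)
    also have "\<dots> = (\<integral>\<^sup>+\<omega>. ennreal (f \<omega>) * indicator A \<omega> \<partial>P)"
      by (subst Q[symmetric], rule emeasure_density) measurable
    also have "(\<integral>\<^sup>+\<omega>. ?K \<omega> \<partial>Q) = (\<integral>\<^sup>+\<omega>. ennreal (f \<omega>) * ?K \<omega> \<partial>P)"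
      by (subst Q[symmetric], rule nn_integral_density) measurable
    also have "\<dots> = (\<integral>\<^sup>+\<omega>. (\<integral>\<^sup>+k. ennreal (f \<omega> * mott_prob u lam \<omega> 0 k) * indicator A (shift k \<omega>) \<partial>count_space UNIV) \<partial>P)"
    proof (rule nn_integral_cong)
      fix \<omega>
      show "ennreal (f \<omega>) * ?K \<omega> =
          (\<integral>\<^sup>+k. ennreal (f \<omega> * mott_prob u lam \<omega> 0 k) * indicator A (shift k \<omega>) \<partial>count_space UNIV)"
        by (subst nn_integral_cmult[symmetric]) (auto simp: ennreal_mult mp0 f_def mult.assoc)
    qed
    finally show "(\<integral>\<^sup>+\<omega>. (\<integral>\<^sup>+k. ennreal (f \<omega> * mott_prob u lam \<omega> 0 k) * indicator A (shift k \<omega>) \<partial>count_space UNIV) \<partial>P) =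
        (\<integral>\<^sup>+\<omega>. ennreal (f \<omega>) * indicator A \<omega> \<partial>P)" .
  qed (use lam in \<open>auto simp: f_def\<close>)
  then show ?thesis using Q by (rule that)
qed

lemma Lp_norm_le:
  assumes "(\<integral>\<^sup>+x. ennreal (\<bar>f x\<bar> powr p) \<partial>M) \<le> ennreal K" "0 < p" "0 \<le> K"
  shows "Lp_norm p M f \<le> ennreal (K powr (1 / p))"
proof -
  define I where "I = (\<integral>\<^sup>+x. ennreal (\<bar>f x\<bar> powr p) \<partial>M)"
  have "I < \<infinity>" using assms(1) by (auto simp: I_def intro: le_less_trans)
  moreover have "enn2real I \<le> K" using assms by (simp add: I_def enn2real_leI)
  ultimately show ?thesis
    using assms by (auto simp: Lp_norm_def Let_def I_def[symmetric] intro!: ennreal_leI powr_mono2)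
qed

theorem theorem1:
  fixes P :: "environment measure"
    and u :: "real \<Rightarrow> real \<Rightarrow> real"
    and Q :: "real \<Rightarrow> environment measure"
    and lmax p :: real
  assumes "stationary_ergodic_environment P"
    and "\<And>x y. u x y = u y x"
    and "bounded (range (\<lambda>(x, y). u x y))"
    and "continuous_on UNIV (\<lambda>(x, y). u x y)"
    and "0 < lmax" and "lmax < 1"
    and "2 \<le> p"
    and "integrable P (\<lambda>\<omega>. exp (p * fst (\<omega> 0)))"
    and "Q 0 = reversible_law P u"
    and "\<And>lam. 0 < lam \<Longrightarrow> lam \<le> lmax \<Longrightarrow> steady_state P u lam (Q lam)"
  shows "(SUP lam\<in>{0..lmax}. Lp_norm p (Q 0) (\<lambda>\<omega>. enn2real (RN_deriv (Q 0) (Q lam) \<omega>))) < \<infinity>"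
proof -
  interpret stationary_ergodic_environment P by fact
  obtain U where U: "\<And>x y. \<bar>u x y\<bar> \<le> U"
    using assms(3) by (auto simp: bounded_iff)
  obtain d where d: "0 < d" "AE \<omega> in P. d \<le> fst (\<omega> 0)"
    using Z0_bounded_below by blast
  have [measurable_cong]: "sets P = sets env_space" by (rule sets_P)
  have exp_int: "integrable P (\<lambda>\<omega>. exp (fst (\<omega> 0)))"
  proof (rule Bochner_Integration.integrable_bound[OF assms(8)])
    show "AE \<omega> in P. norm (exp (fst (\<omega> 0))) \<le> norm (exp (p * fst (\<omega> 0)))"
      using d(2)
    proof eventually_elim
      case (elim \<omega>)
      then have "1 * fst (\<omega> 0) \<le> p * fst (\<omega> 0)"
        using assms(7) d(1) by (intro mult_right_mono) auto
      then show ?case by simp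
    qed
  qed measurable
  interpret mott_environment P u U d lmax
    by unfold_locales
      (use assms U d exp_int in \<open>auto intro: borel_measurable_continuous_onI\<close>)
  have Q0: "Q 0 = unbiased_law"
    by (simp add: assms(9) reversible_law_def unbiased_law_def mean_rate_def rate_sum_def total_rate_def)
  interpret Q0: prob_space unbiased_law by (rule prob_space_unbiased_law)
  define c where "c = rate_const / mean_rate * (mean_rate * density_const * ((1 + 2 * d) / (2 * d))) powr p"
  define m where "m = (\<integral>\<omega>. exp (p * fst (\<omega> 0)) \<partial>P)"
  \<comment> \<open>The value 1 covers the unbiased walk: there the resistance argument has no decay
    to work with, but the density is identically 1.\<close>
  define K where "K = max 1 (c * m)"
  have "(\<integral>\<^sup>+\<omega>. ennreal (\<bar>enn2real (RN_deriv (Q 0) (Q lam) \<omega>)\<bar> powr p) \<partial>Q 0) \<le> ennreal K"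
    if lam: "0 \<le> lam" "lam \<le> lmax" for lam
  proof (cases "lam = 0")
    case True
    have "density unbiased_law (\<lambda>_. 1) = unbiased_law" by (rule density_1)
    then have "AE \<omega> in unbiased_law. 1 = RN_deriv unbiased_law unbiased_law \<omega>"
      by (intro Q0.RN_deriv_unique) auto
    then have "(\<integral>\<^sup>+\<omega>. ennreal (\<bar>enn2real (RN_deriv unbiased_law unbiased_law \<omega>)\<bar> powr p) \<partial>unbiased_law) =
        (\<integral>\<^sup>+\<omega>. 1 \<partial>unbiased_law)"
      by (intro nn_integral_cong_AE, eventually_elim) (metis abs_one enn2real_1 ennreal_1 powr_one_eq_one)
    also have "\<dots> = 1" by (simp add: Q0.emeasure_space_1)
    also have "\<dots> \<le> ennreal K" by (simp add: K_def)
    finally show ?thesis by (simp add: True Q0)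
  next
    case False
    with lam have "0 < lam" by simp
    from steady_state_density[OF this lam(2) assms(10)[OF this lam(2)]]
    obtain f where f: "mott_stationary_density P u U d lmax lam f" "density P (\<lambda>\<omega>. ennreal (f \<omega>)) = Q lam" .
    have "(\<integral>\<^sup>+\<omega>. ennreal (\<bar>enn2real (RN_deriv unbiased_law (Q lam) \<omega>)\<bar> powr p) \<partial>unbiased_law) \<le>
        ennreal c * (\<integral>\<^sup>+\<omega>. ennreal (exp (p * fst (\<omega> 0))) \<partial>P)"
      unfolding c_def using assms(7) by (intro mott_stationary_density.Lp_moment_bound[OF f(1) _ f(2)]) simp
    also have "\<dots> = ennreal c * ennreal m"
      using nn_integral_eq_integral[OF assms(8)] by (simp add: m_def)
    also have "\<dots> = ennreal (c * m)"
      by (rule ennreal_mult''[symmetric]) (simp add: m_def)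
    also have "\<dots> \<le> ennreal K" by (intro ennreal_leI) (simp add: K_def)
    finally show ?thesis by (simp add: Q0)
  qed
  then have "(SUP lam\<in>{0..lmax}. Lp_norm p (Q 0) (\<lambda>\<omega>. enn2real (RN_deriv (Q 0) (Q lam) \<omega>))) \<le> ennreal (K powr (1 / p))"
    using assms(7) by (intro SUP_least Lp_norm_le) (auto simp: K_def)
  also have "\<dots> < \<infinity>" by simp
  finally show ?thesis .
qed

end
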